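(* Let $0<\alpha\le 2$, let $f\in\Phi_\infty(\alpha)$ with Schoenberg measure $\sigma$, i.e. $f(t)=\int_0^\infty e^{-st^\alpha}\,\sigma(ds)$ for $t\ge 0$ with $\sigma$ a probability measure on $[0,\infty)$, and let $X=\{x_k\}_{k\in\mathbb{N}}\subset\mathbb{R}^n$ be a separated sequence of distinct points with $x_1=0$. Then: (i) $f$ is strongly $X$-positive definite. In particular, if the Schoenberg matrix $\mathcal{S}_X(f)=\|f(|x_i-x_j|)\|_{i,j\in\mathbb{N}}$ generates an operator $S_X(f)$ on $\ell^2(\mathbb{N})$, then $S_X(f)$ is positive definite and so invertible. (ii) If $$\int_0^\infty s^{-d/\alpha}\,\sigma(ds)<\infty,\qquad d=\dim\mathcal{L}(X),\qquad ( * )$$ then $\mathcal{S}_X(f)$ generates a bounded (necessarily invertible) operator on $\ell^2(\mathbb{N})$. (iii) Conversely, let $\mathcal{S}_Y(f)$ generate a bounded operator $S_Y(f)$ on $\ell^2(\mathbb{N})$ for at least one $\delta$-regular set $Y$ with $\dim\mathcal{L}(Y)=d$. Then the integral condition in $( * )$ holds for this $d$.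
   Context: $\Phi_\infty(\alpha)$, $0<\alpha\le2$, is the class of functions $f(t)=\int_0^\infty e^{-st^\alpha}\sigma(ds)$, $t\ge0$, with $\sigma$ a (Borel) probability measure on $[0,\infty)$, called the Schoenberg measure of $f$. For a sequence $X=\{x_k\}_{k\in\mathbb{N}}$ of distinct points in $\mathbb{R}^n$, $d_*(X)=\inf_{i\ne j}|x_i-x_j|$, and $X$ is separated if $d_*(X)>0$. Sequences are normalized so that the first point is the origin; $\mathcal{L}(X)$ is the linear span of $X$. $f$ is strongly $X$-positive definite if there is $c=c(X)>0$ such that $\sum_{k,j=1}^m f(|x_k-x_j|)\xi_j\overline{\xi_k}\ge c\sum_{k=1}^m|\xi_k|^2$ for every $m$, every finite set $\{x_1,\dots,x_m\}$ of distinct points of $X$ and every $(\xi_1,\dots,\xi_m)\in\mathbb{C}^m$. The matrix $\mathcal{S}_X(f)$ generates an operator $S_X(f)$ on $\ell^2(\mathbb{N})$ if all its columns belong to $\ell^2(\mathbb{N})$; then $S_X(f)$ is the minimal operator, i.e. the closure of the operator defined on finite linear combinations of the standard basis $\{e_j\}$ by $e_j\mapsto\sum_k f(|x_k-x_j|)e_k$. It is positive definite if $\langle S_X(f)h,h\rangle\ge\varepsilon\|h\|^2$ for all $h\in\operatorname{dom}S_X(f)$ with some $\varepsilon>0$ independent of $h$. "Invertible" means having a bounded inverse (on the range, when $S_X(f)$ is unbounded; everywhere defined when $S_X(f)$ is bounded). A separated sequence $Y=\{y_j\}_{j\in\mathbb{N}}$ (with $y_1=0$) with $\dim\mathcal{L}(Y)=d$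 is $\delta$-regular ($\delta>0$) if there are constants $c_0>0$, $r_0\ge0$, independent of $j$, such that the number of $y_k\in Y$ with $r\le|y_k-y_j|<r+\delta$ is at least $c_0r^{d-1}$ for all $r\ge r_0$, $j\in\mathbb{N}$.
   Formalization: The first sentence of (i) is proved for non-constant f only: if σ is the unit mass at 0, then f ≡ 1 and the quadratic form vanishes at ξ = (1, −1), so f is not strongly X-positive definite. All other claims are proved without this restriction. *)

theory Defs
  imports "HOL-Probability.Probability" "HOL-Library.Complex_Order"
begin

subsection \<open>The classes \<open>\<Phi>\<^sub>\<infinity>(\<alpha>)\<close> and Schoenberg measures\<close>

definition schoenberg_measure :: "real \<Rightarrow> (real \<Rightarrow> real) \<Rightarrow> real measure \<Rightarrow> bool" where
  "schoenberg_measure \<alpha> f \<sigma> \<longleftrightarrow>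
     prob_space \<sigma> \<and> sets \<sigma> = sets (restrict_space borel {0..}) \<and>
     (\<forall>t\<ge>0. f t = (\<integral>s. exp (- s * t powr \<alpha>) \<partial>\<sigma>))"

definition Phi_infty :: "real \<Rightarrow> (real \<Rightarrow> real) set" where
  "Phi_infty \<alpha> = {f. \<exists>\<sigma>. schoenberg_measure \<alpha> f \<sigma>}"

text \<open>
  The integrand is \<open>s\<^bsup>-p\<^esup>\<close> with value \<open>\<infinity>\<close> at \<open>s = 0\<close>, as it should be for \<open>p > 0\<close>:
  there \<open>0 powr p = 0\<close> and \<open>inverse 0 = \<infinity>\<close> in \<^typ>\<open>ennreal\<close>.  (Writing
  \<open>s powr (- p)\<close> instead would give the value \<open>0\<close> at \<open>s = 0\<close>.)
\<close>
definition negative_moment :: "real measure \<Rightarrow> real \<Rightarrow> ennreal" where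
  "negative_moment \<sigma> p = (\<integral>\<^sup>+s. inverse (ennreal (s powr p)) \<partial>\<sigma>)"

subsection \<open>Point sequences\<close>

definition d_star :: "(nat \<Rightarrow> 'a::real_normed_vector) \<Rightarrow> real" where
  "d_star X = (INF (i, j)\<in>{(i, j). i \<noteq> j}. norm (X i - X j))"

definition separated :: "(nat \<Rightarrow> 'a::real_normed_vector) \<Rightarrow> bool" where
  "separated X \<longleftrightarrow> d_star X > 0"

text \<open>The index set is \<open>{0, 1, 2, \<dots>}\<close>, so the first point of a sequence is \<open>X 0\<close>.\<close>
definition normalized_sequence :: "(nat \<Rightarrow> 'a::real_normed_vector) \<Rightarrow> bool" where
  "normalized_sequence X \<longleftrightarrow> inj X \<and> X 0 = 0"

definition span_dim :: "(nat \<Rightarrow> 'a::euclidean_space) \<Rightarrow> nat" where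
  "span_dim X = dim (span (range X))"

text \<open>
  Separation makes the sets of points counted here finite, and injectivity makes the
  dimension positive, so neither \<^const>\<open>card\<close> nor the natural number subtraction
  takes a default value.
\<close>
definition delta_regular :: "real \<Rightarrow> (nat \<Rightarrow> 'a::euclidean_space) \<Rightarrow> bool" where
  "delta_regular \<delta> Y \<longleftrightarrow>
     \<delta> > 0 \<and> normalized_sequence Y \<and> separated Y \<and>
     (\<exists>c0>0. \<exists>r0\<ge>0. \<forall>j. \<forall>r\<ge>r0.
        c0 * r ^ (span_dim Y - 1) \<le>
        real (card {y \<in> range Y. r \<le> norm (y - Y j) \<and> norm (y - Y j) < r + \<delta>}))"

text \<open>
  The order on \<^typ>\<open>complex\<close> is that of \<^theory>\<open>HOL-Library.Complex_Order\<close>: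
  \<open>z \<le> w\<close> means \<open>Re z \<le> Re w\<close> and \<open>Im z = Im w\<close>.
\<close>
definition strongly_positive_definite ::
    "'a::real_normed_vector set \<Rightarrow> (real \<Rightarrow> real) \<Rightarrow> bool" where
  "strongly_positive_definite P f \<longleftrightarrow>
     (\<exists>c>0. \<forall>m. \<forall>x :: nat \<Rightarrow> 'a. \<forall>\<xi> :: nat \<Rightarrow> complex.
        inj_on x {..<m} \<and> x ` {..<m} \<subseteq> P \<longrightarrow>
        complex_of_real (c * (\<Sum>k<m. (cmod (\<xi> k))\<^sup>2)) \<le>
        (\<Sum>k<m. \<Sum>j<m. complex_of_real (f (norm (x k - x j))) * \<xi> j * cnj (\<xi> k)))"

subsection \<open>Operators on \<open>\<ell>\<^sup>2(\<nat>)\<close> generated by matrices\<close>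

definition ell2 :: "(nat \<Rightarrow> complex) set" where
  "ell2 = {h. summable (\<lambda>k. (cmod (h k))\<^sup>2)}"

definition ell2_norm :: "(nat \<Rightarrow> complex) \<Rightarrow> real" where
  "ell2_norm h = sqrt (\<Sum>k. (cmod (h k))\<^sup>2)"

definition ell2_inner :: "(nat \<Rightarrow> complex) \<Rightarrow> (nat \<Rightarrow> complex) \<Rightarrow> complex" where
  "ell2_inner g h = (\<Sum>k. g k * cnj (h k))"

definition finite_sequences :: "(nat \<Rightarrow> complex) set" where
  "finite_sequences = {u. finite {j. u j \<noteq> 0}}"

text \<open>
  The linear extension of \<open>e\<^sub>j \<mapsto> \<Sum>\<^sub>k A k j e\<^sub>k\<close> to the finite linear
  combinations of the standard basis.
\<close>
definition matrix_apply ::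
    "(nat \<Rightarrow> nat \<Rightarrow> complex) \<Rightarrow> (nat \<Rightarrow> complex) \<Rightarrow> nat \<Rightarrow> complex" where
  "matrix_apply A u k = (\<Sum>j | u j \<noteq> 0. A k j * u j)"

definition generates_operator :: "(nat \<Rightarrow> nat \<Rightarrow> complex) \<Rightarrow> bool" where
  "generates_operator A \<longleftrightarrow> (\<forall>j. (\<lambda>k. A k j) \<in> ell2)"

text \<open>
  A not necessarily bounded or everywhere defined operator \<open>T\<close> is represented by its
  graph: \<open>(h, g) \<in> T\<close> means \<open>h \<in> dom T\<close> and \<open>T h = g\<close>.  The minimal operator is
  the closure, in \<open>\<ell>\<^sup>2 \<times> \<ell>\<^sup>2\<close>, of the graph on finite sequences.
\<close>
type_synonym ell2_graph = "((nat \<Rightarrow> complex) \<times> (nat \<Rightarrow> complex)) set"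

definition minimal_operator :: "(nat \<Rightarrow> nat \<Rightarrow> complex) \<Rightarrow> ell2_graph" where
  "minimal_operator A =
     {(h, g). h \<in> ell2 \<and> g \<in> ell2 \<and>
        (\<exists>u :: nat \<Rightarrow> nat \<Rightarrow> complex. (\<forall>n. u n \<in> finite_sequences) \<and>
           (\<lambda>n. ell2_norm (\<lambda>k. u n k - h k)) \<longlonglongrightarrow> 0 \<and>
           (\<lambda>n. ell2_norm (\<lambda>k. matrix_apply A (u n) k - g k)) \<longlonglongrightarrow> 0)}"

definition bounded_operator :: "ell2_graph \<Rightarrow> bool" where
  "bounded_operator T \<longleftrightarrow>
     single_valued T \<and> Domain T = ell2 \<and>
     (\<exists>C. \<forall>(h, g)\<in>T. ell2_norm g \<le> C * ell2_norm h)"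

definition positive_definite_operator :: "ell2_graph \<Rightarrow> bool" where
  "positive_definite_operator T \<longleftrightarrow>
     single_valued T \<and>
     (\<exists>\<epsilon>>0. \<forall>(h, g)\<in>T. complex_of_real (\<epsilon> * (ell2_norm h)\<^sup>2) \<le> ell2_inner g h)"

text \<open>
  The inverse is bounded on the range; for bounded operators it is moreover required to
  be everywhere defined.
\<close>
definition invertible_operator :: "ell2_graph \<Rightarrow> bool" where
  "invertible_operator T \<longleftrightarrow>
     single_valued T \<and> single_valued (T\<inverse>) \<and>
     (\<exists>C. \<forall>(h, g)\<in>T. ell2_norm h \<le> C * ell2_norm g) \<and>
     (bounded_operator T \<longrightarrow> Range T = ell2)"

definition generates_bounded_operator :: "(nat \<Rightarrow> nat \<Rightarrow> complex) \<Rightarrow> bool" where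
  "generates_bounded_operator A \<longleftrightarrow>
     generates_operator A \<and> bounded_operator (minimal_operator A)"

definition schoenberg_matrix ::
    "(nat \<Rightarrow> 'a::real_normed_vector) \<Rightarrow> (real \<Rightarrow> real) \<Rightarrow> nat \<Rightarrow> nat \<Rightarrow> complex" where
  "schoenberg_matrix X f i j = complex_of_real (f (norm (X i - X j)))"

end

theory Submission
  imports Defs
begin

text \<open>
  By Schur's product theorem it suffices for (i) to bound one kernel \<open>exp (- s |x|\<^bsup>\<alpha>\<^esup>)\<close>, \<open>s > 0\<close>, from
  below by a positive multiple of the identity on every separated set. For \<open>\<alpha> = 2\<close> the Gaussian
  dominates, in the order of positive semidefinite kernels, a product of powers of Fejer kernels, whose
  matrix is diagonally dominant when the kernels are narrow. For \<open>\<alpha> < 2\<close> one writes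
  \<open>|x|\<^bsup>\<alpha>\<^esup>\<close> as an integral of \<open>1 - exp (- u |x|\<^sup>2)\<close> and expands the exponential. Part (ii) is Schur's test
  together with the packing estimate \<open>\<Sum>\<^sub>j exp (- s |x\<^sub>i - x\<^sub>j|\<^bsup>\<alpha>\<^esup>) \<le> 1 + C s\<^bsup>-d/\<alpha>\<^esup>\<close>. For (iii), testing
  the operator on indicators of large balls bounds \<open>\<Sum>\<^sub>m m\<^bsup>d-1\<^esup> f (B (m + 1))\<close>, and
  \<open>s\<^bsup>-d/\<alpha>\<^esup>\<close> is dominated by a constant plus a multiple of the corresponding series of exponentials.
\<close>

subsection \<open>Positive semidefinite kernels\<close>

text \<open>Two obstacles shape the lower bound. Domination on the Fourier side is carried out in
  one dimension and multiplied over the coordinates. But distinct points may share a coordinate, so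
  separation says nothing about a single factor; the product is controlled only through the largest
  coordinate of the difference z, by a multiple of |z|^-2. This is not summable over a general
  separated set when n >= 2, hence the powers of the product. Secondly, the constant for exp (- s
  |x|^\<alpha>) is found for each s separately, without control in s, and cannot be integrated
  against \<sigma>. It is fixed at one parameter and carried to all larger ones: the quotient of two
  such kernels is positive semidefinite with unit diagonal, and multiplying by it leaves a multiple
  of the identity unchanged. The same device treats the mixture of Gaussians when \<alpha> < 2. In
  (iii) everything rests on f being nonnegative and nonincreasing, so that sums over points are
  bounded below shell by shell.\<close>

definition psd :: "'i set \<Rightarrow> ('i \<Rightarrow> 'i \<Rightarrow> real) \<Rightarrow> bool" where
  "psd I K \<longleftrightarrow> (\<forall>i\<in>I. \<forall>j\<in>I. K i j = K j i) \<and>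
     (\<forall>v. 0 \<le> (\<Sum>i\<in>I. \<Sum>j\<in>I. K i j * v i * v j))"

lemma psd_sym: "psd I K \<Longrightarrow> i \<in> I \<Longrightarrow> j \<in> I \<Longrightarrow> K i j = K j i"
  by (auto simp: psd_def)

lemma psd_nonneg: "psd I K \<Longrightarrow> 0 \<le> (\<Sum>i\<in>I. \<Sum>j\<in>I. K i j * v i * v j)"
  by (auto simp: psd_def)

lemma psd_cong:
  assumes "\<And>i j. i \<in> I \<Longrightarrow> j \<in> I \<Longrightarrow> K i j = L i j"
  shows "psd I K \<longleftrightarrow> psd I L"
proof -
  have "(\<Sum>i\<in>I. \<Sum>j\<in>I. K i j * v i * v j) = (\<Sum>i\<in>I. \<Sum>j\<in>I. L i j * v i * v j)" for v
    using assms by (intro sum.cong refl) auto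
  then show ?thesis using assms by (simp add: psd_def)
qed

lemma psd_rank_one: "psd I (\<lambda>i j. g i * g j)"
proof -
  have "(\<Sum>i\<in>I. \<Sum>j\<in>I. g i * g j * v i * v j) = (\<Sum>i\<in>I. g i * v i)\<^sup>2" for v :: "'a \<Rightarrow> real"
    by (simp add: power2_eq_square sum_product mult_ac)
  then show ?thesis by (simp add: psd_def)
qed

lemma psd_add:
  assumes "psd I K" "psd I L" shows "psd I (\<lambda>i j. K i j + L i j)"
proof -
  have "(\<Sum>i\<in>I. \<Sum>j\<in>I. (K i j + L i j) * v i * v j) =
    (\<Sum>i\<in>I. \<Sum>j\<in>I. K i j * v i * v j) + (\<Sum>i\<in>I. \<Sum>j\<in>I. L i j * v i * v j)" for v
    by (simp add: sum.distrib distrib_right)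
  then show ?thesis using assms by (auto simp: psd_def)
qed

lemma psd_cmult:
  assumes "psd I K" "0 \<le> c" shows "psd I (\<lambda>i j. c * K i j)"
proof -
  have "(\<Sum>i\<in>I. \<Sum>j\<in>I. c * K i j * v i * v j) = c * (\<Sum>i\<in>I. \<Sum>j\<in>I. K i j * v i * v j)" for v
    by (simp add: sum_distrib_left mult_ac)
  then show ?thesis using assms by (auto simp: psd_def)
qed

lemma psd_zero: "psd I (\<lambda>i j. 0)"
  by (simp add: psd_def)

lemma psd_sum:
  assumes "\<And>n. n \<in> N \<Longrightarrow> psd I (K n)" shows "psd I (\<lambda>i j. \<Sum>n\<in>N. K n i j)"
  using assms by (induction N rule: infinite_finite_induct) (auto intro: psd_add simp: psd_zero)

lemma psd_lim:
  assumes "\<And>n::nat. psd I (K n)" and "\<And>i j. i \<in> I \<Longrightarrow> j \<in> I \<Longrightarrow> (\<lambda>n. K n i j) \<longlonglongrightarrow> L i j"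
  shows "psd I L"
proof -
  have "L i j = L j i" if "i \<in> I" "j \<in> I" for i j
    using LIMSEQ_unique[OF assms(2)[OF that]] assms(2)[OF that(2,1)] psd_sym[OF assms(1) that]
    by simp
  moreover have "0 \<le> (\<Sum>i\<in>I. \<Sum>j\<in>I. L i j * v i * v j)" for v
  proof (rule LIMSEQ_le_const)
    show "(\<lambda>n. \<Sum>i\<in>I. \<Sum>j\<in>I. K n i j * v i * v j) \<longlonglongrightarrow> (\<Sum>i\<in>I. \<Sum>j\<in>I. L i j * v i * v j)"
      by (intro tendsto_intros assms)
  qed (use psd_nonneg[OF assms(1)] in blast)
  ultimately show ?thesis by (auto simp: psd_def)
qed

lemma psd_integral:
  assumes "\<And>w. w \<in> space M \<Longrightarrow> psd I (K w)"
    and "\<And>i j. i \<in> I \<Longrightarrow> j \<in> I \<Longrightarrow> integrable M (\<lambda>w. K w i j)"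
  shows "psd I (\<lambda>i j. \<integral>w. K w i j \<partial>M)"
proof -
  have "(\<integral>w. K w i j \<partial>M) = (\<integral>w. K w j i \<partial>M)" if "i \<in> I" "j \<in> I" for i j
    using psd_sym[OF assms(1) that] by (intro Bochner_Integration.integral_cong) auto
  moreover have "0 \<le> (\<Sum>i\<in>I. \<Sum>j\<in>I. (\<integral>w. K w i j \<partial>M) * v i * v j)" for v
  proof -
    have "0 \<le> (\<integral>w. (\<Sum>i\<in>I. \<Sum>j\<in>I. K w i j * v i * v j) \<partial>M)"
      by (intro Bochner_Integration.integral_nonneg psd_nonneg assms(1))
    also have "\<dots> = (\<Sum>i\<in>I. \<Sum>j\<in>I. (\<integral>w. K w i j \<partial>M) * v i * v j)"
      using assms(2) by (simp add: Bochner_Integration.integral_sum)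
    finally show ?thesis .
  qed
  ultimately show ?thesis by (auto simp: psd_def)
qed

lemma psd_delta: "psd I (\<lambda>i j. of_bool (i = j))"
proof (cases "finite I")
  case True
  have "(\<Sum>i\<in>I. \<Sum>j\<in>I. of_bool (i = j) * v i * v j) = (\<Sum>i\<in>I. (v i)\<^sup>2)" for v :: "'a \<Rightarrow> real"
  proof (intro sum.cong refl)
    fix i assume "i \<in> I"
    have "(\<Sum>j\<in>I. of_bool (i = j) * v i * v j) = (\<Sum>j\<in>I. if j = i then v i * v j else 0)"
      by (intro sum.cong refl) auto
    also have "\<dots> = (v i)\<^sup>2" using True \<open>i \<in> I\<close> by (simp add: power2_eq_square)
    finally show "(\<Sum>j\<in>I. of_bool (i = j) * v i * v j) = (v i)\<^sup>2" .
  qed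
  then show ?thesis by (auto simp: psd_def intro: sum_nonneg)
qed (simp add: psd_def)

text \<open>By the inequality of the means each off-diagonal term costs at most half of
  \<open>\<bar>K i j\<bar>\<close> times \<open>(v i)^2 + (v j)^2\<close>; symmetry of
  \<open>K\<close> turns both halves into the row sums \<open>D i\<close>, which the diagonal
  absorbs.\<close>

lemma psd_diag_dominant:
  assumes "finite I" and sym: "\<And>i j. i \<in> I \<Longrightarrow> j \<in> I \<Longrightarrow> K i j = K j i"
    and dom: "\<And>i. i \<in> I \<Longrightarrow> (\<Sum>j\<in>I - {i}. \<bar>K i j\<bar>) \<le> K i i"
  shows "psd I K"
proof -
  have "0 \<le> (\<Sum>i\<in>I. \<Sum>j\<in>I. K i j * v i * v j)" for v
  proof -
    define D where "D = (\<lambda>i. \<Sum>j\<in>I - {i}. \<bar>K i j\<bar>)"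
    have swap: "(\<Sum>i\<in>I. \<Sum>j\<in>I - {i}. \<bar>K i j\<bar> * (v j)\<^sup>2) = (\<Sum>i\<in>I. D i * (v i)\<^sup>2)"
    proof -
      have "(\<Sum>i\<in>I. \<Sum>j\<in>I - {i}. \<bar>K i j\<bar> * (v j)\<^sup>2) =
          (\<Sum>i\<in>I. \<Sum>j\<in>I. if j = i then 0 else \<bar>K i j\<bar> * (v j)\<^sup>2)"
        by (intro sum.cong refl sum.mono_neutral_cong_left) (auto simp: assms)
      also have "\<dots> = (\<Sum>j\<in>I. \<Sum>i\<in>I. if j = i then 0 else \<bar>K i j\<bar> * (v j)\<^sup>2)"
        by (rule sum.swap)
      also have "\<dots> = (\<Sum>j\<in>I. \<Sum>i\<in>I - {j}. \<bar>K j i\<bar> * (v j)\<^sup>2)"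
      proof (rule sum.cong[OF refl])
        fix j assume j: "j \<in> I"
        have "(\<Sum>i\<in>I. if j = i then 0 else \<bar>K i j\<bar> * (v j)\<^sup>2) = (\<Sum>i\<in>I. if i = j then 0 else \<bar>K j i\<bar> * (v j)\<^sup>2)"
          by (intro sum.cong refl) (use sym j in auto)
        also have "\<dots> = (\<Sum>i\<in>I - {j}. \<bar>K j i\<bar> * (v j)\<^sup>2)"
          by (intro sum.mono_neutral_cong_right) (auto simp: assms)
        finally show "(\<Sum>i\<in>I. if j = i then 0 else \<bar>K i j\<bar> * (v j)\<^sup>2) = (\<Sum>i\<in>I - {j}. \<bar>K j i\<bar> * (v j)\<^sup>2)" .
      qed
      finally show ?thesis by (simp add: D_def sum_distrib_right)
    qed
    have "(\<Sum>j\<in>I. K i j * v i * v j) \<ge> D i * (v i)\<^sup>2 / 2 - (\<Sum>j\<in>I - {i}. \<bar>K i j\<bar> * (v j)\<^sup>2) / 2"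
      if i: "i \<in> I" for i
    proof -
      have *: "- (\<bar>K i j\<bar> * (v i)\<^sup>2 / 2 + \<bar>K i j\<bar> * (v j)\<^sup>2 / 2) \<le> K i j * v i * v j" for j
      proof -
        have "\<bar>v i * v j\<bar> \<le> ((v i)\<^sup>2 + (v j)\<^sup>2) / 2"
          using sum_squares_bound[of "\<bar>v i\<bar>" "\<bar>v j\<bar>"] by (simp add: abs_mult)
        then have "\<bar>K i j\<bar> * \<bar>v i * v j\<bar> \<le> \<bar>K i j\<bar> * (((v i)\<^sup>2 + (v j)\<^sup>2) / 2)"
          by (intro mult_left_mono) auto
        then have "\<bar>K i j * v i * v j\<bar> \<le> \<bar>K i j\<bar> * (v i)\<^sup>2 / 2 + \<bar>K i j\<bar> * (v j)\<^sup>2 / 2"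
          by (simp add: abs_mult distrib_left add_divide_distrib mult_ac)
        then show ?thesis by linarith
      qed
      have "(\<Sum>j\<in>I. K i j * v i * v j) = K i i * (v i)\<^sup>2 + (\<Sum>j\<in>I - {i}. K i j * v i * v j)"
        using i assms(1) by (subst sum.remove[of _ i]) (auto simp: power2_eq_square)
      moreover have "K i i * (v i)\<^sup>2 \<ge> D i * (v i)\<^sup>2"
        unfolding D_def by (intro mult_right_mono dom i) auto
      moreover have "(\<Sum>j\<in>I - {i}. K i j * v i * v j) \<ge>
          (\<Sum>j\<in>I - {i}. - (\<bar>K i j\<bar> * (v i)\<^sup>2 / 2 + \<bar>K i j\<bar> * (v j)\<^sup>2 / 2))"
        by (intro sum_mono *)
      moreover have "(\<Sum>j\<in>I - {i}. - (\<bar>K i j\<bar> * (v i)\<^sup>2 / 2 + \<bar>K i j\<bar> * (v j)\<^sup>2 / 2)) =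
          - (D i * (v i)\<^sup>2 / 2) - (\<Sum>j\<in>I - {i}. \<bar>K i j\<bar> * (v j)\<^sup>2) / 2"
        unfolding D_def sum_negf sum.distrib sum_distrib_right sum_divide_distrib by simp
      ultimately show ?thesis by linarith
    qed
    then have "(\<Sum>i\<in>I. D i * (v i)\<^sup>2 / 2 - (\<Sum>j\<in>I - {i}. \<bar>K i j\<bar> * (v j)\<^sup>2) / 2) \<le>
        (\<Sum>i\<in>I. \<Sum>j\<in>I. K i j * v i * v j)"
      by (rule sum_mono)
    moreover have "(\<Sum>i\<in>I. D i * (v i)\<^sup>2 / 2 - (\<Sum>j\<in>I - {i}. \<bar>K i j\<bar> * (v j)\<^sup>2) / 2) = 0"
      unfolding sum_subtractf sum_divide_distrib[symmetric] using swap by simp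
    ultimately show ?thesis by linarith
  qed
  then show ?thesis using sym by (simp add: psd_def)
qed

section \<open>Gram factorization and Schur products\<close>

lemma psd_subset:
  assumes "psd I K" "J \<subseteq> I" "finite I" shows "psd J K"
proof -
  have "0 \<le> (\<Sum>i\<in>J. \<Sum>j\<in>J. K i j * v i * v j)" for v
  proof -
    let ?w = "\<lambda>i. if i \<in> J then v i else 0"
    have "(\<Sum>i\<in>I. \<Sum>j\<in>I. K i j * ?w i * ?w j) = (\<Sum>i\<in>J. \<Sum>j\<in>I. K i j * ?w i * ?w j)"
      using assms by (intro sum.mono_neutral_right) auto
    also have "\<dots> = (\<Sum>i\<in>J. \<Sum>j\<in>J. K i j * v i * v j)"
      using assms by (intro sum.cong refl sum.mono_neutral_cong_right) auto
    finally show ?thesis using psd_nonneg[OF assms(1), of ?w] by simp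
  qed
  then show ?thesis using assms by (simp add: psd_def subset_iff)
qed

lemma psd_diag_nonneg:
  assumes "finite I" "psd I K" "i \<in> I" shows "0 \<le> K i i"
  using psd_nonneg[OF psd_subset[OF assms(2) _ assms(1), of "{i}"], of "\<lambda>_. 1"] assms by simp

text \<open>On the two indices \<open>a\<close> and \<open>j\<close> the form is affine in
  \<open>v a\<close> once the diagonal entry at \<open>a\<close> vanishes, so it is unbounded below
  unless its slope is zero.\<close>

lemma psd_row_zero:
  assumes "finite I" "psd I K" "a \<in> I" "j \<in> I" "K a a = 0" shows "K a j = 0"
proof (rule ccontr)
  assume nz: "K a j \<noteq> 0"
  with assms have ne: "a \<noteq> j" by auto
  have s: "K j a = K a j" using psd_sym[OF assms(2)] assms by auto
  have "psd {a, j} K" using assms by (auto intro: psd_subset[OF assms(2) _ assms(1)])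
  then have "0 \<le> (\<Sum>i\<in>{a, j}. \<Sum>l\<in>{a, j}. K i l * v i * v l)" for v
    by (rule psd_nonneg)
  moreover have "(\<Sum>i\<in>{a, j}. \<Sum>l\<in>{a, j}. K i l * v i * v l) =
      2 * (K a j * v a * v j) + K j j * v j * v j" for v
    using ne assms(5) s by simp
  ultimately have *: "0 \<le> 2 * (K a j * v a * v j) + K j j * v j * v j" for v
    by simp
  \<comment> \<open>With \<open>v a = t\<close> and \<open>v j = 1\<close> the form takes the value
    -1.\<close>
  define t where "t = - (K j j + 1) / (2 * K a j)"
  have "2 * (K a j * t) = - K j j - 1" using nz by (simp add: t_def)
  with *[of "\<lambda>i. if i = a then t else 1"] ne show False by simp
qed

text \<open>Symmetric elimination by induction on the index set: remove one pivot, factor the Schur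
  complement, and adjoin the pivot row as one more vector.\<close>

lemma psd_gram:
  assumes "finite I" "psd I K"
  shows "\<exists>b. \<forall>i\<in>I. \<forall>j\<in>I. K i j = (\<Sum>m\<in>I. b m i * b m j)"
  using assms
proof (induction I arbitrary: K)
  case (insert a F)
  let ?I = "insert a F"
  have fin: "finite ?I" using insert by simp
  have row0: "K a j = 0" if "j \<in> ?I" "K a a = 0" for j
    using psd_row_zero[OF fin insert.prems _ that] by simp
  have pos: "0 \<le> K a a" using psd_diag_nonneg[OF fin insert.prems] by simp
  have sym: "K i j = K j i" if "i \<in> ?I" "j \<in> ?I" for i j
    using psd_sym[OF insert.prems that] .
  \<comment> \<open>The Schur complement of the entry \<open>K a a\<close>; if that entry vanishes, so does its row, and
    division by zero gives \<open>K\<close> itself.\<close>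
  define L where "L = (\<lambda>i j. K i j - K a i * K a j / K a a)"
  have "psd F L"
  proof -
    have "0 \<le> (\<Sum>i\<in>F. \<Sum>j\<in>F. L i j * v i * v j)" for v
    proof -
      define S where "S = (\<Sum>j\<in>F. K a j * v j)"
      \<comment> \<open>Minimizer of the form in the coordinate \<open>a\<close>; the minimum is the
        form of the Schur complement. If the pivot is zero, so is \<open>S\<close>, and the default
        \<open>t = 0\<close> is still correct.\<close>
      define t where "t = - S / K a a"
      define w where "w = (\<lambda>i. if i = a then t else v i)"
      have S0: "S = 0" if "K a a = 0" using that row0 by (simp add: S_def)
      have wF: "w i = v i" if "i \<in> F" for i using that insert.hyps by (auto simp: w_def)
      have wa: "w a = t" by (simp add: w_def)
      have K1: "(\<Sum>j\<in>F. K a j * t * w j) = t * S"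
        by (simp add: S_def sum_distrib_left mult_ac wF)
      have K2: "(\<Sum>i\<in>F. K i a * w i * t) = t * S"
        unfolding S_def sum_distrib_left
      proof (intro sum.cong refl)
        fix i assume "i \<in> F"
        then show "K i a * w i * t = t * (K a i * v i)" using sym[of i a] by (simp add: wF)
      qed
      have K3: "(\<Sum>i\<in>F. \<Sum>j\<in>F. K i j * w i * w j) = (\<Sum>i\<in>F. \<Sum>j\<in>F. K i j * v i * v j)"
        by (intro sum.cong refl) (simp add: wF)
      have "(\<Sum>i\<in>?I. \<Sum>j\<in>?I. K i j * w i * w j) =
          K a a * t\<^sup>2 + 2 * (t * S) + (\<Sum>i\<in>F. \<Sum>j\<in>F. K i j * v i * v j)"
        using insert.hyps by (simp add: sum.distrib K1 K2 K3 wa power2_eq_square)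
      also have "K a a * t\<^sup>2 + 2 * (t * S) = - (S\<^sup>2 / K a a)"
        using S0 by (cases "K a a = 0") (auto simp: t_def power2_eq_square field_simps)
      also have "S\<^sup>2 / K a a = (\<Sum>i\<in>F. \<Sum>j\<in>F. K a i * K a j / K a a * v i * v j)"
        by (simp add: S_def power2_eq_square sum_product sum_divide_distrib mult_ac)
      also have "- \<dots> + (\<Sum>i\<in>F. \<Sum>j\<in>F. K i j * v i * v j) = (\<Sum>i\<in>F. \<Sum>j\<in>F. L i j * v i * v j)"
        by (simp add: L_def left_diff_distrib sum_subtractf)
      finally show ?thesis using psd_nonneg[OF insert.prems, of w] by simp
    qed
    then show ?thesis using sym by (simp add: psd_def L_def mult_ac)
  qed
  then obtain b where b: "\<And>i j. i \<in> F \<Longrightarrow> j \<in> F \<Longrightarrow> L i j = (\<Sum>m\<in>F. b m i * b m j)"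
    using insert.IH by blast
  \<comment> \<open>The new vector is the pivot row over the square root of the pivot, which is the
    zero vector for a zero pivot; the others are extended by 0 at \<open>a\<close>.\<close>
  define c where "c = (\<lambda>m i. if m = a then K a i / sqrt (K a a) else if i = a then 0 else b m i)"
  have "K i j = (\<Sum>m\<in>?I. c m i * c m j)" if ij: "i \<in> ?I" "j \<in> ?I" for i j
  proof -
    have ca: "c a i * c a j = K a i * K a j / K a a"
      using pos by (simp add: c_def flip: real_sqrt_mult)
    have "(\<Sum>m\<in>F. c m i * c m j) = (if i = a \<or> j = a then 0 else L i j)"
    proof (cases "i = a \<or> j = a")
      case True
      have "(\<Sum>m\<in>F. c m i * c m j) = 0"
        by (rule sum.neutral) (use True insert.hyps in \<open>auto simp: c_def\<close>)
      with True show ?thesis by simp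
    next
      case False
      with ij have "L i j = (\<Sum>m\<in>F. b m i * b m j)" by (intro b) auto
      also have "\<dots> = (\<Sum>m\<in>F. c m i * c m j)"
        using False insert.hyps by (intro sum.cong) (auto simp: c_def)
      finally show ?thesis using False by simp
    qed
    then have eq: "(\<Sum>m\<in>?I. c m i * c m j) = K a i * K a j / K a a + (if i = a \<or> j = a then 0 else L i j)"
      using insert.hyps ca by simp
    show ?thesis
    proof (cases "i = a \<or> j = a")
      case True
      then show ?thesis unfolding eq using ij sym[of i j] row0 by (cases "K a a = 0") auto
    next
      case False
      then show ?thesis unfolding eq by (simp add: L_def)
    qed
  qed
  then show ?case by blast
qed simp

text \<open>Schur's product theorem. A Gram factorization of \<open>K\<close> writes the entrywise
  product as a sum over \<open>m\<close> of \<open>L\<close> rescaled on both sides by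
  \<open>b m\<close>, and the rescaling can be absorbed in the test vector.\<close>

lemma psd_mult:
  assumes "finite I" "psd I K" "psd I L" shows "psd I (\<lambda>i j. K i j * L i j)"
proof -
  obtain b where b: "\<And>i j. i \<in> I \<Longrightarrow> j \<in> I \<Longrightarrow> K i j = (\<Sum>m\<in>I. b m i * b m j)"
    using psd_gram[OF assms(1,2)] by blast
  have "0 \<le> (\<Sum>i\<in>I. \<Sum>j\<in>I. K i j * L i j * v i * v j)" for v
  proof -
    have "0 \<le> (\<Sum>m\<in>I. \<Sum>i\<in>I. \<Sum>j\<in>I. L i j * (b m i * v i) * (b m j * v j))"
      by (intro sum_nonneg psd_nonneg[OF assms(3)])
    also have "\<dots> = (\<Sum>i\<in>I. \<Sum>m\<in>I. \<Sum>j\<in>I. L i j * (b m i * v i) * (b m j * v j))"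
      by (rule sum.swap)
    also have "\<dots> = (\<Sum>i\<in>I. \<Sum>j\<in>I. \<Sum>m\<in>I. L i j * (b m i * v i) * (b m j * v j))"
      by (intro sum.cong refl sum.swap)
    also have "\<dots> = (\<Sum>i\<in>I. \<Sum>j\<in>I. K i j * L i j * v i * v j)"
      by (intro sum.cong refl) (simp add: b sum_distrib_left sum_distrib_right mult_ac)
    finally show ?thesis .
  qed
  then show ?thesis using psd_sym[OF assms(2)] psd_sym[OF assms(3)] by (simp add: psd_def)
qed

lemma psd_power:
  assumes "finite I" "psd I K" shows "psd I (\<lambda>i j. K i j ^ n)"
proof (induction n)
  case 0
  show ?case using psd_rank_one[of I "\<lambda>_. 1"] by simp
next
  case (Suc n)
  then show ?case using psd_mult[OF assms Suc] by simp
qed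

text \<open>The exponential series has nonnegative coefficients, so without its linear term it is
  still a limit of nonnegative combinations of Schur powers. In this form a lower bound for the
  exponent becomes one for the exponential.\<close>

lemma psd_exp_minus_self:
  assumes "finite I" "psd I K" shows "psd I (\<lambda>i j. exp (K i j) - K i j)"
proof (rule psd_lim)
  show "psd I (\<lambda>i j. \<Sum>n\<in>{..<N} - {1}. 1 / fact n * K i j ^ n)" for N
    by (intro psd_sum psd_cmult psd_power assms) auto
  fix i j
  have "(\<lambda>n. K i j ^ n /\<^sub>R fact n) sums exp (K i j)" by (rule exp_converges)
  then have "(\<lambda>n. K i j ^ n /\<^sub>R fact n - (if n = 1 then K i j else 0)) sums (exp (K i j) - K i j)"
    by (intro sums_diff sums_single)
  moreover have "(\<lambda>n. K i j ^ n /\<^sub>R fact n - (if n = 1 then K i j else 0)) =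
      (\<lambda>n. if n = 1 then 0 else 1 / fact n * K i j ^ n)"
    by (auto simp: divide_inverse)
  ultimately have "(\<lambda>n. if n = 1 then 0 else 1 / fact n * K i j ^ n) sums (exp (K i j) - K i j)"
    by metis
  then have "(\<lambda>N. \<Sum>n<N. if n = 1 then 0 else 1 / fact n * K i j ^ n) \<longlonglongrightarrow> exp (K i j) - K i j"
    unfolding sums_def .
  moreover have "(\<Sum>n<N. if n = 1 then 0 else 1 / fact n * K i j ^ n) =
      (\<Sum>n\<in>{..<N} - {1}. 1 / fact n * K i j ^ n)" for N
    by (auto simp: sum.If_cases Diff_eq intro!: sum.cong)
  ultimately show "(\<lambda>N. \<Sum>n\<in>{..<N} - {1}. 1 / fact n * K i j ^ n) \<longlonglongrightarrow> exp (K i j) - K i j"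
    by simp
qed

section \<open>The order of positive semidefinite kernels\<close>

lemma psd_le_trans:
  assumes "psd I (\<lambda>i j. K i j - L i j)" "psd I (\<lambda>i j. L i j - M i j)"
  shows "psd I (\<lambda>i j. K i j - M i j)"
  using psd_add[OF assms] by simp

lemma psd_of_le:
  assumes "psd I (\<lambda>i j. K i j - L i j)" "psd I L"
  shows "psd I K"
  using psd_add[OF assms] by simp

lemma psd_mult_mono:
  assumes "finite I" "psd I (\<lambda>i j. K i j - L i j)" "psd I L"
    "psd I (\<lambda>i j. K' i j - L' i j)" "psd I L'"
  shows "psd I (\<lambda>i j. K i j * K' i j - L i j * L' i j)"
proof -
  have "psd I (\<lambda>i j. (K i j - L i j) * K' i j + L i j * (K' i j - L' i j))"
    using assms by (intro psd_add psd_mult psd_of_le[OF assms(4)])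
  then show ?thesis by (simp add: algebra_simps)
qed

lemma psd_prod:
  assumes "finite I" "\<And>b. b \<in> B \<Longrightarrow> psd I (K b)"
  shows "psd I (\<lambda>i j. \<Prod>b\<in>B. K b i j)"
  using assms(2)
proof (induction B rule: infinite_finite_induct)
  case (insert b B)
  then show ?case using assms(1) by (simp add: psd_mult)
qed (use psd_rank_one[of I "\<lambda>_. 1"] in auto)

lemma psd_prod_mono:
  assumes "finite I" "\<And>b. b \<in> B \<Longrightarrow> psd I (\<lambda>i j. K b i j - L b i j)" "\<And>b. b \<in> B \<Longrightarrow> psd I (L b)"
  shows "psd I (\<lambda>i j. (\<Prod>b\<in>B. K b i j) - (\<Prod>b\<in>B. L b i j))"
  using assms(2,3)
proof (induction B rule: infinite_finite_induct)
  case (insert b B)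
  have "psd I (\<lambda>i j. K b i j * (\<Prod>b\<in>B. K b i j) - L b i j * (\<Prod>b\<in>B. L b i j))"
    using insert assms(1) by (intro psd_mult_mono psd_prod) auto
  then show ?case using insert by simp
qed (auto simp: psd_zero)

lemma psd_power_mono:
  assumes "finite I" "psd I (\<lambda>i j. K i j - L i j)" "psd I L"
  shows "psd I (\<lambda>i j. K i j ^ n - L i j ^ n)"
  using psd_prod_mono[of I "{..<n}" "\<lambda>_. K" "\<lambda>_. L"] assms by simp

text \<open>Entrywise multiplication by a kernel with unit diagonal fixes the identity kernel, so
  the constant \<open>c\<close> survives. With \<open>L\<close> the quotient of two exponential
  kernels, bounds pass from one parameter to all larger ones.\<close>

lemma psd_mult_correlation:
  assumes "finite I" "psd I (\<lambda>i j. K i j - c * of_bool (i = j))" "psd I L"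
    "\<And>i. i \<in> I \<Longrightarrow> L i i = 1"
  shows "psd I (\<lambda>i j. K i j * L i j - c * of_bool (i = j))"
  using psd_mult[OF assms(1-3)]
  by (rule psd_cong[THEN iffD1, rotated]) (use assms(4) in \<open>auto simp: algebra_simps\<close>)

subsection \<open>Counting points of separated sets\<close>

lemma orthonormal_norm_sq:
  fixes B :: "'a::euclidean_space set"
  assumes "pairwise orthogonal B" "\<And>b. b \<in> B \<Longrightarrow> norm b = 1" "finite B" "w \<in> span B"
  shows "(norm w)\<^sup>2 = (\<Sum>b\<in>B. (w \<bullet> b)\<^sup>2)"
proof -
  obtain u where u: "w = (\<Sum>b\<in>B. u b *\<^sub>R b)"
    using assms(3,4) by (auto simp: span_finite)
  have ortho: "b \<bullet> c = (if b = c then 1 else 0)" if "b \<in> B" "c \<in> B" for b c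
    using assms(1,2) that by (auto simp: orthogonal_def pairwise_def norm_eq_1)
  have wb: "w \<bullet> c = u c" if "c \<in> B" for c
  proof -
    have "w \<bullet> c = (\<Sum>b\<in>B. u b * (b \<bullet> c))" by (simp add: u inner_sum_left)
    also have "\<dots> = (\<Sum>b\<in>B. if b = c then u b else 0)"
      by (intro sum.cong refl) (auto simp: ortho that)
    finally show ?thesis using assms(3) that by simp
  qed
  have "(norm w)\<^sup>2 = w \<bullet> (\<Sum>b\<in>B. u b *\<^sub>R b)" by (simp add: dot_square_norm flip: u)
  also have "\<dots> = (\<Sum>b\<in>B. u b * (w \<bullet> b))" by (simp add: inner_sum_right)
  also have "\<dots> = (\<Sum>b\<in>B. (w \<bullet> b)\<^sup>2)" by (intro sum.cong refl) (simp add: wb power2_eq_square)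
  finally show ?thesis .
qed

text \<open>Cells of side \<open>e\<close> of a grid in an orthonormal basis of \<open>V\<close>
  contain at most one point each. Working in \<open>V\<close> makes the exponent
  \<open>dim V\<close> rather than the ambient dimension. The hypothesis
  \<open>\<delta> \<le> r\<close> turns the bound \<open>2 * (r / e) + 2\<close> for the cells per
  axis into a multiple of \<open>r\<close>.\<close>

lemma card_separated_le:
  fixes x :: "'i \<Rightarrow> 'a::euclidean_space"
  assumes fin: "finite J" and \<delta>: "0 < \<delta>" "\<delta> \<le> r"
    and sep: "\<And>i j. i \<in> J \<Longrightarrow> j \<in> J \<Longrightarrow> i \<noteq> j \<Longrightarrow> \<delta> \<le> norm (x i - x j)"
    and V: "subspace V" "\<And>j. j \<in> J \<Longrightarrow> x j - a \<in> V"
    and r: "\<And>j. j \<in> J \<Longrightarrow> norm (x j - a) \<le> r"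
  shows "real (card J) \<le> (2 * (real (dim V) + 2) / \<delta> * r) ^ dim V"
proof -
  obtain B where B: "pairwise orthogonal B" "\<And>b. b \<in> B \<Longrightarrow> norm b = 1" "independent B"
      "card B = dim V" "span B = V"
    using orthonormal_basis_subspace[OF V(1)] by metis
  have finB: "finite B" using B(3) by (rule independent_imp_finite)
  define d where "d = dim V"
  \<comment> \<open>Coordinates differing by at most \<open>e\<close> give distance at most
    \<open>sqrt d * e\<close>, and \<open>d + 1\<close> exceeds \<open>sqrt d\<close> also for
    \<open>d = 0\<close>.\<close>
  define e where "e = \<delta> / (real d + 1)"
  have e: "0 < e" using \<delta> by (simp add: e_def)
  define cell where "cell = (\<lambda>j. \<lambda>b\<in>B. \<lfloor>(x j - a) \<bullet> b / e\<rfloor>)"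
  define Z where "Z = {\<lfloor>- r / e\<rfloor>..\<lfloor>r / e\<rfloor>}"
  have "inj_on cell J"
  proof (rule inj_onI, rule ccontr)
    fix i j assume ij: "i \<in> J" "j \<in> J" "cell i = cell j" "i \<noteq> j"
    let ?w = "x i - x j"
    have small: "(?w \<bullet> b)\<^sup>2 \<le> e\<^sup>2" if "b \<in> B" for b
    proof -
      have "\<lfloor>(x i - a) \<bullet> b / e\<rfloor> = \<lfloor>(x j - a) \<bullet> b / e\<rfloor>"
        using fun_cong[OF ij(3), of b] that by (simp add: cell_def)
      then have "\<bar>(x i - a) \<bullet> b / e - (x j - a) \<bullet> b / e\<bar> < 1" by linarith
      moreover have "(x i - a) \<bullet> b / e - (x j - a) \<bullet> b / e = ?w \<bullet> b / e"
        by (simp add: inner_diff_left diff_divide_distrib)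
      ultimately have "\<bar>?w \<bullet> b\<bar> \<le> e" using e by (simp add: abs_divide)
      then show ?thesis using power_mono[of "\<bar>?w \<bullet> b\<bar>" e 2] by simp
    qed
    have "?w = (x i - a) - (x j - a)" by simp
    then have "?w \<in> span B" using V ij(1,2) B(5) subspace_diff by metis
    then have "(norm ?w)\<^sup>2 = (\<Sum>b\<in>B. (?w \<bullet> b)\<^sup>2)" using orthonormal_norm_sq[of B ?w] B(1,2) finB by blast
    also have "\<dots> \<le> d * e\<^sup>2" using sum_bounded_above[of B, OF small] B(4) by (simp add: d_def)
    also have "\<dots> < (real d + 1)\<^sup>2 * e\<^sup>2"
    proof -
      have "real d < (real d + 1)\<^sup>2" by (simp add: power2_eq_square algebra_simps add_strict_increasing)
      then show ?thesis using e by simp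
    qed
    also have "\<dots> = \<delta>\<^sup>2" by (simp add: e_def power_divide)
    finally have "norm ?w < \<delta>" using \<delta> by (simp add: power2_less_imp_less)
    then show False using sep[OF ij(1,2,4)] by simp
  qed
  moreover have "cell ` J \<subseteq> B \<rightarrow>\<^sub>E Z"
  proof
    fix c assume "c \<in> cell ` J"
    then obtain j where j: "j \<in> J" "c = cell j" by auto
    have "\<lfloor>(x j - a) \<bullet> b / e\<rfloor> \<in> Z" if "b \<in> B" for b
    proof -
      have "\<bar>(x j - a) \<bullet> b\<bar> \<le> r"
        using Cauchy_Schwarz_ineq2[of "x j - a" b] B(2)[OF that] r[OF j(1)] by simp
      then have "- r \<le> (x j - a) \<bullet> b" "(x j - a) \<bullet> b \<le> r" by linarith+
      then have "- r / e \<le> (x j - a) \<bullet> b / e" "(x j - a) \<bullet> b / e \<le> r / e"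
        using e by (intro divide_right_mono; simp)+
      then show ?thesis unfolding Z_def by (auto intro: floor_mono)
    qed
    then show "c \<in> B \<rightarrow>\<^sub>E Z" by (auto simp: j(2) cell_def)
  qed
  ultimately have "card J \<le> card (B \<rightarrow>\<^sub>E Z)"
    using finB by (intro card_inj_on_le[of cell]) (auto intro!: finite_PiE simp: Z_def)
  also have "\<dots> = card Z ^ d" using finB B(4) by (simp add: card_PiE d_def)
  finally have "real (card J) \<le> real (card Z) ^ d" by (metis of_nat_le_iff of_nat_power)
  also have "\<dots> \<le> (2 * (real d + 2) / \<delta> * r) ^ d"
  proof (rule power_mono)
    have "0 \<le> r / e" using \<delta> e by simp
    then have "real (card Z) \<le> 2 * (r / e) + 2"
      unfolding Z_def by (simp, linarith)
    also have "1 \<le> r / \<delta>" using \<delta> by simp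
    then have "2 * (r / e) + 2 \<le> 2 * (r / e) + 2 * (r / \<delta>)" by linarith
    also have "\<dots> = 2 * (real d + 2) / \<delta> * r" using \<delta> by (simp add: e_def field_simps)
    finally show "real (card Z) \<le> 2 * (real d + 2) / \<delta> * r" .
  qed simp
  finally show ?thesis by (simp add: d_def)
qed

text \<open>In \<open>separated_sum_le\<close> the leading 2 bounds a geometric series, the power of
  2 is the loss from dyadic radii, and the last factor is the counting constant of
  \<open>card_separated_le\<close>.\<close>

definition packing_const :: "real \<Rightarrow> nat \<Rightarrow> real" where
  "packing_const \<delta> d = 2 * 2 ^ (d + 1) * (2 * (real d + 2) / \<delta>) ^ d"

lemma packing_const_pos: "0 < \<delta> \<Longrightarrow> 0 < packing_const \<delta> d"
  by (simp add: packing_const_def)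

text \<open>Dyadic balls of radius \<open>2^k * \<rho>\<close>: a point first caught by the k-th
  ball contributes at most a constant times \<open>2^(-k * (d+1))\<close>, and that ball holds at
  most a constant times \<open>(2^k * \<rho>)^d\<close> points, so the surplus exponent 1 leaves a
  geometric series. The bound is a pure power of \<open>\<rho>\<close>, which both the diagonal
  dominance and the moment estimate rely on.\<close>

lemma separated_sum_le:
  fixes x :: "'i \<Rightarrow> 'a::euclidean_space"
  assumes fin: "finite J" and \<delta>: "0 < \<delta>" and \<rho>: "0 < \<rho>"
    and sep: "\<And>i j. i \<in> J \<Longrightarrow> j \<in> J \<Longrightarrow> i \<noteq> j \<Longrightarrow> \<delta> \<le> norm (x i - x j)"
    and V: "subspace V" "\<And>j. j \<in> J \<Longrightarrow> x j - a \<in> V"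
    and away: "\<And>j. j \<in> J \<Longrightarrow> \<delta> \<le> norm (x j - a)"
  shows "(\<Sum>j\<in>J. min 1 (\<rho> / norm (x j - a)) ^ (dim V + 1)) \<le> packing_const \<delta> (dim V) * \<rho> ^ dim V"
proof -
  define d where "d = dim V"
  define r where "r = (\<lambda>j. norm (x j - a))"
  have rpos: "0 < r j" if "j \<in> J" for j using away[OF that] \<delta> unfolding r_def by linarith
  have "\<exists>M::nat. \<forall>j\<in>J. r j \<le> 2 ^ M * \<rho>"
  proof -
    obtain M where M: "Max (insert 0 (r ` J)) / \<rho> < 2 ^ M"
      using real_arch_pow[of 2 "Max (insert 0 (r ` J)) / \<rho>"] by auto
    have "r j \<le> 2 ^ M * \<rho>" if "j \<in> J" for j
    proof -
      have "r j \<le> Max (insert 0 (r ` J))" using fin that by (intro Max_ge) auto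
      also have "\<dots> \<le> 2 ^ M * \<rho>" using M \<rho> by (simp add: field_simps)
      finally show ?thesis .
    qed
    then show ?thesis by blast
  qed
  then obtain M where M: "\<And>j. j \<in> J \<Longrightarrow> r j \<le> 2 ^ M * \<rho>" by blast
  define q where "q = (\<lambda>k. 2 ^ (d + 1) * ((1/2) ^ k) ^ (d + 1) :: real)"
  have q: "0 \<le> q k" for k by (simp add: q_def)
  have term_le: "min 1 (\<rho> / r j) ^ (d + 1) \<le> (\<Sum>k\<le>M. if r j \<le> 2 ^ k * \<rho> then q k else 0)"
    if j: "j \<in> J" for j
  proof -
    \<comment> \<open>The smallest dyadic ball containing the point. Its predecessor fails to
      contain it; for \<open>k = 0\<close> the cutoff at 1 takes over.\<close>
    define k where "k = (LEAST k. r j \<le> 2 ^ k * \<rho>)"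
    have k: "r j \<le> 2 ^ k * \<rho>" unfolding k_def by (rule LeastI[of _ M]) (use M j in auto)
    have "k \<le> M" unfolding k_def by (rule Least_le) (use M j in auto)
    have "min 1 (\<rho> / r j) \<le> 2 * (1/2) ^ k"
    proof (cases k)
      case (Suc l)
      have "2 ^ l * \<rho> < r j"
        using not_less_Least[of l "\<lambda>k. r j \<le> 2 ^ k * \<rho>"] Suc by (auto simp: k_def)
      then have "\<rho> / r j \<le> (1/2) ^ l" using rpos[OF j] by (simp add: field_simps)
      then show ?thesis using Suc by simp
    qed simp
    then have "min 1 (\<rho> / r j) ^ (d + 1) \<le> (2 * (1/2) ^ k) ^ (d + 1)"
      using rpos[OF j] \<rho> by (intro power_mono) auto
    also have "\<dots> = (if r j \<le> 2 ^ k * \<rho> then q k else 0)"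
      using k by (simp add: q_def power_mult_distrib)
    also have "\<dots> \<le> (\<Sum>k\<le>M. if r j \<le> 2 ^ k * \<rho> then q k else 0)"
      using \<open>k \<le> M\<close> q by (intro member_le_sum) auto
    finally show ?thesis .
  qed
  define K where "K = 2 * (real d + 2) / \<delta>"
  have K: "0 < K" using \<delta> by (simp add: K_def)
  \<comment> \<open>Balls of radius below \<open>\<delta>\<close> are empty by \<open>away\<close>;
    this case is what spares an additive constant.\<close>
  have count: "real (card {j\<in>J. r j \<le> 2 ^ k * \<rho>}) \<le> (K * (2 ^ k * \<rho>)) ^ d" for k
  proof (cases "\<delta> \<le> 2 ^ k * \<rho>")
    case True
    then show ?thesis unfolding K_def d_def
      by (intro card_separated_le[where x = x and a = a]) (use fin \<delta> sep V in \<open>auto simp: r_def\<close>)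
  next
    case False
    then have "{j\<in>J. r j \<le> 2 ^ k * \<rho>} = {}" using away by (force simp: r_def)
    then show ?thesis unfolding \<open>_ = {}\<close> using K \<rho> by simp
  qed
  have "(\<Sum>j\<in>J. min 1 (\<rho> / r j) ^ (d + 1)) \<le> (\<Sum>j\<in>J. \<Sum>k\<le>M. if r j \<le> 2 ^ k * \<rho> then q k else 0)"
    by (intro sum_mono term_le)
  also have "\<dots> = (\<Sum>k\<le>M. \<Sum>j\<in>J. if r j \<le> 2 ^ k * \<rho> then q k else 0)" by (rule sum.swap)
  also have "\<dots> = (\<Sum>k\<le>M. real (card {j\<in>J. r j \<le> 2 ^ k * \<rho>}) * q k)"
  proof (rule sum.cong[OF refl])
    fix k
    have "(\<Sum>j\<in>J. if r j \<le> 2 ^ k * \<rho> then q k else 0) = (\<Sum>j\<in>{j\<in>J. r j \<le> 2 ^ k * \<rho>}. q k)"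
      by (rule sum.inter_filter[OF fin, symmetric])
    then show "(\<Sum>j\<in>J. if r j \<le> 2 ^ k * \<rho> then q k else 0) = real (card {j\<in>J. r j \<le> 2 ^ k * \<rho>}) * q k"
      by simp
  qed
  also have "\<dots> \<le> (\<Sum>k\<le>M. (K * (2 ^ k * \<rho>)) ^ d * q k)"
    by (intro sum_mono mult_right_mono count q)
  also have "\<dots> = (\<Sum>k\<le>M. 2 ^ (d + 1) * K ^ d * \<rho> ^ d * (1/2) ^ k)"
  proof (rule sum.cong[OF refl])
    fix k
    have "(2 ^ k) ^ d * ((1/2::real) ^ k) ^ (d + 1) = (1/2) ^ k"
      by (simp add: power_mult_distrib[symmetric] mult.left_commute power_one_over)
    then show "(K * (2 ^ k * \<rho>)) ^ d * q k = 2 ^ (d + 1) * K ^ d * \<rho> ^ d * (1/2) ^ k"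
      unfolding q_def power_mult_distrib by (simp add: mult_ac)
  qed
  also have "\<dots> = 2 ^ (d + 1) * K ^ d * \<rho> ^ d * (\<Sum>k\<le>M. (1/2) ^ k)" by (simp add: sum_distrib_left)
  also have "(\<Sum>k\<le>M. (1/2::real) ^ k) = 2 - (1/2) ^ M" by (induction M) auto
  then have "(\<Sum>k\<le>M. (1/2::real) ^ k) \<le> 2" by simp
  then have "2 ^ (d + 1) * K ^ d * \<rho> ^ d * (\<Sum>k\<le>M. (1/2) ^ k) \<le> 2 ^ (d + 1) * K ^ d * \<rho> ^ d * 2"
    using K \<rho> by (intro mult_left_mono) auto
  finally show ?thesis by (simp add: packing_const_def K_def d_def r_def mult_ac)
qed

subsection \<open>Gaussian kernels on separated sets\<close>

lemma psd_cos: "psd I (\<lambda>i j. cos (w * (x i - x j)))"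
proof -
  have "psd I (\<lambda>i j. cos (w * x i) * cos (w * x j) + sin (w * x i) * sin (w * x j))"
    by (intro psd_add psd_rank_one)
  then show ?thesis by (simp add: right_diff_distrib cos_diff)
qed

lemma integrable_std_normal_cos: "integrable lborel (\<lambda>w. std_normal_density w * cos (w * x))"
proof (rule Bochner_Integration.integrable_bound)
  show "integrable lborel std_normal_density" by simp
qed (auto simp: abs_mult mult_left_le)

text \<open>The left side is the real part of the characteristic function of the standard normal
  distribution.\<close>

lemma integral_std_normal_cos:
  "(\<integral>w. std_normal_density w * cos (w * x) \<partial>lborel) = exp (- x\<^sup>2 / 2)"
proof -
  interpret real_distribution std_normal_distribution by (rule real_dist_normal_dist)
  have int: "integrable std_normal_distribution (\<lambda>w. iexp (x * w))" by (rule integrable_iexp) auto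
  have "(\<integral>w. std_normal_density w * cos (w * x) \<partial>lborel) = (\<integral>w. cos (w * x) \<partial>std_normal_distribution)"
    by (subst integral_density) (auto simp: normal_density_nonneg)
  also have "\<dots> = (\<integral>w. Re (iexp (x * w)) \<partial>std_normal_distribution)"
    by (simp add: Re_exp mult.commute)
  also have "\<dots> = Re (char std_normal_distribution x)"
    unfolding char_def by (rule integral_Re[OF int])
  finally show ?thesis by (simp add: char_std_normal_distribution del: of_real_exp)
qed

text \<open>For nonzero \<open>R\<close> and \<open>x\<close> this is
  \<open>(sin (R * x / 2) / (R * x / 2))^2\<close>, continued by its limit at 0. Up to normalization
  it is the cosine transform of the triangle \<open>R - w\<close> on \<open>[0, R]\<close>. Larger
  \<open>R\<close> makes it narrower at a fixed height.\<close>

definition fejer :: "real \<Rightarrow> real \<Rightarrow> real" where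
  "fejer R x = (if x = 0 then 1 else 2 * (1 - cos (R * x)) / (R * x)\<^sup>2)"

lemma fejer_nonneg: "0 \<le> fejer R x"
  by (simp add: fejer_def)

lemma fejer_0 [simp]: "fejer R 0 = 1"
  by (simp add: fejer_def)

lemma fejer_le_decay: "x \<noteq> 0 \<Longrightarrow> fejer R x \<le> (2 / (R * x))\<^sup>2"
proof -
  have "1 - cos (R * x) \<le> 2" using cos_ge_minus_one[of "R * x"] by linarith
  then have "2 * (1 - cos (R * x)) \<le> 2 * 2" by (rule mult_left_mono) simp
  then have "2 * (1 - cos (R * x)) / (R * x)\<^sup>2 \<le> 2 * 2 / (R * x)\<^sup>2" by (rule divide_right_mono) simp
  then show "x \<noteq> 0 \<Longrightarrow> fejer R x \<le> (2 / (R * x))\<^sup>2"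
    by (simp add: fejer_def power_divide)
qed

lemma
  assumes R: "0 < R"
  shows integral_fejer: "(\<integral>w. indicator {0..R} w *\<^sub>R ((R - w) * cos (w * x)) \<partial>lborel) = R\<^sup>2 / 2 * fejer R x"
    and integrable_fejer: "integrable lborel (\<lambda>w. indicator {0..R} w *\<^sub>R ((R - w) * cos (w * x)))"
proof -
  show "integrable lborel (\<lambda>w. indicator {0..R} w *\<^sub>R ((R - w) * cos (w * x)))"
    by (intro borel_integrable_compact) (auto intro!: continuous_intros)
  show "(\<integral>w. indicator {0..R} w *\<^sub>R ((R - w) * cos (w * x)) \<partial>lborel) = R\<^sup>2 / 2 * fejer R x"
  proof (cases "x = 0")
    case True
    have "(\<integral>w. indicator {0..R} w *\<^sub>R ((R - w) * cos (w * x)) \<partial>lborel) =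
        (R * R - R\<^sup>2 / 2) - (R * 0 - 0\<^sup>2 / 2)"
      using R by (intro integral_FTC_atLeastAtMost[where F = "\<lambda>w. R * w - w\<^sup>2 / 2"])
        (auto intro!: derivative_eq_intros continuous_intros simp: True
          simp flip: has_real_derivative_iff_has_vector_derivative)
    then show ?thesis using True by (simp add: power2_eq_square)
  next
    case False
    have "(\<integral>w. indicator {0..R} w *\<^sub>R ((R - w) * cos (w * x)) \<partial>lborel) =
        ((R - R) * sin (R * x) / x - cos (R * x) / x\<^sup>2) - ((R - 0) * sin (0 * x) / x - cos (0 * x) / x\<^sup>2)"
      using R False
      by (intro integral_FTC_atLeastAtMost[where F = "\<lambda>w. (R - w) * sin (w * x) / x - cos (w * x) / x\<^sup>2"])
        (auto intro!: derivative_eq_intros continuous_intros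
          simp: power2_eq_square field_simps
          simp flip: has_real_derivative_iff_has_vector_derivative)
    also have "\<dots> = R\<^sup>2 / 2 * fejer R x"
      using False R by (simp add: fejer_def field_simps power2_eq_square)
    finally show ?thesis .
  qed
qed

lemma psd_fejer:
  assumes "0 < R" shows "psd I (\<lambda>i j. fejer R (x i - x j))"
proof -
  have "psd I (\<lambda>i j. \<integral>w. indicator {0..R} w *\<^sub>R ((R - w) * cos (w * (x i - x j))) \<partial>lborel)"
  proof (rule psd_integral)
    fix w show "psd I (\<lambda>i j. indicator {0..R} w *\<^sub>R ((R - w) * cos (w * (x i - x j))))"
      using psd_cmult[OF psd_cos[of I w x], of "indicator {0..R} w * (R - w)"]
      by (simp add: mult.assoc indicator_def)
  qed (rule integrable_fejer[OF assms])
  then have "psd I (\<lambda>i j. 2 / R\<^sup>2 * (R\<^sup>2 / 2 * fejer R (x i - x j)))"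
    unfolding integral_fejer[OF assms] by (rule psd_cmult) simp
  then show ?thesis using assms by simp
qed

text \<open>A positive semidefinite kernel is bounded by its diagonal: test on the points 0 and
  \<open>x\<close> with weights 1 and -1.\<close>

lemma fejer_le_1:
  assumes "0 < R" shows "fejer R x \<le> 1"
proof (cases "x = 0")
  case False
  have "psd {0, x} (\<lambda>i j. fejer R (i - j))" using psd_fejer[OF assms, of _ "\<lambda>i. i"] .
  from psd_nonneg[OF this, of "\<lambda>i. if i = 0 then 1 else -1"] False
  have "0 \<le> 2 - fejer R (- x) - fejer R x" by simp
  moreover have "fejer R (- x) = fejer R x" by (simp add: fejer_def)
  ultimately show ?thesis by simp
qed simp

text \<open>The Fourier transform of the Gaussian is bounded below on \<open>[0, R]\<close>, hence dominates a small
  multiple of the triangular function with Fourier transform \<open>fejer R\<close>.\<close>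

lemma gaussian_dominates_fejer:
  assumes "0 < R"
  obtains c where "0 < c"
    "\<And>I (x :: 'i \<Rightarrow> real). psd I (\<lambda>i j. exp (- (x i - x j)\<^sup>2 / 2) - c * fejer R (x i - x j))"
proof
  \<comment> \<open>The triangle \<open>m * (R - w)\<close> then has height
    \<open>std_normal_density R\<close> at \<open>w = 0\<close>, which is the minimum of the density
    on \<open>[0, R]\<close>.\<close>
  define m where "m = std_normal_density R / R"
  have m: "0 < m" using assms by (simp add: m_def normal_density_pos)
  show "0 < m * R\<^sup>2 / 2" using m assms by simp
  fix I and x :: "'i \<Rightarrow> real"
  let ?g = "\<lambda>w y. std_normal_density w * cos (w * y) - m * (indicator {0..R} w *\<^sub>R ((R - w) * cos (w * y)))"
  have "psd I (\<lambda>i j. \<integral>w. ?g w (x i - x j) \<partial>lborel)"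
  proof (rule psd_integral)
    fix w
    have "0 \<le> std_normal_density w - m * (indicator {0..R} w * (R - w))"
    proof (cases "w \<in> {0..R}")
      case True
      have "m * (R - w) \<le> m * R" using True m by (intro mult_left_mono) auto
      also have "\<dots> = std_normal_density R" using assms by (simp add: m_def)
      also have "\<dots> \<le> std_normal_density w"
        using True by (simp add: normal_density_def power_mono divide_right_mono)
      finally show ?thesis using True by simp
    qed (simp add: normal_density_nonneg)
    from psd_cmult[OF psd_cos[of I w x] this]
    show "psd I (\<lambda>i j. ?g w (x i - x j))" by (simp add: algebra_simps)
  qed (intro Bochner_Integration.integrable_diff integrable_mult_right integrable_std_normal_cos
      integrable_fejer assms)
  also have "(\<lambda>i j. \<integral>w. ?g w (x i - x j) \<partial>lborel) =
      (\<lambda>i j. exp (- (x i - x j)\<^sup>2 / 2) - m * R\<^sup>2 / 2 * fejer R (x i - x j))"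
    by (subst Bochner_Integration.integral_diff
          [OF integrable_std_normal_cos integrable_mult_right[OF integrable_fejer[OF assms]]])
       (simp only: integral_std_normal_cos integral_mult_right_zero integral_fejer[OF assms], simp add: mult.assoc)
  finally show "psd I (\<lambda>i j. exp (- (x i - x j)\<^sup>2 / 2) - m * R\<^sup>2 / 2 * fejer R (x i - x j))" .
qed

lemma prod_exp_inner:
  fixes z :: "'a::euclidean_space"
  shows "(\<Prod>b\<in>Basis. exp (- (z \<bullet> b / t)\<^sup>2 / 2)) = exp (- (norm z / t)\<^sup>2 / 2)"
proof -
  have "(\<Sum>b\<in>Basis. - (z \<bullet> b / t)\<^sup>2 / 2) = - (norm z / t)\<^sup>2 / 2"
    unfolding power_divide power2_norm_eq_inner euclidean_inner[of z z]
    by (simp add: power2_eq_square sum_negf flip: sum_divide_distrib)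
  then show ?thesis by (simp flip: exp_sum)
qed

text \<open>Some coordinate of \<open>z\<close> is at least \<open>norm z / sqrt n\<close> in
  absolute value, and its factor alone is at most the square of
  \<open>min 1 (\<rho> / norm z)\<close>; the others are at most 1. The n-th power has exponent
  \<open>2 * n\<close>, enough for the \<open>n + 1\<close> of \<open>separated_sum_le\<close>. The
  scaling by \<open>sqrt n\<close> makes the n-th power of the corresponding Gaussian product the
  unscaled Gaussian.\<close>

lemma prod_fejer_decay:
  fixes z :: "'a::euclidean_space"
  defines "n \<equiv> DIM('a)"
  assumes R: "0 < R" and \<rho>: "\<rho> = 2 * n / R" and z: "z \<noteq> 0"
  shows "(\<Prod>b\<in>Basis. fejer R (z \<bullet> b / sqrt n)) ^ n \<le> min 1 (\<rho> / norm z) ^ (n + 1)"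
proof -
  have n: "0 < n" by (simp add: n_def)
  let ?q = "min 1 (\<rho> / norm z)"
  have q: "0 \<le> ?q" "?q \<le> 1" using R \<rho> by auto
  obtain b :: 'a where b: "b \<in> Basis" "norm z / sqrt n \<le> \<bar>z \<bullet> b\<bar>"
  proof -
    have "infnorm z \<in> (\<lambda>b. \<bar>z \<bullet> b\<bar>) ` Basis"
      unfolding infnorm_Max by (rule Max_in) auto
    moreover have "norm z \<le> sqrt n * infnorm z" unfolding n_def by (rule norm_le_infnorm)
    ultimately show ?thesis using that n by (auto simp: field_simps)
  qed
  have pos: "0 < norm z / sqrt n" using z n by simp
  have nz: "z \<bullet> b \<noteq> 0" using b(2) pos by auto
  have "fejer R (z \<bullet> b / sqrt n) \<le> (2 / (R * (z \<bullet> b / sqrt n)))\<^sup>2"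
    by (rule fejer_le_decay) (use nz n in auto)
  also have "\<dots> = (2 / (R * (\<bar>z \<bullet> b\<bar> / sqrt n)))\<^sup>2"
    by (simp add: power_mult_distrib power_divide)
  also have "\<dots> \<le> (2 / (R * (norm z / sqrt n / sqrt n)))\<^sup>2"
    using R pos n b(2) nz
    by (intro power_mono divide_left_mono mult_left_mono divide_right_mono mult_pos_pos divide_pos_pos) (use z in auto)
  also have "\<dots> = (\<rho> / norm z)\<^sup>2" using n by (simp add: \<rho> real_div_sqrt)
  finally have "fejer R (z \<bullet> b / sqrt n) \<le> ?q\<^sup>2"
    using fejer_le_1[OF R, of "z \<bullet> b / sqrt n"] by (auto simp: min_def)
  moreover have "(\<Prod>c\<in>Basis. fejer R (z \<bullet> c / sqrt n)) \<le> fejer R (z \<bullet> b / sqrt n)"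
  proof -
    have "(\<Prod>c\<in>Basis - {b}. fejer R (z \<bullet> c / sqrt n)) \<le> 1"
      by (intro prod_le_1) (auto simp: fejer_nonneg fejer_le_1 R)
    then have "fejer R (z \<bullet> b / sqrt n) * (\<Prod>c\<in>Basis - {b}. fejer R (z \<bullet> c / sqrt n)) \<le> fejer R (z \<bullet> b / sqrt n)"
      by (intro mult_left_le) (auto simp: fejer_nonneg)
    then show ?thesis using prod.remove[OF finite_Basis b(1), of "\<lambda>c. fejer R (z \<bullet> c / sqrt n)"] by simp
  qed
  ultimately have "(\<Prod>c\<in>Basis. fejer R (z \<bullet> c / sqrt n)) \<le> ?q\<^sup>2" by simp
  then have "(\<Prod>c\<in>Basis. fejer R (z \<bullet> c / sqrt n)) ^ n \<le> (?q\<^sup>2) ^ n"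
    by (intro power_mono prod_nonneg) (auto simp: fejer_nonneg)
  also have "\<dots> \<le> ?q ^ (n + 1)"
    unfolding power_mult[symmetric] using q n by (intro power_decreasing) auto
  finally show ?thesis .
qed

text \<open>One constant \<open>c\<close> serves all configurations at once; this uniformity over
  \<open>I\<close> and \<open>x\<close> is what passes to infinite sequences. Natural numbers
  suffice as indices because only finitely many points occur at a time.\<close>

definition psd_lower_bound :: "real \<Rightarrow> ('a::real_normed_vector \<Rightarrow> real) \<Rightarrow> real \<Rightarrow> bool" where
  "psd_lower_bound \<delta> g c \<longleftrightarrow> (\<forall>I (x :: nat \<Rightarrow> 'a). finite I \<longrightarrow>
     (\<forall>i\<in>I. \<forall>j\<in>I. i \<noteq> j \<longrightarrow> \<delta> \<le> norm (x i - x j)) \<longrightarrow>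
     psd I (\<lambda>i j. g (x i - x j) - c * of_bool (i = j)))"

lemma psd_lower_boundD:
  fixes x :: "nat \<Rightarrow> 'a::real_normed_vector"
  assumes "psd_lower_bound \<delta> g c" "finite I"
    "\<And>i j. i \<in> I \<Longrightarrow> j \<in> I \<Longrightarrow> i \<noteq> j \<Longrightarrow> \<delta> \<le> norm (x i - x j)"
  shows "psd I (\<lambda>i j. g (x i - x j) - c * of_bool (i = j))"
  using assms(2,3) by (intro assms(1)[unfolded psd_lower_bound_def, rule_format]) auto

lemma psd_lower_boundI:
  assumes "\<And>I (x :: nat \<Rightarrow> 'a::real_normed_vector). finite I \<Longrightarrow> (\<And>i j. i \<in> I \<Longrightarrow> j \<in> I \<Longrightarrow> i \<noteq> j \<Longrightarrow> \<delta> \<le> norm (x i - x j)) \<Longrightarrow>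
    psd I (\<lambda>i j. g (x i - x j) - c * of_bool (i = j))"
  shows "psd_lower_bound \<delta> g c"
  unfolding psd_lower_bound_def by (intro allI impI assms) auto

text \<open>The parameter \<open>R\<close> depends on \<open>\<delta>\<close> and the dimension
  alone: it is so large that the off-diagonal row sums of the Fejer products are at most half of
  their unit diagonal.\<close>

lemma gaussian_strong:
  assumes \<delta>: "0 < \<delta>"
  obtains c where "0 < c" "psd_lower_bound \<delta> (\<lambda>z :: 'a::euclidean_space. exp (- (norm z)\<^sup>2 / 2)) c"
proof -
  define n where "n = DIM('a)"
  have n: "0 < n" by (simp add: n_def)
  define C where "C = packing_const \<delta> n"
  have C: "0 < C" using packing_const_pos[OF \<delta>] by (simp add: C_def)
  \<comment> \<open>Since \<open>n \<ge> 1\<close> and \<open>\<rho> \<le> 1\<close>, this gives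
    \<open>C * \<rho>^n \<le> C * \<rho> \<le> 1/2\<close>; \<open>R\<close> is then read off from
    \<open>prod_fejer_decay\<close>.\<close>
  define \<rho> where "\<rho> = 1 / (2 * (C + 1))"
  have \<rho>: "0 < \<rho>" "\<rho> \<le> 1" using C by (auto simp: \<rho>_def)
  have "C * \<rho> ^ n \<le> C * \<rho>" using \<rho> n C power_decreasing[of 1 n \<rho>] by simp
  also have "\<dots> \<le> 1/2" using C by (simp add: \<rho>_def field_simps)
  finally have C\<rho>: "C * \<rho> ^ n \<le> 1/2" .
  define R where "R = 2 * n / \<rho>"
  have R: "0 < R" using \<rho> n by (simp add: R_def)
  obtain c where c: "0 < c"
    "\<And>I (x :: nat \<Rightarrow> real). psd I (\<lambda>i j. exp (- (x i - x j)\<^sup>2 / 2) - c * fejer R (x i - x j))"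
    using gaussian_dominates_fejer[OF R] by blast
  show ?thesis
  proof
    \<comment> \<open>One factor \<open>c\<close> for each coordinate and each of the n powers; the
      1/2 is the part of the diagonal left over by dominance.\<close>
    show "0 < (c ^ n) ^ n * (1/2)" using c(1) by simp
    show "psd_lower_bound \<delta> (\<lambda>z :: 'a. exp (- (norm z)\<^sup>2 / 2)) ((c ^ n) ^ n * (1/2))"
    proof (rule psd_lower_boundI)
      fix I and x :: "nat \<Rightarrow> 'a"
      assume I: "finite I" and sep: "\<And>i j. i \<in> I \<Longrightarrow> j \<in> I \<Longrightarrow> i \<noteq> j \<Longrightarrow> \<delta> \<le> norm (x i - x j)"
      define y where "y = (\<lambda>b i. x i \<bullet> b / sqrt n)"
      define H where "H = (\<lambda>i j. (\<Prod>b\<in>Basis. fejer R (y b i - y b j)) ^ n)"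
      have y: "y b i - y b j = (x i - x j) \<bullet> b / sqrt n" for b i j
        by (simp add: y_def inner_diff_left diff_divide_distrib)
      have gauss: "(\<Prod>b\<in>Basis. exp (- (y b i - y b j)\<^sup>2 / 2)) ^ n = exp (- (norm (x i - x j))\<^sup>2 / 2)" for i j
        unfolding y prod_exp_inner using n by (simp add: power_divide exp_of_nat_mult[symmetric])
      have "psd I (\<lambda>i j. (\<Prod>b\<in>Basis. exp (- (y b i - y b j)\<^sup>2 / 2)) ^ n
          - (\<Prod>b\<in>Basis. c * fejer R (y b i - y b j)) ^ n)"
        by (intro psd_power_mono psd_prod_mono psd_prod psd_cmult psd_fejer I R c(2)) (use c(1) in auto)
      then have 1: "psd I (\<lambda>i j. exp (- (norm (x i - x j))\<^sup>2 / 2) - (c ^ n) ^ n * H i j)"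
        unfolding gauss H_def by (simp add: prod.distrib power_mult_distrib n_def)
      have "psd I (\<lambda>i j. H i j - 1/2 * of_bool (i = j))"
      proof (rule psd_diag_dominant[OF I])
        have "psd I H" unfolding H_def by (intro psd_power psd_prod psd_fejer I R)
        then show "H i j - 1/2 * of_bool (i = j) = H j i - 1/2 * of_bool (j = i)"
          if "i \<in> I" "j \<in> I" for i j using that psd_sym[of I H i j] by auto
        fix i assume i: "i \<in> I"
        have "(\<Sum>j\<in>I - {i}. \<bar>H i j - 1/2 * of_bool (i = j)\<bar>) = (\<Sum>j\<in>I - {i}. H i j)"
          unfolding H_def by (intro sum.cong refl) (auto simp: fejer_nonneg prod_nonneg)
        also have "\<dots> \<le> (\<Sum>j\<in>I - {i}. min 1 (\<rho> / norm (x j - x i)) ^ (n + 1))"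
        proof (rule sum_mono)
          fix j assume j: "j \<in> I - {i}"
          have "H i j \<le> min 1 (\<rho> / norm (x i - x j)) ^ (n + 1)"
            unfolding H_def y n_def
          proof (rule prod_fejer_decay[OF R])
            show "\<rho> = 2 * DIM('a) / R" using n by (simp add: R_def n_def)
            show "x i - x j \<noteq> 0" using sep[OF i, of j] j \<delta> by auto
          qed
          then show "H i j \<le> min 1 (\<rho> / norm (x j - x i)) ^ (n + 1)" by (simp add: norm_minus_commute)
        qed
        also have "\<dots> \<le> C * \<rho> ^ n"
          unfolding C_def n_def
          using separated_sum_le[of "I - {i}" \<delta> \<rho> x UNIV "x i"] I \<delta> \<rho> sep i by auto
        also have "\<dots> \<le> 1/2" by (rule C\<rho>)
        also have "1/2 = H i i - 1/2 * of_bool (i = i)" by (simp add: H_def)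
        finally show "(\<Sum>j\<in>I - {i}. \<bar>H i j - 1/2 * of_bool (i = j)\<bar>) \<le> H i i - 1/2 * of_bool (i = i)" .
      qed
      then have "psd I (\<lambda>i j. (c ^ n) ^ n * (H i j - 1/2 * of_bool (i = j)))"
        by (rule psd_cmult) (use c(1) in auto)
      then have "psd I (\<lambda>i j. (c ^ n) ^ n * H i j - (c ^ n) ^ n * (1/2) * of_bool (i = j))"
        by (simp add: right_diff_distrib mult.assoc)
      from psd_le_trans[OF 1 this]
      show "psd I (\<lambda>i j. exp (- (norm (x i - x j))\<^sup>2 / 2) - (c ^ n) ^ n * (1/2) * of_bool (i = j))" .
    qed
  qed
qed

subsection \<open>Mixtures of stable kernels\<close>

lemma psd_exp:
  assumes "finite I" "psd I K" shows "psd I (\<lambda>i j. exp (K i j))"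
  using psd_of_le[OF psd_exp_minus_self[OF assms] assms(2)] .

lemma psd_gaussian:
  fixes x :: "'i \<Rightarrow> 'a::euclidean_space"
  assumes "finite I" "0 \<le> u"
  shows "psd I (\<lambda>i j. exp (- u * (norm (x i - x j))\<^sup>2))"
proof (cases "u = 0")
  case True
  then show ?thesis using psd_rank_one[of I "\<lambda>_. 1"] by simp
next
  case False
  have 1: "psd I (\<lambda>i j. exp (- (y i - y j)\<^sup>2 / 2))" for y :: "'i \<Rightarrow> real"
    unfolding integral_std_normal_cos[symmetric]
    by (intro psd_integral psd_cmult psd_cos integrable_std_normal_cos) (simp add: normal_density_nonneg)
  define t where "t = 1 / sqrt (2 * u)"
  have "psd I (\<lambda>i j. \<Prod>b\<in>Basis. exp (- (x i \<bullet> b / t - x j \<bullet> b / t)\<^sup>2 / 2))"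
    by (intro psd_prod assms 1)
  then have "psd I (\<lambda>i j. \<Prod>b\<in>Basis. exp (- ((x i - x j) \<bullet> b / t)\<^sup>2 / 2))"
    by (simp add: inner_diff_left diff_divide_distrib)
  then show ?thesis
    unfolding prod_exp_inner using assms(2) False by (simp add: t_def power_mult_distrib mult_ac)
qed

text \<open>Dilating the points by \<open>sqrt (2 * u)\<close> reduces to the standard Gaussian at
  separation \<open>sqrt (2 * u) * \<delta>\<close>.\<close>

lemma gaussian_strong_scaled:
  assumes \<delta>: "0 < \<delta>" and u: "0 < u"
  obtains c where "0 < c" "psd_lower_bound \<delta> (\<lambda>z :: 'a::euclidean_space. exp (- u * (norm z)\<^sup>2)) c"
proof -
  let ?t = "sqrt (2 * u)"
  have t: "0 < ?t" using u by simp
  obtain c where c: "0 < c" "psd_lower_bound (?t * \<delta>) (\<lambda>z :: 'a. exp (- (norm z)\<^sup>2 / 2)) c"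
    using gaussian_strong[OF mult_pos_pos[OF t \<delta>]] by blast
  have "psd_lower_bound \<delta> (\<lambda>z :: 'a. exp (- u * (norm z)\<^sup>2)) c"
  proof (rule psd_lower_boundI)
    fix I and x :: "nat \<Rightarrow> 'a"
    assume I: "finite I" and sep: "\<And>i j. i \<in> I \<Longrightarrow> j \<in> I \<Longrightarrow> i \<noteq> j \<Longrightarrow> \<delta> \<le> norm (x i - x j)"
    have nrm: "norm (?t *\<^sub>R x i - ?t *\<^sub>R x j) = ?t * norm (x i - x j)" for i j
      using t by (simp flip: scaleR_diff_right)
    have "psd I (\<lambda>i j. exp (- (norm (?t *\<^sub>R x i - ?t *\<^sub>R x j))\<^sup>2 / 2) - c * of_bool (i = j))"
    proof (rule psd_lower_boundD[OF c(2) I])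
      show "?t * \<delta> \<le> norm (?t *\<^sub>R x i - ?t *\<^sub>R x j)" if "i \<in> I" "j \<in> I" "i \<noteq> j" for i j
        unfolding nrm using sep[OF that] t by (intro mult_left_mono) auto
    qed
    then show "psd I (\<lambda>i j. exp (- u * (norm (x i - x j))\<^sup>2) - c * of_bool (i = j))"
      unfolding nrm using u by (simp add: power_mult_distrib)
  qed
  with c(1) show thesis by (rule that)
qed

section \<open>Power integrals and the Levy representation of powers\<close>

lemma
  fixes e a :: real
  assumes "e < -1" "0 < a"
  shows integrable_powr_tail: "integrable lborel (\<lambda>u. indicator {a..} u * u powr e)"
    and integral_powr_tail: "(\<integral>u. indicator {a..} u * u powr e \<partial>lborel) = - (a powr (e + 1)) / (e + 1)"
proof -
  have hi: "((\<lambda>u. u powr e) has_integral - (a powr (e + 1)) / (e + 1)) {a..}"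
    by (rule has_integral_powr_to_inf[OF assms])
  then have "(\<lambda>u. u powr e) absolutely_integrable_on {a..}"
    by (intro nonnegative_absolutely_integrable_1) (auto simp: integrable_on_def)
  then show int: "integrable lborel (\<lambda>u. indicator {a..} u * u powr e)"
    by (simp add: set_integrable_def integrable_completion)
  have "((\<lambda>u. indicator {a..} u * u powr e) has_integral - (a powr (e + 1)) / (e + 1)) UNIV"
  proof -
    have "(\<lambda>u. indicator {a..} u * u powr e) = (\<lambda>u. if u \<in> {a..} then u powr e else 0)"
      by (auto simp: indicator_def)
    then show ?thesis using hi by (simp only: has_integral_restrict_UNIV)
  qed
  with has_integral_integral_lborel[OF int]
  show "(\<integral>u. indicator {a..} u * u powr e \<partial>lborel) = - (a powr (e + 1)) / (e + 1)"
    by (rule has_integral_unique)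
qed

lemma integrable_powr_head:
  fixes e a :: real
  assumes "-1 < e" "0 \<le> a"
  shows "integrable lborel (\<lambda>u. indicator {0..a} u * u powr e)"
proof -
  have "(\<lambda>u. u powr e) absolutely_integrable_on {0..a}"
    by (intro nonnegative_absolutely_integrable_1 integrable_on_powr_from_0 assms) auto
  then show ?thesis by (simp add: set_integrable_def integrable_completion)
qed

text \<open>The Levy-Khintchine integral of the Bernstein function \<open>l powr \<beta>\<close>, up
  to a constant factor. The indicator restricts the Lebesgue integral to positive
  \<open>u\<close>.\<close>

definition levy_integral :: "real \<Rightarrow> real \<Rightarrow> real" where
  "levy_integral \<beta> l = (\<integral>u. indicator {0<..} u * ((1 - exp (- u * l)) * u powr (- 1 - \<beta>)) \<partial>lborel)"

context
  fixes \<beta> :: real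
  assumes \<beta>: "0 < \<beta>" "\<beta> < 1"
begin

text \<open>Near 0 the bound \<open>1 - exp (- u * l) \<le> u * l\<close> leaves
  \<open>u powr (- \<beta>)\<close>, integrable because \<open>\<beta> < 1\<close>; at infinity the
  bound 1 leaves \<open>u powr (- 1 - \<beta>)\<close>, integrable because
  \<open>\<beta> > 0\<close>.\<close>

lemma integrable_levy:
  assumes l: "0 \<le> l"
  shows "integrable lborel (\<lambda>u. indicator {0<..} u * ((1 - exp (- u * l)) * u powr (- 1 - \<beta>)))"
proof (rule Bochner_Integration.integrable_bound)
  show "integrable lborel (\<lambda>u. l * (indicator {0..1} u * u powr (- \<beta>)) + indicator {1..} u * u powr (- 1 - \<beta>))"
    using \<beta> by (intro Bochner_Integration.integrable_add integrable_mult_right integrable_powr_head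
        integrable_powr_tail) auto
  show "AE u in lborel. norm (indicator {0<..} u * ((1 - exp (- u * l)) * u powr (- 1 - \<beta>)))
      \<le> norm (l * (indicator {0..1} u * u powr (- \<beta>)) + indicator {1..} u * u powr (- 1 - \<beta>))"
  proof (rule AE_I2)
    fix u :: real
    have "(1 - exp (- u * l)) * u powr (- 1 - \<beta>) \<le> l * u powr (- \<beta>)" if "0 < u"
    proof -
      have "1 - exp (- u * l) \<le> u * l" using exp_ge_add_one_self[of "- u * l"] by simp
      then have "(1 - exp (- u * l)) * u powr (- 1 - \<beta>) \<le> u * l * u powr (- 1 - \<beta>)"
        by (rule mult_right_mono) simp
      also have "\<dots> = l * u powr (- \<beta>)" using that by (simp add: powr_mult_base)
      finally show ?thesis .
    qed
    moreover have "(1 - exp (- u * l)) * u powr (- 1 - \<beta>) \<le> u powr (- 1 - \<beta>)"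
      using mult_right_mono[of "1 - exp (- u * l)" 1 "u powr (- 1 - \<beta>)"] by simp
    moreover have "0 \<le> 1 - exp (- u * l)" if "0 < u" using that l by simp
    ultimately show "norm (indicator {0<..} u * ((1 - exp (- u * l)) * u powr (- 1 - \<beta>)))
      \<le> norm (l * (indicator {0..1} u * u powr (- \<beta>)) + indicator {1..} u * u powr (- 1 - \<beta>))"
      using l by (auto simp: indicator_def abs_mult)
  qed
qed auto

text \<open>Substitution of \<open>u / l\<close> for \<open>u\<close>. The factor
  \<open>levy_integral \<beta> 1\<close> stays unevaluated; its positivity is what later allows
  dividing by it.\<close>

lemma levy_integral_powr:
  assumes l: "0 \<le> l"
  shows "levy_integral \<beta> l = l powr \<beta> * levy_integral \<beta> 1"
proof (cases "l = 0")
  case False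
  with l have l: "0 < l" by simp
  let ?g = "\<lambda>u. indicator {0<..} u * ((1 - exp (- u * l)) * u powr (- 1 - \<beta>)) :: real"
  have "levy_integral \<beta> l = 1 / l * (\<integral>u. ?g (0 + 1 / l * u) \<partial>lborel)"
    unfolding levy_integral_def using l by (subst lborel_integral_real_affine[where c = "1 / l" and t = 0]) auto
  also have "(\<lambda>u. ?g (0 + 1 / l * u)) =
      (\<lambda>u. l powr (1 + \<beta>) * (indicator {0<..} u * ((1 - exp (- u * 1)) * u powr (- 1 - \<beta>))))"
  proof
    fix u
    have "(u / l) powr (- 1 - \<beta>) = u powr (- 1 - \<beta>) * l powr (1 + \<beta>)" if "0 < u"
      using that l by (simp add: powr_divide powr_minus_divide[of l "1 + \<beta>", simplified])
    then show "?g (0 + 1 / l * u) =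
        l powr (1 + \<beta>) * (indicator {0<..} u * ((1 - exp (- u * 1)) * u powr (- 1 - \<beta>)))"
      using l by (auto simp: indicator_def zero_less_divide_iff)
  qed
  also have "1 / l * (\<integral>u. l powr (1 + \<beta>) * (indicator {0<..} u * ((1 - exp (- u * 1)) * u powr (- 1 - \<beta>))) \<partial>lborel)
      = l powr \<beta> * levy_integral \<beta> 1"
    unfolding levy_integral_def using l by (simp add: powr_add)
  finally show ?thesis .
qed (simp add: levy_integral_def)

lemma levy_integral_pos: "0 < levy_integral \<beta> 1"
proof -
  have "0 < (1 - exp (- 1)) * (1 / \<beta>)" using \<beta> by simp
  also have "1 / \<beta> = (\<integral>u. indicator {1..} u * u powr (- 1 - \<beta>) \<partial>lborel)"
    using \<beta> by (subst integral_powr_tail) auto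
  also have "(1 - exp (- 1)) * \<dots> = (\<integral>u. (1 - exp (- 1)) * (indicator {1..} u * u powr (- 1 - \<beta>)) \<partial>lborel)"
    by simp
  also have "\<dots> \<le> levy_integral \<beta> 1"
    unfolding levy_integral_def
  proof (rule integral_mono)
    show "integrable lborel (\<lambda>u. (1 - exp (- 1)) * (indicator {1..} u * u powr (- 1 - \<beta>)))"
      using \<beta> by (intro integrable_mult_right integrable_powr_tail) auto
    show "integrable lborel (\<lambda>u. indicator {0<..} u * ((1 - exp (- u * 1)) * u powr (- 1 - \<beta>)))"
      by (rule integrable_levy) simp
    show "(1 - exp (- 1)) * (indicator {1..} u * u powr (- 1 - \<beta>)) \<le>
        indicator {0<..} u * ((1 - exp (- u * 1)) * u powr (- 1 - \<beta>))" for u :: real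
      by (auto simp: indicator_def mult_right_mono)
  qed
  finally show ?thesis .
qed

text \<open>Away from 0 the weight is integrable by itself, so in the truncated integral the
  constant 1 and the exponential can be separated. The full integrand dominates.\<close>

lemma levy_truncation_tendsto:
  assumes l: "0 \<le> l"
  shows "(\<lambda>n. \<integral>u. indicator {1 / (real n + 1)..} u * u powr (- 1 - \<beta>) * (1 - exp (- u * l)) \<partial>lborel)
      \<longlonglongrightarrow> levy_integral \<beta> l"
  unfolding levy_integral_def
proof (rule integral_dominated_convergence[OF _ _ integrable_levy[OF l]])
  show "AE u in lborel. (\<lambda>n. indicator {1 / (real n + 1)..} u * u powr (- 1 - \<beta>) * (1 - exp (- u * l)))
      \<longlonglongrightarrow> indicator {0<..} u * ((1 - exp (- u * l)) * u powr (- 1 - \<beta>))"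
  proof (rule AE_I2)
    fix u :: real
    show "(\<lambda>n. indicator {1 / (real n + 1)..} u * u powr (- 1 - \<beta>) * (1 - exp (- u * l)))
      \<longlonglongrightarrow> indicator {0<..} u * ((1 - exp (- u * l)) * u powr (- 1 - \<beta>))"
    proof (cases "0 < u")
      case True
      have "(\<lambda>n. 1 / (real n + 1)) \<longlonglongrightarrow> 0"
        using LIMSEQ_inverse_real_of_nat by (simp add: inverse_eq_divide add.commute)
      from order_tendstoD(2)[OF this True]
      have "\<forall>\<^sub>F n in sequentially. indicator {1 / (real n + 1)..} u * u powr (- 1 - \<beta>) * (1 - exp (- u * l)) =
          indicator {0<..} u * ((1 - exp (- u * l)) * u powr (- 1 - \<beta>))"
        by eventually_elim (use True in auto)
      then show ?thesis by (rule tendsto_eventually)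
    next
      case False
      then have "indicator {1 / (real n + 1)..} u = (0::real)" for n
        by (auto simp: indicator_def not_le intro: le_less_trans[of _ 0])
      then show ?thesis using False by simp
    qed
  qed
  show "AE u in lborel. norm (indicator {1 / (real n + 1)..} u * u powr (- 1 - \<beta>) * (1 - exp (- u * l)))
      \<le> indicator {0<..} u * ((1 - exp (- u * l)) * u powr (- 1 - \<beta>))" for n
  proof (rule AE_I2)
    fix u :: real
    have "0 < u" if "1 / (real n + 1) \<le> u" using that by (auto intro: less_le_trans[rotated])
    then show "norm (indicator {1 / (real n + 1)..} u * u powr (- 1 - \<beta>) * (1 - exp (- u * l)))
      \<le> indicator {0<..} u * ((1 - exp (- u * l)) * u powr (- 1 - \<beta>))"
      using l by (auto simp: indicator_def abs_mult)
  qed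
qed auto

text \<open>Truncating the representation \<open>C |x|\<^bsup>2\<beta>\<^esup> = \<integral> (1 - exp (- u |x|\<^sup>2)) u\<^bsup>-1-\<beta>\<^esup> du\<close>
  to \<open>u \<ge> 1 / (n + 1)\<close> turns it into \<open>A - \<phi>\<close> with a positive semidefinite \<open>\<phi>\<close>. The part of
  \<open>\<phi>\<close> coming from \<open>u \<ge> 1\<close> is strongly positive definite, with a bound that does not depend
  on \<open>n\<close>.\<close>

lemma exp_powr_strong_lt_2:
  assumes \<delta>: "0 < \<delta>" and s: "0 < s"
  obtains c where "0 < c"
    "psd_lower_bound \<delta> (\<lambda>z :: 'a::euclidean_space. exp (- s * norm z powr (2 * \<beta>))) c"
proof -
  obtain c where c: "0 < c" "psd_lower_bound \<delta> (\<lambda>z :: 'a. exp (- 1 * (norm z)\<^sup>2)) c"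
    using gaussian_strong_scaled[OF \<delta> zero_less_one] by blast
  define C where "C = levy_integral \<beta> 1"
  have C: "0 < C" unfolding C_def by (rule levy_integral_pos)
  \<comment> \<open>Chosen so that
    \<open>t * (l powr \<beta> * C) = s * l powr \<beta>\<close>.\<close>
  define t where "t = s / C"
  have t: "0 < t" using s C by (simp add: t_def)
  define a where "a = (\<lambda>n u. indicator {1 / (real n + 1)..} u * u powr (- 1 - \<beta>))"
  have a_nonneg: "0 \<le> a n u" for n u by (simp add: a_def)
  have int_a: "integrable lborel (a n)" for n
    unfolding a_def using \<beta> by (intro integrable_powr_tail) auto
  have a0: "integral\<^sup>L lborel (a 0) = 1 / \<beta>"
    unfolding a_def using \<beta> by (subst integral_powr_tail) auto
  have a_supp: "0 \<le> u" if "a n u \<noteq> 0" for n u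
    using that by (auto simp: a_def indicator_def split: if_splits intro: order_trans[rotated])
  have int_aexp: "integrable lborel (\<lambda>u. a n u * exp (- u * l))" if "0 \<le> l" for n l
  proof (rule Bochner_Integration.integrable_bound[OF int_a[of n]])
    show "AE u in lborel. norm (a n u * exp (- u * l)) \<le> norm (a n u)"
    proof (rule AE_I2)
      fix u
      show "norm (a n u * exp (- u * l)) \<le> norm (a n u)"
        using a_supp[of n u] that by (cases "a n u = 0") (auto simp: abs_mult intro!: mult_left_le)
    qed
  qed (auto simp: a_def)
  define \<phi> where "\<phi> = (\<lambda>n l. \<integral>u. a n u * exp (- u * l) \<partial>lborel)"
  define A where "A = (\<lambda>n. integral\<^sup>L lborel (a n))"
  have \<phi>0: "\<phi> n 0 = A n" for n by (simp add: \<phi>_def A_def)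
  have lim: "(\<lambda>n. A n - \<phi> n l) \<longlonglongrightarrow> l powr \<beta> * C" if "0 \<le> l" for l
  proof -
    have "A n - \<phi> n l = (\<integral>u. a n u * (1 - exp (- u * l)) \<partial>lborel)" for n
      unfolding A_def \<phi>_def using int_a int_aexp[OF that]
      by (simp add: right_diff_distrib flip: Bochner_Integration.integral_diff)
    then show ?thesis
      using levy_truncation_tendsto[OF that] levy_integral_powr[OF that] by (simp add: a_def C_def)
  qed
  \<comment> \<open>A bound free of \<open>n\<close>: \<open>t * (c * A 0)\<close> bounds the kernel
    \<open>exp (t * \<phi> 0)\<close> below, and \<open>exp (- t * A 0)\<close> is the part of the
    prefactor not spent on normalizing the diagonal of the remaining factor.\<close>
  define c' where "c' = exp (- t * A 0) * (t * (c * A 0))"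
  show thesis
  proof (rule that)
    show "0 < c'" using c(1) t \<beta> by (simp add: c'_def A_def a0)
    show "psd_lower_bound \<delta> (\<lambda>z :: 'a. exp (- s * norm z powr (2 * \<beta>))) c'"
    proof (rule psd_lower_boundI)
      fix I and x :: "nat \<Rightarrow> 'a"
      assume I: "finite I" and sep: "\<And>i j. i \<in> I \<Longrightarrow> j \<in> I \<Longrightarrow> i \<noteq> j \<Longrightarrow> \<delta> \<le> norm (x i - x j)"
      define N where "N = (\<lambda>i j. (norm (x i - x j))\<^sup>2)"
      have N0: "0 \<le> N i j" "N i i = 0" for i j by (auto simp: N_def)
      have gauss: "psd I (\<lambda>i j. exp (- u * N i j))" if "0 \<le> u" for u
        unfolding N_def by (rule psd_gaussian[OF I that])
      have head: "psd I (\<lambda>i j. \<phi> 0 (N i j) - c * A 0 * of_bool (i = j))"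
      proof -
        have "psd I (\<lambda>i j. \<integral>u. a 0 u * exp (- u * N i j) - c * of_bool (i = j) * a 0 u \<partial>lborel)"
        proof (rule psd_integral)
          fix u
          have "psd I (\<lambda>i j. a 0 u * (exp (- u * N i j) - c * of_bool (i = j)))"
          proof (cases "1 \<le> u")
            case True
            \<comment> \<open>The bound at \<open>u = 1\<close> carries over to
              \<open>u \<ge> 1\<close> with the same \<open>c\<close>, since the remaining Gaussian
              factor has unit diagonal.\<close>
            have "psd I (\<lambda>i j. exp (- 1 * N i j) * exp (- (u - 1) * N i j) - c * of_bool (i = j))"
              by (rule psd_mult_correlation[OF I _ gauss])
                (use True psd_lower_boundD[OF c(2) I sep] in \<open>auto simp: N_def\<close>)
            then have "psd I (\<lambda>i j. exp (- u * N i j) - c * of_bool (i = j))"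
              by (simp add: algebra_simps flip: exp_add)
            then show ?thesis by (rule psd_cmult) (rule a_nonneg)
          qed (simp add: a_def psd_zero)
          then show "psd I (\<lambda>i j. a 0 u * exp (- u * N i j) - c * of_bool (i = j) * a 0 u)"
            by (simp add: algebra_simps)
        qed (intro Bochner_Integration.integrable_diff int_aexp integrable_mult_right int_a N0)
        also have "(\<lambda>i j. \<integral>u. a 0 u * exp (- u * N i j) - c * of_bool (i = j) * a 0 u \<partial>lborel) =
            (\<lambda>i j. \<phi> 0 (N i j) - c * A 0 * of_bool (i = j))"
          by (subst Bochner_Integration.integral_diff[OF int_aexp[OF N0(1)] integrable_mult_right[OF int_a]])
             (simp add: \<phi>_def A_def mult_ac)
        finally show ?thesis .
      qed
      have tail: "psd I (\<lambda>i j. \<phi> n (N i j) - \<phi> 0 (N i j))" for n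
      proof -
        have "psd I (\<lambda>i j. \<integral>u. a n u * exp (- u * N i j) - a 0 u * exp (- u * N i j) \<partial>lborel)"
        proof (rule psd_integral)
          fix u
          have "psd I (\<lambda>i j. (a n u - a 0 u) * exp (- u * N i j))"
          proof (cases "0 \<le> u")
            case True
            have "1 / (real n + 1) \<le> u" if "1 \<le> u" by (rule order_trans[OF _ that]) simp
            then have "a 0 u \<le> a n u" by (auto simp: a_def indicator_def)
            then show ?thesis by (intro psd_cmult gauss True) simp
          next
            case False
            then have "a n u = 0" "a 0 u = 0" using a_supp by blast+
            then show ?thesis by (simp add: psd_zero)
          qed
          then show "psd I (\<lambda>i j. a n u * exp (- u * N i j) - a 0 u * exp (- u * N i j))"
            by (simp add: left_diff_distrib)
        qed (intro Bochner_Integration.integrable_diff int_aexp N0)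
        then show ?thesis
          unfolding \<phi>_def Bochner_Integration.integral_diff[OF int_aexp[OF N0(1)] int_aexp[OF N0(1)]] .
      qed
      have trunc: "psd I (\<lambda>i j. exp (- t * (A n - \<phi> n (N i j))) - c' * of_bool (i = j))" for n
      proof -
        have t\<phi>: "psd I (\<lambda>i j. t * \<phi> 0 (N i j) - t * (c * A 0) * of_bool (i = j))"
          using psd_cmult[OF head, of t] t by (simp add: right_diff_distrib mult.assoc)
        have "psd I (\<lambda>i j. t * (c * A 0) * of_bool (i = j))"
          using t c(1) \<beta> by (intro psd_cmult psd_delta) (simp add: A_def a0)
        with t\<phi> have "psd I (\<lambda>i j. t * \<phi> 0 (N i j))" by (rule psd_of_le)
        from psd_le_trans[OF psd_exp_minus_self[OF I this] t\<phi>]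
        have *: "psd I (\<lambda>i j. exp (t * \<phi> 0 (N i j)) - t * (c * A 0) * of_bool (i = j))" .
        \<comment> \<open>This factor has diagonal 1 because \<open>\<phi> n 0 = A n\<close>;
          multiplying \<open>exp (t * \<phi> 0)\<close> by it and by \<open>exp (- t * A 0)\<close>
          restores the truncated kernel.\<close>
        have "psd I (\<lambda>i j. exp (- t * (A n - A 0)) * exp (t * (\<phi> n (N i j) - \<phi> 0 (N i j))))"
          by (intro psd_cmult psd_exp I tail) (use t in auto)
        from psd_mult_correlation[OF I * this]
        have "psd I (\<lambda>i j. exp (t * \<phi> 0 (N i j)) * (exp (- t * (A n - A 0)) * exp (t * (\<phi> n (N i j) - \<phi> 0 (N i j))))
            - t * (c * A 0) * of_bool (i = j))"
          by (simp add: N0 \<phi>0 flip: exp_add)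
        from psd_cmult[OF this, of "exp (- t * A 0)"]
        have "psd I (\<lambda>i j. exp (- t * A 0) * (exp (t * \<phi> 0 (N i j)) * (exp (- t * (A n - A 0)) * exp (t * (\<phi> n (N i j) - \<phi> 0 (N i j)))))
            - c' * of_bool (i = j))"
          by (simp add: right_diff_distrib c'_def mult.assoc)
        then show ?thesis by (simp add: algebra_simps flip: exp_add)
      qed
      show "psd I (\<lambda>i j. exp (- s * norm (x i - x j) powr (2 * \<beta>)) - c' * of_bool (i = j))"
      proof (rule psd_lim[OF trunc])
        fix i j
        have "(N i j) powr \<beta> = norm (x i - x j) powr (2 * \<beta>)"
          by (simp add: N_def powr_powr flip: powr_numeral)
        then have "- s * norm (x i - x j) powr (2 * \<beta>) = - t * (N i j powr \<beta> * C)"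
          using C by (simp add: t_def)
        then show "(\<lambda>n. exp (- t * (A n - \<phi> n (N i j))) - c' * of_bool (i = j))
            \<longlonglongrightarrow> exp (- s * norm (x i - x j) powr (2 * \<beta>)) - c' * of_bool (i = j)"
          by (simp only:) (intro tendsto_intros lim N0)
      qed
    qed
  qed
qed

end

text \<open>The value 2 is treated apart: it would be the endpoint \<open>\<beta> = 1\<close>, at
  which the Levy integral diverges at 0.\<close>

lemma exp_powr_strong:
  assumes \<alpha>: "0 < \<alpha>" "\<alpha> \<le> 2" and \<delta>: "0 < \<delta>" and s: "0 < s"
  obtains c where "0 < c" "psd_lower_bound \<delta> (\<lambda>z :: 'a::euclidean_space. exp (- s * norm z powr \<alpha>)) c"
proof (cases "\<alpha> = 2")
  case True
  then have eq: "norm z powr \<alpha> = (norm z)\<^sup>2" for z :: 'a by (simp flip: powr_numeral)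
  show ?thesis
    unfolding eq by (rule gaussian_strong_scaled[OF \<delta> s, where 'a = 'a]) (rule that[unfolded eq])
next
  case False
  with \<alpha> have \<beta>: "0 < \<alpha> / 2" "\<alpha> / 2 < 1" and eq: "2 * (\<alpha> / 2) = \<alpha>" by auto
  show ?thesis by (rule exp_powr_strong_lt_2[OF \<beta> \<delta> s, unfolded eq]) (rule that)
qed

lemma psd_of_lower_bound:
  fixes x :: "nat \<Rightarrow> 'a::real_normed_vector"
  assumes "psd_lower_bound \<delta> g c" "0 \<le> c" "finite I"
    "\<And>i j. i \<in> I \<Longrightarrow> j \<in> I \<Longrightarrow> i \<noteq> j \<Longrightarrow> \<delta> \<le> norm (x i - x j)"
  shows "psd I (\<lambda>i j. g (x i - x j))"
  using psd_of_le[OF psd_lower_boundD[OF assms(1,3,4)] psd_cmult[OF psd_delta assms(2)]] by simp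

section \<open>Averaging over the Schoenberg measure\<close>

lemma schoenberg_measureD:
  assumes "schoenberg_measure \<alpha> f \<sigma>"
  shows "prob_space \<sigma>" "space \<sigma> = {0..}" "g \<in> borel_measurable borel \<Longrightarrow> g \<in> borel_measurable \<sigma>"
    "0 \<le> t \<Longrightarrow> f t = (\<integral>s. exp (- s * t powr \<alpha>) \<partial>\<sigma>)"
proof -
  have sets: "sets \<sigma> = sets (restrict_space borel {0..})" using assms by (simp add: schoenberg_measure_def)
  show "space \<sigma> = {0..}" using sets_eq_imp_space_eq[OF sets] by (simp add: space_restrict_space)
  show "g \<in> borel_measurable borel \<Longrightarrow> g \<in> borel_measurable \<sigma>"
    unfolding measurable_cong_sets[OF sets refl] by (rule measurable_restrict_space1)
qed (use assms in \<open>auto simp: schoenberg_measure_def\<close>)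

lemma schoenberg_integrable:
  assumes "schoenberg_measure \<alpha> f \<sigma>" "0 \<le> l"
  shows "integrable \<sigma> (\<lambda>s. exp (- s * l))"
proof -
  interpret prob_space \<sigma> using schoenberg_measureD(1)[OF assms(1)] .
  show ?thesis
    by (rule integrable_const_bound[where B = 1])
       (use assms(2) in \<open>auto simp: schoenberg_measureD(2)[OF assms(1)]
          intro!: AE_I2 schoenberg_measureD(3)[OF assms(1)]\<close>)
qed

text \<open>If no half-line \<open>{a..}\<close> with \<open>a > 0\<close> had mass, \<sigma> would
  be the unit mass at 0 and \<open>f\<close> would be 1 on the half-line.\<close>

lemma schoenberg_tail_pos:
  assumes sm: "schoenberg_measure \<alpha> f \<sigma>" and nc: "\<not> f constant_on {0..}"
  obtains a where "0 < a" "0 < measure \<sigma> ({a..} \<inter> space \<sigma>)"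
proof (rule ccontr)
  assume contra: "\<not> thesis"
  interpret prob_space \<sigma> using schoenberg_measureD(1)[OF sm] .
  have tail: "{a..} \<inter> space \<sigma> \<in> sets \<sigma>" for a
    using measurable_sets[OF schoenberg_measureD(3)[OF sm, of "\<lambda>s. s"], of "{a..}"] by simp
  have "AE s in \<sigma>. s < 1 / (real n + 1)" for n
  proof -
    have "measure \<sigma> ({1 / (real n + 1)..} \<inter> space \<sigma>) = 0"
      using contra that[of "1 / (real n + 1)"] measure_nonneg[of \<sigma>] by (fastforce simp: less_le)
    then have "{1 / (real n + 1)..} \<inter> space \<sigma> \<in> null_sets \<sigma>"
      using tail by (auto simp: null_sets_def emeasure_eq_measure)
    then show ?thesis by (rule AE_I') auto
  qed
  then have "AE s in \<sigma>. \<forall>n. s < 1 / (real n + 1)" by (simp add: AE_all_countable)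
  then have ae0: "AE s in \<sigma>. s = 0"
  proof (rule AE_mp, intro AE_I2 impI)
    fix s assume s: "s \<in> space \<sigma>" "\<forall>n. s < 1 / (real n + 1)"
    show "s = 0"
    proof (rule ccontr)
      assume "s \<noteq> 0"
      with s(1) have "0 < s" by (simp add: schoenberg_measureD(2)[OF sm])
      then obtain n where "inverse (real (Suc n)) < s" using reals_Archimedean by blast
      with s(2)[rule_format, of n] show False by (simp add: inverse_eq_divide add.commute)
    qed
  qed
  have "f t = 1" if "0 \<le> t" for t
  proof -
    have "f t = (\<integral>s. 1 \<partial>\<sigma>)"
      unfolding schoenberg_measureD(4)[OF sm that]
      by (rule integral_cong_AE) (use ae0 in \<open>auto intro!: schoenberg_measureD(3)[OF sm] elim: eventually_mono\<close>)
    then show ?thesis by (simp add: prob_space)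
  qed
  with nc show False by (auto simp: constant_on_def)
qed

text \<open>The constants of \<open>exp_powr_strong\<close> are not controlled as functions of
  \<open>s\<close>, so one \<open>a\<close> with mass beyond it is fixed: parameters
  \<open>s \<ge> a\<close> inherit its constant, and smaller ones contribute only a positive
  semidefinite kernel.\<close>

lemma schoenberg_lower_bound:
  assumes \<alpha>: "0 < \<alpha>" "\<alpha> \<le> 2" and sm: "schoenberg_measure \<alpha> f \<sigma>"
    and nc: "\<not> f constant_on {0..}" and \<delta>: "0 < \<delta>"
  obtains c where "0 < c" "psd_lower_bound \<delta> (\<lambda>z :: 'a::euclidean_space. f (norm z)) c"
proof -
  interpret prob_space \<sigma> using schoenberg_measureD(1)[OF sm] .
  obtain a where a: "0 < a" "0 < measure \<sigma> ({a..} \<inter> space \<sigma>)"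
    using schoenberg_tail_pos[OF sm nc] .
  have tail: "{a..} \<inter> space \<sigma> \<in> sets \<sigma>"
    using measurable_sets[OF schoenberg_measureD(3)[OF sm, of "\<lambda>s. s"], of "{a..}"] by simp
  obtain c where c: "0 < c" "psd_lower_bound \<delta> (\<lambda>z :: 'a. exp (- a * norm z powr \<alpha>)) c"
    using exp_powr_strong[OF \<alpha> \<delta> a(1), where 'a = 'a] .
  have "psd_lower_bound \<delta> (\<lambda>z :: 'a. f (norm z)) (c * measure \<sigma> ({a..} \<inter> space \<sigma>))"
  proof (rule psd_lower_boundI)
    fix I and x :: "nat \<Rightarrow> 'a"
    assume I: "finite I" and sep: "\<And>i j. i \<in> I \<Longrightarrow> j \<in> I \<Longrightarrow> i \<noteq> j \<Longrightarrow> \<delta> \<le> norm (x i - x j)"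
    define N where "N = (\<lambda>i j. norm (x i - x j) powr \<alpha>)"
    have N: "0 \<le> N i j" "N i i = 0" for i j by (auto simp: N_def)
    have kernel: "psd I (\<lambda>i j. exp (- s * N i j))" if "0 \<le> s" for s
    proof (cases "s = 0")
      case True
      then show ?thesis using psd_rank_one[of I "\<lambda>_. 1"] by simp
    next
      case False
      with that have "0 < s" by simp
      then obtain b where b: "0 < b" "psd_lower_bound \<delta> (\<lambda>z :: 'a. exp (- s * norm z powr \<alpha>)) b"
        using exp_powr_strong[OF \<alpha> \<delta>, where 'a = 'a] by blast
      show ?thesis unfolding N_def by (rule psd_of_lower_bound[OF b(2) _ I sep]) (use b(1) in auto)
    qed
    have int: "integrable \<sigma> (\<lambda>s. exp (- s * N i j))" for i j
      by (rule schoenberg_integrable[OF sm N(1)])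
    have int': "integrable \<sigma> (\<lambda>s. c * of_bool (i = j) * indicator ({a..} \<inter> space \<sigma>) s)" for i j
      using tail by (intro integrable_mult_right) (auto simp: emeasure_eq_measure)
    have "psd I (\<lambda>i j. \<integral>s. exp (- s * N i j) - c * of_bool (i = j) * indicator ({a..} \<inter> space \<sigma>) s \<partial>\<sigma>)"
    proof (rule psd_integral)
      fix s assume "s \<in> space \<sigma>"
      then have s: "0 \<le> s" by (simp add: schoenberg_measureD(2)[OF sm])
      show "psd I (\<lambda>i j. exp (- s * N i j) - c * of_bool (i = j) * indicator ({a..} \<inter> space \<sigma>) s)"
      proof (cases "a \<le> s")
        case True
        have "psd I (\<lambda>i j. exp (- a * N i j) * exp (- (s - a) * N i j) - c * of_bool (i = j))"
          by (rule psd_mult_correlation[OF I _ kernel])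
            (use True psd_lower_boundD[OF c(2) I sep] in \<open>auto simp: N_def\<close>)
        then show ?thesis
          using True \<open>s \<in> space \<sigma>\<close> by (simp add: algebra_simps flip: exp_add)
      qed (use kernel[OF s] in simp)
    qed (intro Bochner_Integration.integrable_diff int int')
    also have "(\<lambda>i j. \<integral>s. exp (- s * N i j) - c * of_bool (i = j) * indicator ({a..} \<inter> space \<sigma>) s \<partial>\<sigma>) =
        (\<lambda>i j. f (norm (x i - x j)) - c * measure \<sigma> ({a..} \<inter> space \<sigma>) * of_bool (i = j))"
      by (subst Bochner_Integration.integral_diff[OF int int'])
         (use tail in \<open>simp add: schoenberg_measureD(4)[OF sm] N_def mult_ac\<close>)
    finally show "psd I (\<lambda>i j. f (norm (x i - x j)) - c * measure \<sigma> ({a..} \<inter> space \<sigma>) * of_bool (i = j))" .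
  qed
  then show thesis using that c(1) a(2) by (meson mult_pos_pos)
qed

subsection \<open>The sequence space\<close>

abbreviation partial_norm :: "(nat \<Rightarrow> complex) \<Rightarrow> nat \<Rightarrow> real" where
  "partial_norm h n \<equiv> L2_set (\<lambda>k. cmod (h k)) {..<n}"

lemma partial_norm_le:
  assumes "h \<in> ell2" shows "partial_norm h n \<le> ell2_norm h"
  unfolding L2_set_def ell2_norm_def
  using assms by (intro real_sqrt_le_mono sum_le_suminf) (auto simp: ell2_def)

text \<open>Bounds on all finite sections give membership and norm bound together; this is how the
  finite inequalities of Minkowski and of Schur's test reach the sequence space.\<close>

lemma
  assumes "\<And>n. partial_norm h n \<le> C"
  shows ell2_of_bounded: "h \<in> ell2" and ell2_norm_le: "ell2_norm h \<le> C"
proof -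
  have C: "0 \<le> C" using assms[of 0] by simp
  have bound: "(\<Sum>k<n. (cmod (h k))\<^sup>2) \<le> C\<^sup>2" for n
    using assms[of n] unfolding L2_set_def by (rule sqrt_le_D)
  show "h \<in> ell2"
    unfolding ell2_def using bound
    by (auto intro!: summableI_nonneg_bounded)
  then have "(\<Sum>k. (cmod (h k))\<^sup>2) \<le> C\<^sup>2"
    unfolding ell2_def using bound by (intro suminf_le_const) auto
  then show "ell2_norm h \<le> C" unfolding ell2_norm_def using C by (simp add: real_le_lsqrt suminf_nonneg)
qed

lemma ell2_norm_nonneg [simp]: "0 \<le> ell2_norm h" if "h \<in> ell2"
  unfolding ell2_norm_def using that by (simp add: ell2_def suminf_nonneg)

lemma ell2_norm_sq: "h \<in> ell2 \<Longrightarrow> (ell2_norm h)\<^sup>2 = (\<Sum>k. (cmod (h k))\<^sup>2)"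
  unfolding ell2_norm_def by (simp add: ell2_def suminf_nonneg)

lemma cmod_le_ell2_norm: "h \<in> ell2 \<Longrightarrow> cmod (h k) \<le> ell2_norm h"
  using partial_norm_le[of h "Suc k"] member_le_L2_set[of "{..<Suc k}" k "\<lambda>k. cmod (h k)"] by simp

lemma
  assumes "h \<in> ell2" "g \<in> ell2"
  shows ell2_add: "(\<lambda>k. h k + g k) \<in> ell2"
    and ell2_norm_triangle: "ell2_norm (\<lambda>k. h k + g k) \<le> ell2_norm h + ell2_norm g"
proof -
  have "partial_norm (\<lambda>k. h k + g k) n \<le> ell2_norm h + ell2_norm g" for n
  proof -
    have "partial_norm (\<lambda>k. h k + g k) n \<le> L2_set (\<lambda>k. cmod (h k) + cmod (g k)) {..<n}"
      by (intro L2_set_mono) (auto intro: norm_triangle_ineq)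
    also have "\<dots> \<le> partial_norm h n + partial_norm g n" by (rule L2_set_triangle_ineq)
    finally show ?thesis using partial_norm_le[OF assms(1), of n] partial_norm_le[OF assms(2), of n] by linarith
  qed
  then show "(\<lambda>k. h k + g k) \<in> ell2" "ell2_norm (\<lambda>k. h k + g k) \<le> ell2_norm h + ell2_norm g"
    by (rule ell2_of_bounded ell2_norm_le)+
qed

lemma
  assumes "h \<in> ell2"
  shows ell2_cmult: "(\<lambda>k. c * h k) \<in> ell2"
    and ell2_norm_cmult: "ell2_norm (\<lambda>k. c * h k) = cmod c * ell2_norm h"
  using assms by (auto simp: ell2_def ell2_norm_def norm_mult power_mult_distrib suminf_mult
      real_sqrt_mult intro: summable_mult)

lemma ell2_uminus: "h \<in> ell2 \<Longrightarrow> (\<lambda>k. - h k) \<in> ell2"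
  and ell2_norm_uminus: "ell2_norm (\<lambda>k. - h k) = ell2_norm h"
  by (auto simp: ell2_def ell2_norm_def)

lemma ell2_diff:
  assumes "h \<in> ell2" "g \<in> ell2" shows "(\<lambda>k. h k - g k) \<in> ell2"
  using ell2_add[OF assms(1) ell2_uminus[OF assms(2)]] by simp

lemma ell2_norm_minus_commute: "ell2_norm (\<lambda>k. h k - g k) = ell2_norm (\<lambda>k. g k - h k)"
  by (simp add: ell2_norm_def norm_minus_commute)

lemma ell2_norm_diff_triangle:
  assumes "a \<in> ell2" "b \<in> ell2" "c \<in> ell2"
  shows "ell2_norm (\<lambda>k. a k - c k) \<le> ell2_norm (\<lambda>k. a k - b k) + ell2_norm (\<lambda>k. b k - c k)"
  using ell2_norm_triangle[OF ell2_diff[OF assms(1,2)] ell2_diff[OF assms(2,3)]] by simp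

lemma ell2_norm_triangle_sub:
  assumes "a \<in> ell2" "b \<in> ell2"
  shows "\<bar>ell2_norm a - ell2_norm b\<bar> \<le> ell2_norm (\<lambda>k. a k - b k)"
  using ell2_norm_triangle[OF ell2_diff[OF assms] assms(2)]
    ell2_norm_triangle[OF ell2_diff[OF assms(2,1)] assms(1)]
  by (simp add: ell2_norm_minus_commute[of b a])

lemma ell2_zero: "(\<lambda>k. 0) \<in> ell2" and ell2_norm_zero: "ell2_norm (\<lambda>k. 0) = 0"
  by (auto simp: ell2_def ell2_norm_def)

lemma ell2_norm_eq_0D: "h \<in> ell2 \<Longrightarrow> ell2_norm h \<le> 0 \<Longrightarrow> h = (\<lambda>k. 0)"
  by (rule ext) (use cmod_le_ell2_norm[of h] order_trans in \<open>fastforce simp flip: norm_le_zero_iff\<close>)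

lemma finite_sequences_subset: "u \<in> finite_sequences \<Longrightarrow> u \<in> ell2"
  unfolding ell2_def finite_sequences_def by (auto intro!: summable_finite[where N = "{j. u j \<noteq> 0}"])

lemma
  assumes "h \<in> ell2" "g \<in> ell2"
  shows ell2_mult_summable: "summable (\<lambda>k. cmod (h k) * cmod (g k))"
    and ell2_mult_suminf_le: "(\<Sum>k. cmod (h k) * cmod (g k)) \<le> ell2_norm h * ell2_norm g"
proof -
  have bound: "(\<Sum>k<n. cmod (h k) * cmod (g k)) \<le> ell2_norm h * ell2_norm g" for n
  proof -
    have "(\<Sum>k<n. cmod (h k) * cmod (g k)) \<le> partial_norm h n * partial_norm g n"
      using L2_set_mult_ineq[of "\<lambda>k. cmod (h k)" "\<lambda>k. cmod (g k)" "{..<n}"] by simp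
    also have "\<dots> \<le> ell2_norm h * ell2_norm g"
      by (intro mult_mono partial_norm_le assms) (auto simp: assms)
    finally show ?thesis .
  qed
  show s: "summable (\<lambda>k. cmod (h k) * cmod (g k))"
    by (rule summableI_nonneg_bounded[OF _ bound]) simp
  show "(\<Sum>k. cmod (h k) * cmod (g k)) \<le> ell2_norm h * ell2_norm g"
    by (rule suminf_le_const[OF s bound])
qed

lemma
  assumes "h \<in> ell2" "g \<in> ell2"
  shows ell2_pairing_summable: "summable (\<lambda>k. h k * g k)"
    and ell2_pairing_le: "cmod (\<Sum>k. h k * g k) \<le> ell2_norm h * ell2_norm g"
proof -
  have s: "summable (\<lambda>k. cmod (h k * g k))" using ell2_mult_summable[OF assms] by (simp add: norm_mult)
  then show "summable (\<lambda>k. h k * g k)" by (rule summable_norm_cancel)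
  have "cmod (\<Sum>k. h k * g k) \<le> (\<Sum>k. cmod (h k * g k))" by (rule summable_norm[OF s])
  also have "\<dots> \<le> ell2_norm h * ell2_norm g" using ell2_mult_suminf_le[OF assms] by (simp add: norm_mult)
  finally show "cmod (\<Sum>k. h k * g k) \<le> ell2_norm h * ell2_norm g" .
qed

lemma ell2_cnj: "h \<in> ell2 \<Longrightarrow> (\<lambda>k. cnj (h k)) \<in> ell2" and ell2_norm_cnj: "ell2_norm (\<lambda>k. cnj (h k)) = ell2_norm h"
  by (auto simp: ell2_def ell2_norm_def)

lemma ell2_inner_summable: "h \<in> ell2 \<Longrightarrow> g \<in> ell2 \<Longrightarrow> summable (\<lambda>k. h k * cnj (g k))"
  by (intro ell2_pairing_summable ell2_cnj)

lemma ell2_inner_le: "h \<in> ell2 \<Longrightarrow> g \<in> ell2 \<Longrightarrow> cmod (ell2_inner h g) \<le> ell2_norm h * ell2_norm g"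
  unfolding ell2_inner_def using ell2_pairing_le[OF _ ell2_cnj] by (simp add: ell2_norm_cnj)

lemma ell2_norm_sq_diff_scaled:
  assumes a: "a \<in> ell2" and b: "b \<in> ell2"
  shows "(ell2_norm (\<lambda>k. a k - of_real t * b k))\<^sup>2 =
    (ell2_norm a)\<^sup>2 - 2 * t * Re (ell2_inner b a) + t\<^sup>2 * (ell2_norm b)\<^sup>2"
proof -
  have pt: "(cmod (a k - of_real t * b k))\<^sup>2 =
      (cmod (a k))\<^sup>2 - 2 * t * Re (b k * cnj (a k)) + t\<^sup>2 * (cmod (b k))\<^sup>2" for k
    unfolding cmod_power2 by (simp add: algebra_simps power2_eq_square)
  have sa: "summable (\<lambda>k. (cmod (a k))\<^sup>2)" and sb: "summable (\<lambda>k. (cmod (b k))\<^sup>2)"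
    using a b by (auto simp: ell2_def)
  have sba: "summable (\<lambda>k. b k * cnj (a k))" by (rule ell2_inner_summable[OF b a])
  have "(\<lambda>k. (cmod (a k))\<^sup>2 - 2 * t * Re (b k * cnj (a k)) + t\<^sup>2 * (cmod (b k))\<^sup>2) sums
      ((ell2_norm a)\<^sup>2 - 2 * t * Re (ell2_inner b a) + t\<^sup>2 * (ell2_norm b)\<^sup>2)"
    unfolding ell2_norm_sq[OF a] ell2_norm_sq[OF b] ell2_inner_def
    by (intro sums_add sums_diff sums_mult sums_Re summable_sums sa sb sba)
  then show ?thesis
    unfolding ell2_norm_sq[OF ell2_diff[OF a ell2_cmult[OF b]]] pt by (simp add: sums_iff)
qed

text \<open>Coordinates converge by completeness of the complex numbers; letting \<open>m\<close>
  tend to infinity on finite sections preserves the Cauchy bound and so makes the coordinatewise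
  limit a limit in norm.\<close>

lemma ell2_complete:
  assumes s: "\<And>n. s n \<in> ell2"
    and cauchy: "\<And>e. 0 < e \<Longrightarrow> \<exists>M. \<forall>m\<ge>M. \<forall>n\<ge>M. ell2_norm (\<lambda>k. s m k - s n k) \<le> e"
  obtains h where "h \<in> ell2" "(\<lambda>n. ell2_norm (\<lambda>k. s n k - h k)) \<longlonglongrightarrow> 0"
proof -
  have "Cauchy (\<lambda>n. s n k)" for k
  proof (rule metric_CauchyI)
    fix e :: real assume e: "0 < e"
    then obtain M where M: "\<And>m n. m \<ge> M \<Longrightarrow> n \<ge> M \<Longrightarrow> ell2_norm (\<lambda>k. s m k - s n k) \<le> e / 2"
      using cauchy[of "e / 2"] by auto
    have "dist (s m k) (s n k) < e" if "m \<ge> M" "n \<ge> M" for m n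
      using M[OF that] cmod_le_ell2_norm[OF ell2_diff[OF s[of m] s[of n]], of k] e by (simp add: dist_norm)
    then show "\<exists>M. \<forall>m\<ge>M. \<forall>n\<ge>M. dist (s m k) (s n k) < e" by blast
  qed
  then have "\<exists>l. (\<lambda>n. s n k) \<longlonglongrightarrow> l" for k
    by (simp add: Cauchy_convergent_iff convergent_def)
  then obtain h where h: "\<And>k. (\<lambda>n. s n k) \<longlonglongrightarrow> h k" by metis
  have tail: "(\<lambda>k. s n k - h k) \<in> ell2 \<and> ell2_norm (\<lambda>k. s n k - h k) \<le> e"
    if M: "\<And>m n. m \<ge> M \<Longrightarrow> n \<ge> M \<Longrightarrow> ell2_norm (\<lambda>k. s m k - s n k) \<le> e" and n: "n \<ge> M" for M n e
  proof -
    have pb: "partial_norm (\<lambda>k. s n k - h k) K \<le> e" for K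
    proof (rule LIMSEQ_le_const2)
      show "(\<lambda>m. partial_norm (\<lambda>k. s n k - s m k) K) \<longlonglongrightarrow> partial_norm (\<lambda>k. s n k - h k) K"
        unfolding L2_set_def by (intro tendsto_intros h)
      show "\<exists>N. \<forall>m\<ge>N. partial_norm (\<lambda>k. s n k - s m k) K \<le> e"
        using M[OF n] partial_norm_le[OF ell2_diff[OF s[of n] s], of _ K] order_trans by blast
    qed
    show ?thesis using ell2_of_bounded[OF pb] ell2_norm_le[OF pb] by simp
  qed
  have diff_ell2: "(\<lambda>k. s n k - h k) \<in> ell2" if "n \<ge> M"
    "\<forall>m\<ge>M. \<forall>n\<ge>M. ell2_norm (\<lambda>k. s m k - s n k) \<le> 1" for n M
    using tail[of M 1 n] that by auto
  obtain M1 where M1: "\<forall>m\<ge>M1. \<forall>n\<ge>M1. ell2_norm (\<lambda>k. s m k - s n k) \<le> 1"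
    using cauchy[of 1] by auto
  have "(\<lambda>k. s M1 k - (s M1 k - h k)) \<in> ell2" by (intro ell2_diff s diff_ell2[OF _ M1]) simp
  then have hl: "h \<in> ell2" by simp
  show thesis
  proof (rule that[OF hl], rule LIMSEQ_I)
    fix e :: real assume e: "0 < e"
    then obtain M where M: "\<And>m n. m \<ge> M \<Longrightarrow> n \<ge> M \<Longrightarrow> ell2_norm (\<lambda>k. s m k - s n k) \<le> e / 2"
      using cauchy[of "e / 2"] by auto
    have "norm (ell2_norm (\<lambda>k. s n k - h k) - 0) < e" if "n \<ge> M" for n
      using tail[OF M that] e by auto
    then show "\<exists>no. \<forall>n\<ge>no. norm (ell2_norm (\<lambda>k. s n k - h k) - 0) < e" by blast
  qed
qed

lemma ell2_lim_unique:
  assumes "\<And>n. s n \<in> ell2" "g \<in> ell2" "h \<in> ell2"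
    "(\<lambda>n. ell2_norm (\<lambda>k. s n k - g k)) \<longlonglongrightarrow> 0" "(\<lambda>n. ell2_norm (\<lambda>k. s n k - h k)) \<longlonglongrightarrow> 0"
  shows "g = h"
proof -
  have "ell2_norm (\<lambda>k. g k - h k) \<le> 0 + 0"
  proof (rule LIMSEQ_le_const[OF tendsto_add[OF assms(4,5)]], intro exI allI impI)
    fix n
    show "ell2_norm (\<lambda>k. g k - h k) \<le> ell2_norm (\<lambda>k. s n k - g k) + ell2_norm (\<lambda>k. s n k - h k)"
      using ell2_norm_diff_triangle[OF assms(2) assms(1)[of n] assms(3)]
      by (simp add: ell2_norm_minus_commute[of g])
  qed
  from ell2_norm_eq_0D[OF ell2_diff[OF assms(2,3)]] this have "(\<lambda>k. g k - h k) = (\<lambda>k. 0)" by simp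
  then show ?thesis by (auto simp: fun_eq_iff)
qed

lemma ell2_norm_tendsto:
  assumes "\<And>n. s n \<in> ell2" "h \<in> ell2" "(\<lambda>n. ell2_norm (\<lambda>k. s n k - h k)) \<longlonglongrightarrow> 0"
  shows "(\<lambda>n. ell2_norm (s n)) \<longlonglongrightarrow> ell2_norm h"
proof -
  have "(\<lambda>n. ell2_norm (s n) - ell2_norm h) \<longlonglongrightarrow> 0"
    by (rule Lim_null_comparison[OF _ assms(3)])
       (use ell2_norm_triangle_sub[OF assms(1,2)] in auto)
  then show ?thesis by (simp add: LIM_zero_iff)
qed

lemma ell2_inner_tendsto:
  assumes a: "\<And>n. a n \<in> ell2" and g: "g \<in> ell2" and ag: "(\<lambda>n. ell2_norm (\<lambda>k. a n k - g k)) \<longlonglongrightarrow> 0"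
    and b: "\<And>n. b n \<in> ell2" and h: "h \<in> ell2" and bh: "(\<lambda>n. ell2_norm (\<lambda>k. b n k - h k)) \<longlonglongrightarrow> 0"
  shows "(\<lambda>n. ell2_inner (a n) (b n)) \<longlonglongrightarrow> ell2_inner g h"
proof -
  have "cmod (ell2_inner (a n) (b n) - ell2_inner g h) \<le>
      ell2_norm (\<lambda>k. a n k - g k) * ell2_norm (b n) + ell2_norm g * ell2_norm (\<lambda>k. b n k - h k)" for n
  proof -
    have "(\<lambda>k. a n k * cnj (b n k) - g k * cnj (h k)) =
        (\<lambda>k. (a n k - g k) * cnj (b n k) + g k * cnj (b n k - h k))"
      by (simp add: algebra_simps)
    moreover have "(\<lambda>k. a n k * cnj (b n k) - g k * cnj (h k)) sums (ell2_inner (a n) (b n) - ell2_inner g h)"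
      unfolding ell2_inner_def by (intro sums_diff summable_sums ell2_inner_summable a b g h)
    moreover have "(\<lambda>k. (a n k - g k) * cnj (b n k) + g k * cnj (b n k - h k)) sums
        (ell2_inner (\<lambda>k. a n k - g k) (b n) + ell2_inner g (\<lambda>k. b n k - h k))"
      unfolding ell2_inner_def by (intro sums_add summable_sums ell2_inner_summable ell2_diff a b g h)
    ultimately have "ell2_inner (a n) (b n) - ell2_inner g h =
        ell2_inner (\<lambda>k. a n k - g k) (b n) + ell2_inner g (\<lambda>k. b n k - h k)"
      by (metis sums_unique2)
    also have "cmod \<dots> \<le> cmod (ell2_inner (\<lambda>k. a n k - g k) (b n)) + cmod (ell2_inner g (\<lambda>k. b n k - h k))"
      by (rule norm_triangle_ineq)
    also have "\<dots> \<le> ell2_norm (\<lambda>k. a n k - g k) * ell2_norm (b n) + ell2_norm g * ell2_norm (\<lambda>k. b n k - h k)"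
      by (intro add_mono ell2_inner_le ell2_diff a b g h)
    finally show ?thesis .
  qed
  then have bound: "\<forall>n. norm (ell2_inner (a n) (b n) - ell2_inner g h) \<le>
      ell2_norm (\<lambda>k. a n k - g k) * ell2_norm (b n) + ell2_norm g * ell2_norm (\<lambda>k. b n k - h k)" by blast
  have "(\<lambda>n. ell2_norm (\<lambda>k. a n k - g k) * ell2_norm (b n) + ell2_norm g * ell2_norm (\<lambda>k. b n k - h k))
      \<longlonglongrightarrow> 0 * ell2_norm h + ell2_norm g * 0"
    by (intro tendsto_intros ag bh ell2_norm_tendsto[OF b h])
  then have "(\<lambda>n. ell2_inner (a n) (b n) - ell2_inner g h) \<longlonglongrightarrow> 0"
    using Lim_null_comparison[OF always_eventually[OF bound]] by simp
  then show ?thesis by (simp add: LIM_zero_iff)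
qed

lemma truncation_tendsto:
  assumes h: "h \<in> ell2"
  defines "u \<equiv> \<lambda>n k. if k < n then h k else 0"
  shows "u n \<in> finite_sequences" "(\<lambda>n. ell2_norm (\<lambda>k. u n k - h k)) \<longlonglongrightarrow> 0"
proof -
  show "u n \<in> finite_sequences"
    by (auto simp: finite_sequences_def u_def intro: finite_subset[of _ "{..<n}"])
  have s: "summable (\<lambda>k. (cmod (h k))\<^sup>2)" using h by (simp add: ell2_def)
  have "ell2_norm (\<lambda>k. u n k - h k) = sqrt (\<Sum>k. (cmod (h (k + n)))\<^sup>2)" for n
  proof -
    have "(\<lambda>k. (cmod (u n (k + n) - h (k + n)))\<^sup>2) sums (\<Sum>k. (cmod (h (k + n)))\<^sup>2)"
      using summable_sums[OF summable_ignore_initial_segment[OF s, of n]] by (simp add: u_def)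
    then have "(\<lambda>k. (cmod (u n k - h k))\<^sup>2) sums (\<Sum>k. (cmod (h (k + n)))\<^sup>2)"
      by (subst (asm) sums_iff_shift) (simp add: u_def)
    then show ?thesis by (simp add: ell2_norm_def sums_iff)
  qed
  moreover have "(\<lambda>n. sqrt (\<Sum>k. (cmod (h (k + n)))\<^sup>2)) \<longlonglongrightarrow> sqrt 0"
    by (intro tendsto_real_sqrt suminf_exist_split2 s)
  ultimately show "(\<lambda>n. ell2_norm (\<lambda>k. u n k - h k)) \<longlonglongrightarrow> 0" by simp
qed

subsection \<open>Minimal operators\<close>

lemma matrix_apply_eq:
  assumes "finite J" "{j. u j \<noteq> 0} \<subseteq> J"
  shows "matrix_apply A u k = (\<Sum>j\<in>J. A k j * u j)"
  unfolding matrix_apply_def using assms by (intro sum.mono_neutral_left) auto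

lemma ell2_sum:
  assumes "\<And>j. j \<in> J \<Longrightarrow> v j \<in> ell2" shows "(\<lambda>k. \<Sum>j\<in>J. v j k) \<in> ell2"
  using assms by (induction J rule: infinite_finite_induct) (auto intro: ell2_add ell2_zero)

lemma matrix_apply_ell2:
  assumes "generates_operator A" "u \<in> finite_sequences"
  shows "matrix_apply A u \<in> ell2"
proof -
  have "(\<lambda>k. \<Sum>j | u j \<noteq> 0. u j * A k j) \<in> ell2"
    using assms(1) by (intro ell2_sum ell2_cmult) (simp add: generates_operator_def)
  then show ?thesis unfolding matrix_apply_def[abs_def] by (simp add: mult.commute)
qed

lemma matrix_apply_suminf:
  assumes "u \<in> finite_sequences"
  shows "matrix_apply A u k = (\<Sum>j. A k j * u j)"
  unfolding matrix_apply_def using assms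
  by (intro suminf_finite[symmetric]) (auto simp: finite_sequences_def)

lemma finite_sequences_lincomb:
  assumes "u \<in> finite_sequences" "v \<in> finite_sequences"
  shows "(\<lambda>k. c * u k + v k) \<in> finite_sequences"
  using assms unfolding finite_sequences_def
  by (auto intro: finite_subset[of _ "{j. u j \<noteq> 0} \<union> {j. v j \<noteq> 0}"])

lemma matrix_apply_lincomb:
  assumes "u \<in> finite_sequences" "v \<in> finite_sequences"
  shows "matrix_apply A (\<lambda>k. c * u k + v k) k = c * matrix_apply A u k + matrix_apply A v k"
proof -
  let ?J = "{j. u j \<noteq> 0} \<union> {j. v j \<noteq> 0}"
  have "finite ?J" using assms by (auto simp: finite_sequences_def)
  then have "matrix_apply A (\<lambda>k. c * u k + v k) k = (\<Sum>j\<in>?J. A k j * (c * u j + v j))"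
    "matrix_apply A u k = (\<Sum>j\<in>?J. A k j * u j)" "matrix_apply A v k = (\<Sum>j\<in>?J. A k j * v j)"
    by (intro matrix_apply_eq; auto)+
  then show ?thesis by (simp add: sum_distrib_left algebra_simps flip: sum.distrib)
qed

lemma minimal_operatorD:
  assumes "(h, g) \<in> minimal_operator A"
  obtains u where "h \<in> ell2" "g \<in> ell2" "\<And>n. u n \<in> finite_sequences"
    "(\<lambda>n. ell2_norm (\<lambda>k. u n k - h k)) \<longlonglongrightarrow> 0"
    "(\<lambda>n. ell2_norm (\<lambda>k. matrix_apply A (u n) k - g k)) \<longlonglongrightarrow> 0"
  using assms unfolding minimal_operator_def by blast

lemma minimal_operatorI:
  assumes "h \<in> ell2" "g \<in> ell2" "\<And>n. u n \<in> finite_sequences"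
    "(\<lambda>n. ell2_norm (\<lambda>k. u n k - h k)) \<longlonglongrightarrow> 0"
    "(\<lambda>n. ell2_norm (\<lambda>k. matrix_apply A (u n) k - g k)) \<longlonglongrightarrow> 0"
  shows "(h, g) \<in> minimal_operator A"
  using assms unfolding minimal_operator_def by blast

lemma minimal_operator_finite:
  assumes "generates_operator A" "u \<in> finite_sequences"
  shows "(u, matrix_apply A u) \<in> minimal_operator A"
  by (rule minimal_operatorI[where u = "\<lambda>_. u"])
     (use assms in \<open>auto simp: ell2_norm_zero finite_sequences_subset matrix_apply_ell2\<close>)

lemma minimal_operator_lincomb:
  assumes gen: "generates_operator A"
    and T: "(h1, g1) \<in> minimal_operator A" "(h2, g2) \<in> minimal_operator A"
  shows "((\<lambda>k. c * h1 k + h2 k), (\<lambda>k. c * g1 k + g2 k)) \<in> minimal_operator A"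
proof -
  obtain u where u: "h1 \<in> ell2" "g1 \<in> ell2" "\<And>n. u n \<in> finite_sequences"
    "(\<lambda>n. ell2_norm (\<lambda>k. u n k - h1 k)) \<longlonglongrightarrow> 0"
    "(\<lambda>n. ell2_norm (\<lambda>k. matrix_apply A (u n) k - g1 k)) \<longlonglongrightarrow> 0"
    using minimal_operatorD[OF T(1)] by blast
  obtain v where v: "h2 \<in> ell2" "g2 \<in> ell2" "\<And>n. v n \<in> finite_sequences"
    "(\<lambda>n. ell2_norm (\<lambda>k. v n k - h2 k)) \<longlonglongrightarrow> 0"
    "(\<lambda>n. ell2_norm (\<lambda>k. matrix_apply A (v n) k - g2 k)) \<longlonglongrightarrow> 0"
    using minimal_operatorD[OF T(2)] by blast
  have lim: "(\<lambda>n. ell2_norm (\<lambda>k. (c * a n k + b n k) - (c * p k + q k))) \<longlonglongrightarrow> 0"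
    if "\<And>n. a n \<in> ell2" "\<And>n. b n \<in> ell2" "p \<in> ell2" "q \<in> ell2"
      "(\<lambda>n. ell2_norm (\<lambda>k. a n k - p k)) \<longlonglongrightarrow> 0" "(\<lambda>n. ell2_norm (\<lambda>k. b n k - q k)) \<longlonglongrightarrow> 0"
    for a b :: "nat \<Rightarrow> nat \<Rightarrow> complex" and p q
  proof -
    have eq: "(\<lambda>k. (c * a n k + b n k) - (c * p k + q k)) = (\<lambda>k. c * (a n k - p k) + (b n k - q k))" for n
      by (auto simp: algebra_simps)
    have mem: "(\<lambda>k. c * (a n k - p k)) \<in> ell2" "(\<lambda>k. b n k - q k) \<in> ell2" for n
      by (intro ell2_cmult ell2_diff that)+
    have bound: "\<forall>n. norm (ell2_norm (\<lambda>k. (c * a n k + b n k) - (c * p k + q k))) \<le>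
        cmod c * ell2_norm (\<lambda>k. a n k - p k) + ell2_norm (\<lambda>k. b n k - q k)"
    proof
      fix n
      show "norm (ell2_norm (\<lambda>k. (c * a n k + b n k) - (c * p k + q k))) \<le>
          cmod c * ell2_norm (\<lambda>k. a n k - p k) + ell2_norm (\<lambda>k. b n k - q k)"
        unfolding eq using ell2_norm_triangle[OF mem[of n]] ell2_norm_nonneg[OF ell2_add[OF mem[of n]]]
        by (simp add: ell2_norm_cmult[OF ell2_diff[OF that(1,3)]])
    qed
    have "(\<lambda>n. cmod c * ell2_norm (\<lambda>k. a n k - p k) + ell2_norm (\<lambda>k. b n k - q k)) \<longlonglongrightarrow> cmod c * 0 + 0"
      by (intro tendsto_intros that)
    then show ?thesis using Lim_null_comparison[OF always_eventually[OF bound]] by simp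
  qed
  show ?thesis
  proof (rule minimal_operatorI[where u = "\<lambda>n k. c * u n k + v n k"])
    show "(\<lambda>n. ell2_norm (\<lambda>k. (c * u n k + v n k) - (c * h1 k + h2 k))) \<longlonglongrightarrow> 0"
      by (intro lim finite_sequences_subset u v)
    show "(\<lambda>n. ell2_norm (\<lambda>k. matrix_apply A (\<lambda>k. c * u n k + v n k) k - (c * g1 k + g2 k))) \<longlonglongrightarrow> 0"
      unfolding matrix_apply_lincomb[OF u(3) v(3)] by (intro lim matrix_apply_ell2 gen u v)
  qed (intro ell2_add ell2_cmult u v finite_sequences_lincomb)+
qed

text \<open>A square-summable row defines a continuous functional, so coordinate \<open>k\<close> of
  the image is the same along every approximating sequence. With all rows in \<open>ell2\<close>
  this makes the closure of the graph single valued.\<close>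

lemma minimal_operator_suminf:
  assumes gen: "generates_operator A" and rows: "(\<lambda>j. A k j) \<in> ell2"
    and T: "(h, g) \<in> minimal_operator A"
  shows "g k = (\<Sum>j. A k j * h j)"
proof -
  obtain u where u: "h \<in> ell2" "g \<in> ell2" "\<And>n. u n \<in> finite_sequences"
    "(\<lambda>n. ell2_norm (\<lambda>k. u n k - h k)) \<longlonglongrightarrow> 0"
    "(\<lambda>n. ell2_norm (\<lambda>k. matrix_apply A (u n) k - g k)) \<longlonglongrightarrow> 0"
    using minimal_operatorD[OF T] by blast
  have uell: "u n \<in> ell2" for n by (rule finite_sequences_subset[OF u(3)])
  have "(\<lambda>n. matrix_apply A (u n) k - g k) \<longlonglongrightarrow> 0"
    by (rule Lim_null_comparison[OF always_eventually u(5)])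
       (use cmod_le_ell2_norm[OF ell2_diff[OF matrix_apply_ell2[OF gen u(3)] u(2)]] in blast)
  then have 1: "(\<lambda>n. matrix_apply A (u n) k) \<longlonglongrightarrow> g k" by (simp add: LIM_zero_iff)
  have bound: "\<forall>n. norm (matrix_apply A (u n) k - (\<Sum>j. A k j * h j)) \<le>
      ell2_norm (\<lambda>j. A k j) * ell2_norm (\<lambda>j. u n j - h j)"
  proof
    fix n
    have "matrix_apply A (u n) k - (\<Sum>j. A k j * h j) = (\<Sum>j. A k j * (u n j - h j))"
      unfolding matrix_apply_suminf[OF u(3)]
      by (subst suminf_diff[OF ell2_pairing_summable[OF rows uell] ell2_pairing_summable[OF rows u(1)]])
         (simp add: right_diff_distrib)
    then show "norm (matrix_apply A (u n) k - (\<Sum>j. A k j * h j)) \<le>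
        ell2_norm (\<lambda>j. A k j) * ell2_norm (\<lambda>j. u n j - h j)"
      using ell2_pairing_le[OF rows ell2_diff[OF uell u(1)]] by simp
  qed
  have "(\<lambda>n. ell2_norm (\<lambda>j. A k j) * ell2_norm (\<lambda>j. u n j - h j)) \<longlonglongrightarrow> ell2_norm (\<lambda>j. A k j) * 0"
    by (intro tendsto_intros u)
  then have "(\<lambda>n. matrix_apply A (u n) k - (\<Sum>j. A k j * h j)) \<longlonglongrightarrow> 0"
    using Lim_null_comparison[OF always_eventually[OF bound]] by simp
  then have "(\<lambda>n. matrix_apply A (u n) k) \<longlonglongrightarrow> (\<Sum>j. A k j * h j)" by (simp add: LIM_zero_iff)
  with 1 show ?thesis by (rule LIMSEQ_unique)
qed

lemma minimal_operator_single_valued: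
  assumes "generates_operator A" "\<And>k. (\<lambda>j. A k j) \<in> ell2"
  shows "single_valued (minimal_operator A)"
  unfolding single_valued_def
  using minimal_operator_suminf[OF assms(1) assms(2)] by (metis ext)

lemma minimal_operator_positive:
  assumes gen: "generates_operator A" and T: "(h, g) \<in> minimal_operator A"
    and pos: "\<And>u. u \<in> finite_sequences \<Longrightarrow>
      complex_of_real (\<epsilon> * (ell2_norm u)\<^sup>2) \<le> ell2_inner (matrix_apply A u) u"
  shows "complex_of_real (\<epsilon> * (ell2_norm h)\<^sup>2) \<le> ell2_inner g h"
proof -
  obtain u where u: "h \<in> ell2" "g \<in> ell2" "\<And>n. u n \<in> finite_sequences"
    "(\<lambda>n. ell2_norm (\<lambda>k. u n k - h k)) \<longlonglongrightarrow> 0"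
    "(\<lambda>n. ell2_norm (\<lambda>k. matrix_apply A (u n) k - g k)) \<longlonglongrightarrow> 0"
    using minimal_operatorD[OF T] by blast
  have uell: "u n \<in> ell2" for n by (rule finite_sequences_subset[OF u(3)])
  have inner: "(\<lambda>n. ell2_inner (matrix_apply A (u n)) (u n)) \<longlonglongrightarrow> ell2_inner g h"
    by (intro ell2_inner_tendsto matrix_apply_ell2 gen u uell)
  have re: "\<epsilon> * (ell2_norm (u n))\<^sup>2 \<le> Re (ell2_inner (matrix_apply A (u n)) (u n))"
    and im: "Im (ell2_inner (matrix_apply A (u n)) (u n)) = 0" for n
    using pos[OF u(3)[of n]] by (auto simp: less_eq_complex_def)
  have "\<epsilon> * (ell2_norm h)\<^sup>2 \<le> Re (ell2_inner g h)"
  proof (rule LIMSEQ_le)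
    show "(\<lambda>n. \<epsilon> * (ell2_norm (u n))\<^sup>2) \<longlonglongrightarrow> \<epsilon> * (ell2_norm h)\<^sup>2"
      by (intro tendsto_intros ell2_norm_tendsto uell u)
    show "(\<lambda>n. Re (ell2_inner (matrix_apply A (u n)) (u n))) \<longlonglongrightarrow> Re (ell2_inner g h)"
      by (intro tendsto_intros inner)
  qed (use re in blast)
  moreover have "Im (ell2_inner g h) = 0"
    using tendsto_Im[OF inner] by (simp add: im LIMSEQ_const_iff)
  ultimately show ?thesis by (simp add: less_eq_complex_def)
qed

text \<open>Surjectivity is obtained from the Neumann series of \<open>1 - \<tau> T\<close>, a strict contraction for
  \<open>\<tau> = \<epsilon> / C\<^sup>2\<close>.\<close>

lemma positive_bounded_surj:
  assumes gen: "generates_operator A" and bdd: "bounded_operator (minimal_operator A)"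
    and \<epsilon>: "0 < \<epsilon>"
    and pos: "\<And>h g. (h, g) \<in> minimal_operator A \<Longrightarrow>
      complex_of_real (\<epsilon> * (ell2_norm h)\<^sup>2) \<le> ell2_inner g h"
  shows "Range (minimal_operator A) = ell2"
proof -
  let ?T = "minimal_operator A"
  have dom: "Domain ?T = ell2" using bdd by (simp add: bounded_operator_def)
  obtain C0 where C0: "\<And>h g. (h, g) \<in> ?T \<Longrightarrow> ell2_norm g \<le> C0 * ell2_norm h"
    using bdd by (fastforce simp: bounded_operator_def)
  \<comment> \<open>Enlarging the bound to at least \<open>2 * \<epsilon>\<close> makes it positive
    and larger than \<open>\<epsilon>\<close>, so the square root defining \<open>q\<close> is taken
    of a positive number.\<close>
  define C where "C = max C0 (2 * \<epsilon>)"
  have C: "0 < C" "\<epsilon> < C" using \<epsilon> by (auto simp: C_def)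
  have T_ell2: "h \<in> ell2" "g \<in> ell2" if "(h, g) \<in> ?T" for h g
    using that by (auto simp: minimal_operator_def)
  have bound: "ell2_norm g \<le> C * ell2_norm h" if "(h, g) \<in> ?T" for h g
  proof -
    have "ell2_norm g \<le> C0 * ell2_norm h" by (rule C0[OF that])
    also have "\<dots> \<le> C * ell2_norm h"
      using T_ell2[OF that] by (intro mult_right_mono) (auto simp: C_def)
    finally show ?thesis .
  qed
  have "\<forall>h\<in>ell2. \<exists>g. (h, g) \<in> ?T" using dom by blast
  then obtain F where F: "\<And>h. h \<in> ell2 \<Longrightarrow> (h, F h) \<in> ?T" by metis
  have F_ell2: "F h \<in> ell2" if "h \<in> ell2" for h using T_ell2 F that by blast
  \<comment> \<open>Minimizes \<open>1 - 2 * \<tau> * \<epsilon> + \<tau>^2 * C^2\<close>, with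
    minimum \<open>1 - \<epsilon>^2 / C^2\<close>.\<close>
  define \<tau> where "\<tau> = \<epsilon> / C\<^sup>2"
  have \<tau>: "0 < \<tau>" using \<epsilon> C by (simp add: \<tau>_def)
  define q where "q = sqrt (1 - \<epsilon>\<^sup>2 / C\<^sup>2)"
  have "\<epsilon>\<^sup>2 \<le> C\<^sup>2" using \<epsilon> C by (intro power_mono) auto
  then have q2: "q\<^sup>2 = 1 - \<epsilon>\<^sup>2 / C\<^sup>2" using C by (simp add: q_def)
  have q: "0 \<le> q" "q < 1" using \<epsilon> C \<open>\<epsilon>\<^sup>2 \<le> C\<^sup>2\<close> by (auto simp: q_def)
  define S where "S = (\<lambda>h k. h k - of_real \<tau> * F h k)"
  have S_ell2: "S h \<in> ell2" if "h \<in> ell2" for h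
    unfolding S_def by (intro ell2_diff ell2_cmult F_ell2 that)
  have contr: "ell2_norm (S h) \<le> q * ell2_norm h" if h: "h \<in> ell2" for h
  proof -
    have "(ell2_norm (S h))\<^sup>2 =
        (ell2_norm h)\<^sup>2 - 2 * \<tau> * Re (ell2_inner (F h) h) + \<tau>\<^sup>2 * (ell2_norm (F h))\<^sup>2"
      unfolding S_def by (rule ell2_norm_sq_diff_scaled[OF h F_ell2[OF h]])
    also have "\<dots> \<le> (ell2_norm h)\<^sup>2 - 2 * \<tau> * (\<epsilon> * (ell2_norm h)\<^sup>2) + \<tau>\<^sup>2 * (C * ell2_norm h)\<^sup>2"
      using pos[OF F[OF h]] bound[OF F[OF h]] \<tau> h F_ell2[OF h]
      by (intro add_mono diff_mono mult_left_mono power_mono) (auto simp: less_eq_complex_def)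
    also have "\<dots> = (1 - 2 * \<tau> * \<epsilon> + \<tau>\<^sup>2 * C\<^sup>2) * (ell2_norm h)\<^sup>2"
      by (simp add: algebra_simps power_mult_distrib)
    also have "1 - 2 * \<tau> * \<epsilon> + \<tau>\<^sup>2 * C\<^sup>2 = q\<^sup>2"
      unfolding q2 \<tau>_def using C by (simp add: field_simps power2_eq_square)
    finally have "(ell2_norm (S h))\<^sup>2 \<le> (q * ell2_norm h)\<^sup>2" by (simp add: power_mult_distrib)
    then show ?thesis by (rule power2_le_imp_le) (use q h in simp)
  qed
  have "w \<in> Range ?T" if w: "w \<in> ell2" for w
  proof -
    \<comment> \<open>The residuals of the iteration: the operator maps the partial sum
      \<open>s N\<close> below to \<open>w - v N\<close>. By boundedness \<open>F h = w\<close>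
      follows once \<open>v N\<close> tends to 0 and \<open>s N\<close> converges to
      \<open>h\<close>.\<close>
    define v where "v = (\<lambda>n. (S ^^ n) w)"
    have v_ell2: "v n \<in> ell2" for n
      unfolding v_def by (induction n) (auto intro: w S_ell2)
    have v_norm: "ell2_norm (v n) \<le> q ^ n * ell2_norm w" for n
    proof (induction n)
      case (Suc n)
      have "ell2_norm (v (Suc n)) \<le> q * ell2_norm (v n)" using contr[OF v_ell2[of n]] by (simp add: v_def)
      also have "\<dots> \<le> q * (q ^ n * ell2_norm w)" using q by (intro mult_left_mono Suc)
      finally show ?case by simp
    qed (simp add: v_def)
    define s where "s = (\<lambda>N k. \<Sum>n<N. of_real \<tau> * v n k)"
    have sT: "(s N, (\<lambda>k. w k - v N k)) \<in> ?T" for N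
    proof (induction N)
      case 0
      have "((\<lambda>k. 0), matrix_apply A (\<lambda>k. 0)) \<in> ?T"
        by (intro minimal_operator_finite gen) (simp add: finite_sequences_def)
      then show ?case by (simp add: s_def v_def matrix_apply_def[abs_def])
    next
      case (Suc N)
      have "((\<lambda>k. of_real \<tau> * v N k + s N k), (\<lambda>k. of_real \<tau> * F (v N) k + (w k - v N k))) \<in> ?T"
        by (intro minimal_operator_lincomb gen F v_ell2 Suc)
      then show ?case by (simp add: s_def v_def S_def algebra_simps)
    qed
    have s_ell2: "s N \<in> ell2" for N using T_ell2[OF sT] by blast
    define K where "K = \<tau> * ell2_norm w / (1 - q)"
    have step: "ell2_norm (\<lambda>k. s (N + m) k - s N k) \<le> q ^ N * K" for N m
    proof -
      have "ell2_norm (\<lambda>k. s (N + m) k - s N k) \<le> (\<Sum>n<m. \<tau> * (q ^ (N + n) * ell2_norm w))"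
      proof (induction m)
        case (Suc m)
        have eq: "(\<lambda>k. s (N + Suc m) k - s N k) = (\<lambda>k. (s (N + m) k - s N k) + of_real \<tau> * v (N + m) k)"
          by (simp add: s_def algebra_simps)
        have "ell2_norm (\<lambda>k. s (N + Suc m) k - s N k) \<le>
            ell2_norm (\<lambda>k. s (N + m) k - s N k) + ell2_norm (\<lambda>k. of_real \<tau> * v (N + m) k)"
          unfolding eq by (intro ell2_norm_triangle ell2_diff ell2_cmult s_ell2 v_ell2)
        also have "ell2_norm (\<lambda>k. of_real \<tau> * v (N + m) k) = \<tau> * ell2_norm (v (N + m))"
          using \<tau> by (simp add: ell2_norm_cmult[OF v_ell2])
        also have "\<tau> * ell2_norm (v (N + m)) \<le> \<tau> * (q ^ (N + m) * ell2_norm w)"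
          using \<tau> by (intro mult_left_mono v_norm) auto
        finally show ?case using Suc by simp
      qed (simp add: ell2_norm_zero)
      also have "\<dots> = q ^ N * (\<tau> * ell2_norm w * (\<Sum>n<m. q ^ n))"
        by (simp add: power_add sum_distrib_left mult_ac)
      also have "(\<Sum>n<m. q ^ n) = (1 - q ^ m) / (1 - q)"
        using q by (subst sum_gp_strict) auto
      also have "\<tau> * ell2_norm w * ((1 - q ^ m) / (1 - q)) \<le> K"
        unfolding K_def using q \<tau> w
        by (simp add: divide_right_mono mult_left_le)
      then have "q ^ N * (\<tau> * ell2_norm w * ((1 - q ^ m) / (1 - q))) \<le> q ^ N * K"
        using q by (intro mult_left_mono) auto
      finally show ?thesis .
    qed
    have qK: "(\<lambda>N. q ^ N * K) \<longlonglongrightarrow> 0"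
      using tendsto_mult[OF LIMSEQ_realpow_zero[OF q] tendsto_const[of K]] by simp
    have "\<exists>M. \<forall>m\<ge>M. \<forall>n\<ge>M. ell2_norm (\<lambda>k. s m k - s n k) \<le> e" if e: "0 < e" for e
    proof -
      obtain M where M: "\<And>N. N \<ge> M \<Longrightarrow> q ^ N * K < e"
        using order_tendstoD(2)[OF qK e] by (auto simp: eventually_sequentially)
      have le: "ell2_norm (\<lambda>k. s m k - s n k) \<le> e" if "n \<ge> M" "n \<le> m" for m n
        using step[of n "m - n"] M[OF that(1)] that(2) by simp
      have "ell2_norm (\<lambda>k. s m k - s n k) \<le> e" if "m \<ge> M" "n \<ge> M" for m n
        using le[of n m] le[of m n] that ell2_norm_minus_commute[of "s m" "s n"] by (cases "n \<le> m") auto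
      then show ?thesis by blast
    qed
    then obtain h where h: "h \<in> ell2" "(\<lambda>n. ell2_norm (\<lambda>k. s n k - h k)) \<longlonglongrightarrow> 0"
      using ell2_complete[of s, OF s_ell2] by blast
    have "(\<lambda>n. ell2_norm (\<lambda>k. (w k - v n k) - F h k)) \<longlonglongrightarrow> 0"
    proof -
      have bd: "\<forall>n. norm (ell2_norm (\<lambda>k. (w k - v n k) - F h k)) \<le> C * ell2_norm (\<lambda>k. s n k - h k)"
      proof
        fix n
        have mem: "((\<lambda>k. -1 * h k + s n k), (\<lambda>k. -1 * F h k + (w k - v n k))) \<in> ?T"
          by (intro minimal_operator_lincomb gen F h sT)
        from bound[OF mem] show "norm (ell2_norm (\<lambda>k. (w k - v n k) - F h k)) \<le> C * ell2_norm (\<lambda>k. s n k - h k)"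
          using ell2_norm_nonneg[OF T_ell2(2)[OF mem]] by (simp add: algebra_simps)
      qed
      have "(\<lambda>n. C * ell2_norm (\<lambda>k. s n k - h k)) \<longlonglongrightarrow> C * 0" by (intro tendsto_intros h)
      then show ?thesis using Lim_null_comparison[OF always_eventually[OF bd]] by simp
    qed
    moreover have "(\<lambda>n. ell2_norm (\<lambda>k. (w k - v n k) - w k)) \<longlonglongrightarrow> 0"
    proof -
      have bd: "\<forall>n. norm (ell2_norm (\<lambda>k. (w k - v n k) - w k)) \<le> q ^ n * ell2_norm w"
        using v_norm v_ell2 by (simp add: ell2_norm_uminus)
      have "(\<lambda>n. q ^ n * ell2_norm w) \<longlonglongrightarrow> 0 * ell2_norm w" by (intro tendsto_intros LIMSEQ_realpow_zero q)
      then show ?thesis using Lim_null_comparison[OF always_eventually[OF bd]] by simp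
    qed
    ultimately have "F h = w"
      by (intro ell2_lim_unique[of "\<lambda>n k. w k - v n k"] ell2_diff w v_ell2 F_ell2 h)
    with F[OF h(1)] show ?thesis by auto
  qed
  then show ?thesis using T_ell2 by auto
qed

text \<open>Cauchy-Schwarz turns the form bound into
  \<open>\<epsilon> * ell2_norm h \<le> ell2_norm g\<close>, which gives injectivity and a bounded
  inverse; in the bounded case \<open>positive_bounded_surj\<close> adds that the range is
  everything.\<close>

lemma positive_definite_invertible:
  assumes gen: "generates_operator A" and rows: "\<And>k. (\<lambda>j. A k j) \<in> ell2" and \<epsilon>: "0 < \<epsilon>"
    and pos: "\<And>u. u \<in> finite_sequences \<Longrightarrow>
      complex_of_real (\<epsilon> * (ell2_norm u)\<^sup>2) \<le> ell2_inner (matrix_apply A u) u"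
  shows "positive_definite_operator (minimal_operator A)" "invertible_operator (minimal_operator A)"
proof -
  let ?T = "minimal_operator A"
  have T_ell2: "h \<in> ell2" "g \<in> ell2" if "(h, g) \<in> ?T" for h g
    using that by (auto simp: minimal_operator_def)
  have posT: "complex_of_real (\<epsilon> * (ell2_norm h)\<^sup>2) \<le> ell2_inner g h" if "(h, g) \<in> ?T" for h g
    by (rule minimal_operator_positive[OF gen that pos])
  have sv: "single_valued ?T" by (rule minimal_operator_single_valued[OF gen rows])
  show "positive_definite_operator ?T"
    unfolding positive_definite_operator_def using sv \<epsilon> posT by auto
  have below: "ell2_norm h \<le> 1 / \<epsilon> * ell2_norm g" if "(h, g) \<in> ?T" for h g
  proof (cases "ell2_norm h = 0")
    case False
    have h: "0 < ell2_norm h" using False ell2_norm_nonneg[OF T_ell2(1)[OF that]] by simp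
    have "\<epsilon> * (ell2_norm h)\<^sup>2 \<le> Re (ell2_inner g h)" using posT[OF that] by (simp add: less_eq_complex_def)
    also have "\<dots> \<le> ell2_norm g * ell2_norm h"
      using complex_Re_le_cmod ell2_inner_le[OF T_ell2(2)[OF that] T_ell2(1)[OF that]] by (rule order_trans)
    finally have "\<epsilon> * ell2_norm h \<le> ell2_norm g" using h by (simp add: power2_eq_square)
    then show ?thesis using \<epsilon> by (simp add: field_simps)
  qed (use ell2_norm_nonneg[OF T_ell2(2)[OF that]] \<epsilon> in simp)
  have "single_valued (?T\<inverse>)"
  proof (rule single_valuedI)
    fix g h1 h2 assume "(g, h1) \<in> ?T\<inverse>" "(g, h2) \<in> ?T\<inverse>"
    then have T: "(h1, g) \<in> ?T" "(h2, g) \<in> ?T" by auto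
    have "((\<lambda>k. -1 * h1 k + h2 k), (\<lambda>k. -1 * g k + g k)) \<in> ?T"
      by (intro minimal_operator_lincomb gen T)
    from below[OF this] have "ell2_norm (\<lambda>k. h2 k - h1 k) \<le> 0" by (simp add: ell2_norm_zero)
    from ell2_norm_eq_0D[OF ell2_diff[OF T_ell2(1)[OF T(2)] T_ell2(1)[OF T(1)]] this]
    show "h1 = h2" by (auto simp: fun_eq_iff)
  qed
  then show "invertible_operator ?T"
    unfolding invertible_operator_def using sv below positive_bounded_surj[OF gen _ \<epsilon> posT] by blast
qed

text \<open>Symmetry lets the one bound \<open>M\<close> serve for rows and columns. With
  \<open>a k j\<close> split into two square roots, Cauchy-Schwarz spends one \<open>M\<close> on
  the rows, and exchanging the sums spends the other on the columns.\<close>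

lemma schur_test:
  fixes a :: "nat \<Rightarrow> nat \<Rightarrow> real"
  assumes nonneg: "\<And>i j. 0 \<le> a i j" and sym: "\<And>i j. a i j = a j i"
    and row: "\<And>i J. finite J \<Longrightarrow> (\<Sum>j\<in>J. a i j) \<le> M"
    and u: "u \<in> finite_sequences"
  defines "A \<equiv> \<lambda>i j. complex_of_real (a i j)"
  shows "matrix_apply A u \<in> ell2" "ell2_norm (matrix_apply A u) \<le> M * ell2_norm u"
proof -
  define J where "J = {j. u j \<noteq> 0}"
  have J: "finite J" using u by (simp add: J_def finite_sequences_def)
  have M: "0 \<le> M" using row[of "{}"] by simp
  have pt: "(cmod (matrix_apply A u k))\<^sup>2 \<le> M * (\<Sum>j\<in>J. a k j * (cmod (u j))\<^sup>2)" for k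
  proof -
    have "cmod (matrix_apply A u k) \<le> (\<Sum>j\<in>J. a k j * cmod (u j))"
      unfolding matrix_apply_def J_def[symmetric] A_def
      by (rule order_trans[OF norm_sum]) (simp add: norm_mult nonneg)
    also have "\<dots> = (\<Sum>j\<in>J. sqrt (a k j) * (sqrt (a k j) * cmod (u j)))"
      using nonneg by (simp flip: mult.assoc)
    finally have "(cmod (matrix_apply A u k))\<^sup>2 \<le> (\<Sum>j\<in>J. sqrt (a k j) * (sqrt (a k j) * cmod (u j)))\<^sup>2"
      by (intro power_mono) auto
    also have "\<dots> \<le> (\<Sum>j\<in>J. (sqrt (a k j))\<^sup>2) * (\<Sum>j\<in>J. (sqrt (a k j) * cmod (u j))\<^sup>2)"
      by (rule Cauchy_Schwarz_ineq_sum)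
    also have "\<dots> = (\<Sum>j\<in>J. a k j) * (\<Sum>j\<in>J. a k j * (cmod (u j))\<^sup>2)"
      using nonneg by (simp add: power_mult_distrib)
    also have "\<dots> \<le> M * (\<Sum>j\<in>J. a k j * (cmod (u j))\<^sup>2)"
      using nonneg by (intro mult_right_mono row J sum_nonneg) auto
    finally show ?thesis .
  qed
  have "partial_norm (matrix_apply A u) n \<le> M * ell2_norm u" for n
  proof -
    have "(\<Sum>k<n. (cmod (matrix_apply A u k))\<^sup>2) \<le> (\<Sum>k<n. M * (\<Sum>j\<in>J. a k j * (cmod (u j))\<^sup>2))"
      by (intro sum_mono pt)
    also have "\<dots> = M * (\<Sum>j\<in>J. \<Sum>k<n. a k j * (cmod (u j))\<^sup>2)"
      by (subst sum.swap) (simp add: sum_distrib_left)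
    also have "\<dots> \<le> M * (\<Sum>j\<in>J. M * (cmod (u j))\<^sup>2)"
    proof (intro mult_left_mono sum_mono M)
      fix j
      have "(\<Sum>k<n. a k j) \<le> M" using row[of "{..<n}" j] sym by simp
      then show "(\<Sum>k<n. a k j * (cmod (u j))\<^sup>2) \<le> M * (cmod (u j))\<^sup>2"
        by (simp add: mult_right_mono flip: sum_distrib_right)
    qed
    also have "\<dots> = M\<^sup>2 * (\<Sum>j\<in>J. (cmod (u j))\<^sup>2)" by (simp add: power2_eq_square sum_distrib_left mult_ac)
    also have "(\<Sum>j\<in>J. (cmod (u j))\<^sup>2) = (ell2_norm u)\<^sup>2"
      unfolding ell2_norm_sq[OF finite_sequences_subset[OF u]]
      by (rule suminf_finite[symmetric, OF J]) (simp add: J_def)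
    also have "M\<^sup>2 * (ell2_norm u)\<^sup>2 = (M * ell2_norm u)\<^sup>2" by (simp add: power_mult_distrib)
    finally show ?thesis
      unfolding L2_set_def using M finite_sequences_subset[OF u] by (simp add: real_le_lsqrt sum_nonneg)
  qed
  then show "matrix_apply A u \<in> ell2" "ell2_norm (matrix_apply A u) \<le> M * ell2_norm u"
    by (rule ell2_of_bounded ell2_norm_le)+
qed

text \<open>The estimate on finite sequences extends by density: the images of the truncations of
  \<open>h\<close> form a Cauchy sequence, so every \<open>h\<close> lies in the domain of the
  closure.\<close>

lemma schur_bounded_operator:
  fixes a :: "nat \<Rightarrow> nat \<Rightarrow> real"
  assumes nonneg: "\<And>i j. 0 \<le> a i j" and sym: "\<And>i j. a i j = a j i"
    and row: "\<And>i J. finite J \<Longrightarrow> (\<Sum>j\<in>J. a i j) \<le> M"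
  shows "generates_bounded_operator (\<lambda>i j. complex_of_real (a i j))"
proof -
  let ?A = "\<lambda>i j. complex_of_real (a i j)"
  let ?T = "minimal_operator ?A"
  have schur: "matrix_apply ?A u \<in> ell2" "ell2_norm (matrix_apply ?A u) \<le> M * ell2_norm u"
    if "u \<in> finite_sequences" for u
    using schur_test[of a M u] nonneg sym row that by blast+
  have M: "0 \<le> M" using row[of "{}"] by simp
  have gen: "generates_operator ?A"
    unfolding generates_operator_def
  proof
    fix j
    have "matrix_apply ?A (\<lambda>i. if i = j then 1 else 0) \<in> ell2"
      by (rule schur(1)) (auto simp: finite_sequences_def)
    also have "matrix_apply ?A (\<lambda>i. if i = j then 1 else 0) = (\<lambda>k. ?A k j)"
      by (rule ext, subst matrix_apply_eq[of "{j}"]) auto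
    finally show "(\<lambda>k. ?A k j) \<in> ell2" .
  qed
  have rows: "(\<lambda>j. ?A k j) \<in> ell2" for k
    using gen sym[of k] by (simp add: generates_operator_def)
  have bound: "ell2_norm g \<le> M * ell2_norm h" if T: "(h, g) \<in> ?T" for h g
  proof -
    obtain u where u: "h \<in> ell2" "g \<in> ell2" "\<And>n. u n \<in> finite_sequences"
      "(\<lambda>n. ell2_norm (\<lambda>k. u n k - h k)) \<longlonglongrightarrow> 0"
      "(\<lambda>n. ell2_norm (\<lambda>k. matrix_apply ?A (u n) k - g k)) \<longlonglongrightarrow> 0"
      using minimal_operatorD[OF T] by blast
    show ?thesis
    proof (rule LIMSEQ_le)
      show "(\<lambda>n. ell2_norm (matrix_apply ?A (u n))) \<longlonglongrightarrow> ell2_norm g"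
        by (intro ell2_norm_tendsto matrix_apply_ell2 gen u)
      show "(\<lambda>n. M * ell2_norm (u n)) \<longlonglongrightarrow> M * ell2_norm h"
        by (intro tendsto_intros ell2_norm_tendsto finite_sequences_subset u)
      show "\<exists>N. \<forall>n\<ge>N. ell2_norm (matrix_apply ?A (u n)) \<le> M * ell2_norm (u n)"
        using schur(2)[OF u(3)] by blast
    qed
  qed
  have "h \<in> Domain ?T" if h: "h \<in> ell2" for h
  proof -
    define u where "u = (\<lambda>n k. if k < n then h k else 0 :: complex)"
    have u: "u n \<in> finite_sequences" "(\<lambda>n. ell2_norm (\<lambda>k. u n k - h k)) \<longlonglongrightarrow> 0" for n
      unfolding u_def by (rule truncation_tendsto[OF h])+
    have uell: "u n \<in> ell2" for n by (rule finite_sequences_subset[OF u(1)])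
    have "\<exists>N. \<forall>m\<ge>N. \<forall>n\<ge>N. ell2_norm (\<lambda>k. matrix_apply ?A (u m) k - matrix_apply ?A (u n) k) \<le> e"
      if e: "0 < e" for e
    proof -
      \<comment> \<open>Division by \<open>M + 1\<close> rather than \<open>M\<close>, which may be
        0.\<close>
      have "0 < e / (M + 1) / 2" using e M by simp
      from order_tendstoD(2)[OF u(2) this]
      obtain N where N: "\<And>n. n \<ge> N \<Longrightarrow> ell2_norm (\<lambda>k. u n k - h k) < e / (M + 1) / 2"
        by (auto simp: eventually_sequentially)
      have "ell2_norm (\<lambda>k. matrix_apply ?A (u m) k - matrix_apply ?A (u n) k) \<le> e"
        if "m \<ge> N" "n \<ge> N" for m n
      proof -
        let ?d = "\<lambda>k. -1 * u n k + u m k"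
        have d: "?d \<in> finite_sequences" by (intro finite_sequences_lincomb u)
        have "ell2_norm (\<lambda>k. matrix_apply ?A (u m) k - matrix_apply ?A (u n) k) = ell2_norm (matrix_apply ?A ?d)"
          unfolding matrix_apply_lincomb[OF u(1) u(1), abs_def] by simp
        also have "\<dots> \<le> M * ell2_norm ?d" by (rule schur(2)[OF d])
        also have "\<dots> \<le> M * (ell2_norm (\<lambda>k. u m k - h k) + ell2_norm (\<lambda>k. u n k - h k))"
          using ell2_norm_diff_triangle[OF uell[of m] h uell[of n]] ell2_norm_minus_commute[of h "u n"] M
          by (intro mult_left_mono) auto
        also have "\<dots> \<le> M * (e / (M + 1) / 2 + e / (M + 1) / 2)"
          using N that M by (intro mult_left_mono add_mono) (auto simp: less_imp_le)
        also have "\<dots> = M * (e / (M + 1))" by (simp only: field_sum_of_halves)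
        also have "\<dots> = e * (M / (M + 1))" by simp
        also have "\<dots> \<le> e * 1" using M e by (intro mult_left_mono) auto
        also have "e * 1 = e" by simp
        finally show ?thesis .
      qed
      then show ?thesis by blast
    qed
    then obtain g where "g \<in> ell2" "(\<lambda>n. ell2_norm (\<lambda>k. matrix_apply ?A (u n) k - g k)) \<longlonglongrightarrow> 0"
      using ell2_complete[of "\<lambda>n. matrix_apply ?A (u n)", OF matrix_apply_ell2[OF gen u(1)]] by blast
    then have "(h, g) \<in> ?T" by (intro minimal_operatorI[of h g u] h u)
    then show ?thesis by auto
  qed
  then have "Domain ?T = ell2" by (auto simp: minimal_operator_def)
  then show ?thesis
    unfolding generates_bounded_operator_def bounded_operator_def
    using gen bound minimal_operator_single_valued[OF gen rows] by blast
qed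

subsection \<open>Operators with Schoenberg matrices\<close>

text \<open>The real part is the sum of the real forms at \<open>Re\<close> and \<open>Im\<close> of
  \<open>\<xi>\<close>; the imaginary part cancels by symmetry of \<open>K\<close>. The order on
  complex numbers asks for both.\<close>

lemma psd_complex:
  assumes K: "psd I K"
  shows "0 \<le> (\<Sum>k\<in>I. \<Sum>j\<in>I. complex_of_real (K k j) * \<xi> j * cnj (\<xi> k))"
proof -
  define S where "S = (\<Sum>k\<in>I. \<Sum>j\<in>I. complex_of_real (K k j) * \<xi> j * cnj (\<xi> k))"
  have "Re S = (\<Sum>k\<in>I. \<Sum>j\<in>I. K k j * Re (\<xi> k) * Re (\<xi> j)) + (\<Sum>k\<in>I. \<Sum>j\<in>I. K k j * Im (\<xi> k) * Im (\<xi> j))"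
  proof -
    have "Re (complex_of_real (K k j) * \<xi> j * cnj (\<xi> k)) =
        K k j * Re (\<xi> k) * Re (\<xi> j) + K k j * Im (\<xi> k) * Im (\<xi> j)" for k j
      by (simp add: algebra_simps)
    then show ?thesis unfolding S_def by (simp only: Re_sum sum.distrib)
  qed
  then have "0 \<le> Re S" 
    using psd_nonneg[OF K, of "\<lambda>k. Re (\<xi> k)"] psd_nonneg[OF K, of "\<lambda>k. Im (\<xi> k)"] by linarith
  moreover have "Im S = 0"
  proof -
    have im: "Im S = (\<Sum>k\<in>I. \<Sum>j\<in>I. K k j * (Im (\<xi> j) * Re (\<xi> k))) - (\<Sum>k\<in>I. \<Sum>j\<in>I. K k j * (Re (\<xi> j) * Im (\<xi> k)))"
    proof -
      have im_term: "Im (complex_of_real (K k j) * \<xi> j * cnj (\<xi> k)) =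
          K k j * (Im (\<xi> j) * Re (\<xi> k)) - K k j * (Re (\<xi> j) * Im (\<xi> k))" for k j
        by (simp add: algebra_simps)
      show ?thesis unfolding S_def Im_sum im_term sum_subtractf ..
    qed
    have "(\<Sum>k\<in>I. \<Sum>j\<in>I. K k j * (Im (\<xi> j) * Re (\<xi> k))) = (\<Sum>j\<in>I. \<Sum>k\<in>I. K k j * (Im (\<xi> j) * Re (\<xi> k)))"
      by (rule sum.swap)
    also have "\<dots> = (\<Sum>k\<in>I. \<Sum>j\<in>I. K k j * (Re (\<xi> j) * Im (\<xi> k)))"
    proof (rule sum.cong[OF refl], rule sum.cong[OF refl])
      fix k j assume "k \<in> I" "j \<in> I"
      show "K j k * (Im (\<xi> k) * Re (\<xi> j)) = K k j * (Re (\<xi> j) * Im (\<xi> k))"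
        unfolding psd_sym[OF K \<open>j \<in> I\<close> \<open>k \<in> I\<close>] by simp
    qed
    finally show ?thesis unfolding im by (rule right_minus_eq[THEN iffD2])
  qed
  ultimately show ?thesis unfolding S_def[symmetric] by (simp add: less_eq_complex_def)
qed

lemma psd_complex_lower_bound:
  assumes "finite I" and K: "psd I (\<lambda>i j. K i j - c * of_bool (i = j))"
  shows "complex_of_real (c * (\<Sum>k\<in>I. (cmod (\<xi> k))\<^sup>2)) \<le>
    (\<Sum>k\<in>I. \<Sum>j\<in>I. complex_of_real (K k j) * \<xi> j * cnj (\<xi> k))"
proof -
  have diag: "(\<Sum>j\<in>I. complex_of_real (c * of_bool (k = j)) * \<xi> j * cnj (\<xi> k)) =
      complex_of_real (c * (cmod (\<xi> k))\<^sup>2)" if "k \<in> I" for k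
  proof -
    have "(\<Sum>j\<in>I. complex_of_real (c * of_bool (k = j)) * \<xi> j * cnj (\<xi> k)) =
        (\<Sum>j\<in>I. if j = k then complex_of_real c * \<xi> j * cnj (\<xi> k) else 0)"
      by (intro sum.cong refl) auto
    also have "\<dots> = complex_of_real c * (\<xi> k * cnj (\<xi> k))" using assms(1) that by simp
    finally show ?thesis by (simp add: complex_norm_square[symmetric] flip: of_real_power)
  qed
  have "(\<Sum>k\<in>I. \<Sum>j\<in>I. complex_of_real (K k j - c * of_bool (k = j)) * \<xi> j * cnj (\<xi> k)) =
      (\<Sum>k\<in>I. \<Sum>j\<in>I. complex_of_real (K k j) * \<xi> j * cnj (\<xi> k)) -
      (\<Sum>k\<in>I. \<Sum>j\<in>I. complex_of_real (c * of_bool (k = j)) * \<xi> j * cnj (\<xi> k))"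
    by (simp only: of_real_diff left_diff_distrib sum_subtractf)
  also have "(\<Sum>k\<in>I. \<Sum>j\<in>I. complex_of_real (c * of_bool (k = j)) * \<xi> j * cnj (\<xi> k)) =
      complex_of_real (c * (\<Sum>k\<in>I. (cmod (\<xi> k))\<^sup>2))"
    by (simp only: diag sum_distrib_left of_real_sum cong: sum.cong)
  finally show ?thesis using psd_complex[OF K, of \<xi>] by simp
qed

section \<open>Positivity for separated sequences\<close>

lemma separatedD:
  assumes "i \<noteq> j" shows "d_star X \<le> norm (X i - X j)"
proof -
  have "d_star X \<le> (case (i, j) of (i, j) \<Rightarrow> norm (X i - X j))"
    unfolding d_star_def by (rule cINF_lower) (use assms in \<open>auto intro!: bdd_belowI2[of _ 0]\<close>)
  then show ?thesis by simp
qed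

lemma strongly_positive_definite_of_lower_bound:
  fixes X :: "nat \<Rightarrow> 'a::real_normed_vector"
  assumes c: "0 < c" "psd_lower_bound (d_star X) (\<lambda>z :: 'a. f (norm z)) c"
  shows "strongly_positive_definite (range X) f"
  unfolding strongly_positive_definite_def
proof (intro exI[of _ c] conjI c(1) allI impI)
  fix m and x :: "nat \<Rightarrow> 'a" and \<xi> :: "nat \<Rightarrow> complex"
  assume x: "inj_on x {..<m} \<and> x ` {..<m} \<subseteq> range X"
  have psd: "psd {..<m} (\<lambda>i j. f (norm (x i - x j)) - c * of_bool (i = j))"
  proof (rule psd_lower_boundD[OF c(2) finite_lessThan])
    fix i j assume ij: "i \<in> {..<m}" "j \<in> {..<m}" "i \<noteq> j"
    then obtain p q where pq: "x i = X p" "x j = X q" using x by blast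
    moreover have "x i \<noteq> x j" using x ij by (auto dest: inj_onD)
    ultimately show "d_star X \<le> norm (x i - x j)" using separatedD[of p q X] by auto
  qed
  show "complex_of_real (c * (\<Sum>k<m. (cmod (\<xi> k))\<^sup>2)) \<le>
      (\<Sum>k<m. \<Sum>j<m. complex_of_real (f (norm (x k - x j))) * \<xi> j * cnj (\<xi> k))"
    by (rule psd_complex_lower_bound[OF finite_lessThan psd])
qed

lemma ell2_inner_matrix_apply:
  assumes "u \<in> finite_sequences"
  defines "J \<equiv> {j. u j \<noteq> 0}"
  shows "ell2_inner (matrix_apply A u) u = (\<Sum>k\<in>J. \<Sum>j\<in>J. A k j * u j * cnj (u k))"
    "(ell2_norm u)\<^sup>2 = (\<Sum>k\<in>J. (cmod (u k))\<^sup>2)"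
proof -
  have J: "finite J" using assms by (simp add: finite_sequences_def)
  have "ell2_inner (matrix_apply A u) u = (\<Sum>k\<in>J. matrix_apply A u k * cnj (u k))"
    unfolding ell2_inner_def by (rule suminf_finite[OF J]) (simp add: J_def)
  then show "ell2_inner (matrix_apply A u) u = (\<Sum>k\<in>J. \<Sum>j\<in>J. A k j * u j * cnj (u k))"
    by (simp add: matrix_apply_def J_def sum_distrib_right)
  show "(ell2_norm u)\<^sup>2 = (\<Sum>k\<in>J. (cmod (u k))\<^sup>2)"
    unfolding ell2_norm_sq[OF finite_sequences_subset[OF assms(1)]]
    by (rule suminf_finite[OF J]) (simp add: J_def)
qed

lemma schoenberg_matrix_sym: "schoenberg_matrix X f i j = schoenberg_matrix X f j i"
  by (simp add: schoenberg_matrix_def norm_minus_commute)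

lemma schoenberg_rows:
  assumes "generates_operator (schoenberg_matrix X f)"
  shows "(\<lambda>j. schoenberg_matrix X f k j) \<in> ell2"
  using assms unfolding generates_operator_def by (subst schoenberg_matrix_sym) blast

lemma schoenberg_at_0:
  assumes "schoenberg_measure \<alpha> f \<sigma>" shows "f 0 = 1"
proof -
  interpret prob_space \<sigma> using schoenberg_measureD(1)[OF assms] .
  show ?thesis using schoenberg_measureD(4)[OF assms, of 0] by (simp add: prob_space)
qed

text \<open>A constant \<open>f\<close> equals \<open>f 0 = 1\<close>, and a column of ones is not
  square summable. Nonconstancy is therefore automatic once an operator is generated.\<close>

lemma schoenberg_generates_nonconstant:
  assumes sm: "schoenberg_measure \<alpha> f \<sigma>" and gen: "generates_operator (schoenberg_matrix X f)"
  shows "\<not> f constant_on {0..}"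
proof
  assume "f constant_on {0..}"
  then obtain c where c: "f t = c" if "0 \<le> t" for t by (auto simp: constant_on_def)
  have one: "f t = 1" if "0 \<le> t" for t using c[OF that] c[of 0] schoenberg_at_0[OF sm] by simp
  have "(\<lambda>k. 1) \<in> ell2"
    using gen by (simp add: generates_operator_def schoenberg_matrix_def one)
  then have "(\<lambda>k::nat. 1::real) \<longlonglongrightarrow> 0" unfolding ell2_def using summable_LIMSEQ_zero by fastforce
  then show False by (simp add: LIMSEQ_const_iff)
qed

lemma schoenberg_generates_positive:
  fixes X :: "nat \<Rightarrow> 'a::euclidean_space"
  assumes \<alpha>: "0 < \<alpha>" "\<alpha> \<le> 2" and sm: "schoenberg_measure \<alpha> f \<sigma>" and X: "separated X"
    and gen: "generates_operator (schoenberg_matrix X f)"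
  shows "positive_definite_operator (minimal_operator (schoenberg_matrix X f))"
    "invertible_operator (minimal_operator (schoenberg_matrix X f))"
proof -
  have \<delta>: "0 < d_star X" using X by (simp add: separated_def)
  obtain c where c: "0 < c" "psd_lower_bound (d_star X) (\<lambda>z :: 'a. f (norm z)) c"
    using schoenberg_lower_bound[OF \<alpha> sm schoenberg_generates_nonconstant[OF sm gen] \<delta>, where 'a = 'a] .
  have pos: "complex_of_real (c * (ell2_norm u)\<^sup>2) \<le> ell2_inner (matrix_apply (schoenberg_matrix X f) u) u"
    if u: "u \<in> finite_sequences" for u
    unfolding ell2_inner_matrix_apply[OF u] schoenberg_matrix_def
  proof (rule psd_complex_lower_bound)
    show "finite {j. u j \<noteq> 0}" using u by (simp add: finite_sequences_def)
    then show "psd {j. u j \<noteq> 0} (\<lambda>i j. f (norm (X i - X j)) - c * of_bool (i = j))"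
      using psd_lower_boundD[OF c(2), of _ X] separatedD[of _ _ X] by blast
  qed
  show "positive_definite_operator (minimal_operator (schoenberg_matrix X f))"
    "invertible_operator (minimal_operator (schoenberg_matrix X f))"
    using positive_definite_invertible[OF gen schoenberg_rows[OF gen] c(1) pos] by blast+
qed

lemma span_dim_pos:
  assumes "normalized_sequence X" shows "0 < span_dim X"
proof -
  have "X 1 \<noteq> 0" using assms unfolding normalized_sequence_def by (metis inj_eq zero_neq_one)
  moreover have "X 1 \<in> span (range X)" by (intro span_base) auto
  ultimately show ?thesis unfolding span_dim_def using dim_eq_0 by blast
qed

section \<open>Sufficiency of the moment condition\<close>

lemma exp_minus_le_power:
  assumes "0 < (y::real)" shows "exp (- y) \<le> fact N / y ^ N"
proof -
  have "y ^ N /\<^sub>R fact N \<le> (\<Sum>n. y ^ n /\<^sub>R fact n)"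
    using sum_le_suminf[OF summable_exp_generic[of y], of "{N}"] assms by simp
  then have "y ^ N / fact N \<le> exp y" by (simp add: exp_def divide_inverse mult.commute)
  then show ?thesis using assms by (simp add: exp_minus field_simps)
qed

text \<open>The exponent \<open>N\<close> is taken with \<open>\<alpha> * N \<ge> m\<close>, so that
  the N-th term of the exponential series beats the power; for \<open>t \<le> 1\<close> the constant
  \<open>fact N \<ge> 1\<close> suffices.\<close>

lemma exp_powr_decay:
  fixes \<alpha> :: real
  assumes "0 < \<alpha>"
  obtains C where "0 < C" "\<And>t. 0 < t \<Longrightarrow> exp (- (t powr \<alpha>)) \<le> C * min 1 (1 / t) ^ m"
proof
  define N where "N = nat \<lceil>m / \<alpha>\<rceil>"
  have "m / \<alpha> \<le> N" unfolding N_def by (rule real_nat_ceiling_ge)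
  then have N: "real m \<le> \<alpha> * N" using assms by (simp add: field_simps)
  show "0 < (fact N :: real)" by simp
  fix t :: real assume t: "0 < t"
  show "exp (- (t powr \<alpha>)) \<le> fact N * min 1 (1 / t) ^ m"
  proof (cases "t \<le> 1")
    case True
    have "exp (- (t powr \<alpha>)) \<le> 1" by simp
    also have "(1::real) \<le> fact N" by (rule fact_ge_1)
    finally have "exp (- (t powr \<alpha>)) \<le> fact N" .
    moreover have "min 1 (1 / t) = 1" using True t by simp
    ultimately show ?thesis by simp
  next
    case False
    have "exp (- (t powr \<alpha>)) \<le> fact N / (t powr \<alpha>) ^ N" using t by (intro exp_minus_le_power) simp
    also have "(t powr \<alpha>) ^ N = t powr (\<alpha> * N)" using t by (simp add: powr_powr flip: powr_realpow)
    also have "fact N / t powr (\<alpha> * N) \<le> fact N / t powr m"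
      using False t N by (intro divide_left_mono powr_mono) auto
    also have "\<dots> = fact N * (1 / t) ^ m" using t by (simp add: powr_realpow power_one_over)
    also have "1 / t = min 1 (1 / t)" using False by simp
    finally show ?thesis .
  qed
qed

lemma inverse_ennreal_powr: "0 < s \<Longrightarrow> inverse (ennreal (s powr p)) = ennreal (s powr (- p))"
  by (simp add: inverse_ennreal powr_minus)

text \<open>Integrating the packing estimate against \<sigma> bounds the row sums required by
  Schur's test. The index \<open>i\<close> is split off because the estimate concerns points away
  from the centre; it contributes \<open>f 0 = 1\<close>.\<close>

lemma schoenberg_row_sum_le:
  fixes X :: "nat \<Rightarrow> 'a::euclidean_space"
  assumes \<alpha>: "0 < \<alpha>" and sm: "schoenberg_measure \<alpha> f \<sigma>" and X: "separated X"
    and mom: "negative_moment \<sigma> (real (span_dim X) / \<alpha>) < \<infinity>"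
  shows "\<exists>M. \<forall>i J. finite J \<longrightarrow> (\<Sum>j\<in>J. f (norm (X i - X j))) \<le> M"
proof -
  define d where "d = span_dim X"
  define V where "V = span (range X)"
  have V: "subspace V" "dim V = d" "X j - X i \<in> V" for i j
    by (auto simp: V_def d_def span_dim_def span_base intro: span_diff)
  have \<delta>: "0 < d_star X" using X by (simp add: separated_def)
  obtain C where C: "0 < C" "\<And>t. 0 < t \<Longrightarrow> exp (- (t powr \<alpha>)) \<le> C * min 1 (1 / t) ^ (d + 1)"
    using exp_powr_decay[OF \<alpha>] by blast
  define P where "P = C * packing_const (d_star X) d"
  have P: "0 < P" using C packing_const_pos[OF \<delta>] by (simp add: P_def)
  obtain m where m: "0 \<le> m" "negative_moment \<sigma> (d / \<alpha>) = ennreal m"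
    using mom by (cases "negative_moment \<sigma> (d / \<alpha>)") (auto simp: d_def)
  have kernel: "(\<Sum>j\<in>J. exp (- s * norm (X i - X j) powr \<alpha>)) \<le> P * s powr (- (d / \<alpha>))"
    if J: "finite J" "i \<notin> J" and s: "0 < s" for J i s
  proof -
    \<comment> \<open>The length scale of the kernel:
      \<open>s * r powr \<alpha> = (r / \<rho>) powr \<alpha>\<close>, and \<open>\<rho>^d\<close>
      becomes the integrand of the moment.\<close>
    define \<rho> where "\<rho> = s powr (- (1 / \<alpha>))"
    have \<rho>: "0 < \<rho>" using s by (simp add: \<rho>_def)
    have \<rho>\<alpha>: "\<rho> powr \<alpha> = 1 / s" using s \<alpha> by (simp add: \<rho>_def powr_powr powr_neg_one)
    have "(\<Sum>j\<in>J. exp (- s * norm (X i - X j) powr \<alpha>)) \<le> (\<Sum>j\<in>J. C * min 1 (\<rho> / norm (X j - X i)) ^ (d + 1))"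
    proof (rule sum_mono)
      fix j assume "j \<in> J"
      with J have "j \<noteq> i" by auto
      from separatedD[OF this, of X] \<delta> have r: "0 < norm (X j - X i)" by linarith
      have "s * norm (X j - X i) powr \<alpha> = (norm (X j - X i) / \<rho>) powr \<alpha>"
        using r \<rho> by (simp add: powr_divide \<rho>\<alpha>)
      then show "exp (- s * norm (X i - X j) powr \<alpha>) \<le> C * min 1 (\<rho> / norm (X j - X i)) ^ (d + 1)"
        using C(2)[of "norm (X j - X i) / \<rho>"] r \<rho> by (simp add: norm_minus_commute)
    qed
    also have "\<dots> = C * (\<Sum>j\<in>J. min 1 (\<rho> / norm (X j - X i)) ^ (dim V + 1))"
      unfolding V(2) by (rule sum_distrib_left[symmetric])
    also have "\<dots> \<le> C * (packing_const (d_star X) (dim V) * \<rho> ^ dim V)"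
    proof (intro mult_left_mono separated_sum_le J \<delta> \<rho> V)
      show "d_star X \<le> norm (X j - X i)" if "j \<in> J" for j using that J by (intro separatedD) auto
    qed (use C separatedD in auto)
    also have "\<dots> = P * s powr (- (d / \<alpha>))"
      using s by (simp add: P_def V \<rho>_def powr_powr flip: powr_realpow)
    finally show ?thesis .
  qed
  have off: "(\<Sum>j\<in>J. f (norm (X i - X j))) \<le> P * m" if J: "finite J" "i \<notin> J" for J i
  proof -
    have int: "integrable \<sigma> (\<lambda>s. exp (- s * norm (X i - X j) powr \<alpha>))" for j
      by (rule schoenberg_integrable[OF sm]) simp
    have "(\<Sum>j\<in>J. f (norm (X i - X j))) = (\<integral>s. (\<Sum>j\<in>J. exp (- s * norm (X i - X j) powr \<alpha>)) \<partial>\<sigma>)"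
      using int by (simp add: schoenberg_measureD(4)[OF sm])
    then have "ennreal (\<Sum>j\<in>J. f (norm (X i - X j))) =
        (\<integral>\<^sup>+s. ennreal (\<Sum>j\<in>J. exp (- s * norm (X i - X j) powr \<alpha>)) \<partial>\<sigma>)"
      using int by (subst nn_integral_eq_integral) (auto intro!: sum_nonneg)
    also have "\<dots> \<le> (\<integral>\<^sup>+s. ennreal P * inverse (ennreal (s powr (d / \<alpha>))) \<partial>\<sigma>)"
    proof (rule nn_integral_mono)
      fix s assume "s \<in> space \<sigma>"
      then have "0 \<le> s" by (simp add: schoenberg_measureD(2)[OF sm])
      then consider "s = 0" | "0 < s" by linarith
      then show "ennreal (\<Sum>j\<in>J. exp (- s * norm (X i - X j) powr \<alpha>)) \<le>
          ennreal P * inverse (ennreal (s powr (d / \<alpha>)))"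
      proof cases
        \<comment> \<open>At \<open>s = 0\<close> the right side is infinite, since the inverse of 0
          is the top element and \<open>P > 0\<close>.\<close>
        case 1
        then show ?thesis using P by (simp add: ennreal_mult_top)
      next
        case 2
        then show ?thesis
          using kernel[OF J 2] P by (simp add: inverse_ennreal_powr flip: ennreal_mult)
      qed
    qed
    also have "\<dots> = ennreal P * negative_moment \<sigma> (d / \<alpha>)"
      unfolding negative_moment_def
      by (intro nn_integral_cmult borel_measurable_inverse_ennreal measurable_compose[OF _ measurable_ennreal]
          schoenberg_measureD(3)[OF sm]) measurable
    also have "\<dots> = ennreal (P * m)" using P m by (simp add: ennreal_mult)
    finally show ?thesis using P m by (simp add: ennreal_le_iff)
  qed
  show ?thesis
  proof (intro exI[of _ "1 + P * m"] allI impI)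
    fix i and J :: "nat set" assume J: "finite J"
    have "(\<Sum>j\<in>J. f (norm (X i - X j))) \<le> 1 + (\<Sum>j\<in>J - {i}. f (norm (X i - X j)))"
      using J schoenberg_at_0[OF sm] by (cases "i \<in> J") (auto simp: sum.remove[of J i])
    also have "\<dots> \<le> 1 + P * m" using off[of "J - {i}" i] J by simp
    finally show "(\<Sum>j\<in>J. f (norm (X i - X j))) \<le> 1 + P * m" .
  qed
qed

lemma schoenberg_nonneg:
  assumes "schoenberg_measure \<alpha> f \<sigma>" "0 \<le> t" shows "0 \<le> f t"
  unfolding schoenberg_measureD(4)[OF assms] by (intro Bochner_Integration.integral_nonneg) simp

lemma schoenberg_antimono:
  assumes sm: "schoenberg_measure \<alpha> f \<sigma>" and "0 < \<alpha>" "0 \<le> s" "s \<le> t" shows "f t \<le> f s"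
proof -
  have t: "0 \<le> t" using assms by simp
  show ?thesis
    unfolding schoenberg_measureD(4)[OF sm t] schoenberg_measureD(4)[OF sm assms(3)]
  proof (intro integral_mono schoenberg_integrable[OF sm])
    fix u assume "u \<in> space \<sigma>"
    then have "0 \<le> u" by (simp add: schoenberg_measureD(2)[OF sm])
    then show "exp (- u * t powr \<alpha>) \<le> exp (- u * s powr \<alpha>)"
      using assms by (simp add: mult_left_mono powr_mono2)
  qed auto
qed

lemma schoenberg_bounded_operator:
  fixes X :: "nat \<Rightarrow> 'a::euclidean_space"
  assumes "0 < \<alpha>" and sm: "schoenberg_measure \<alpha> f \<sigma>" and "separated X"
    and "negative_moment \<sigma> (real (span_dim X) / \<alpha>) < \<infinity>"
  shows "generates_bounded_operator (schoenberg_matrix X f)"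
proof -
  obtain M where M: "\<And>i J. finite J \<Longrightarrow> (\<Sum>j\<in>J. f (norm (X i - X j))) \<le> M"
    using schoenberg_row_sum_le[OF assms] by blast
  show ?thesis
    unfolding schoenberg_matrix_def[abs_def]
    by (rule schur_bounded_operator[OF _ _ M])
       (auto simp: norm_minus_commute intro: schoenberg_nonneg[OF sm])
qed

subsection \<open>Regular sequences\<close>

lemma card_ball_le:
  fixes Y :: "nat \<Rightarrow> 'a::euclidean_space" and i :: nat
  assumes \<delta>: "0 < \<delta>" "\<delta> \<le> d_star Y" "\<delta> \<le> r"
  defines "J \<equiv> {k. norm (Y k - Y i) < r}"
  shows "finite J" "real (card J) \<le> (2 * (real (span_dim Y) + 2) / \<delta> * r) ^ span_dim Y"
proof -
  let ?V = "span (range Y)"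
  \<comment> \<open>Stated for finite subsets, because the finiteness of \<open>J\<close> is itself
    deduced from this bound.\<close>
  have le: "real (card F) \<le> (2 * (real (span_dim Y) + 2) / \<delta> * r) ^ span_dim Y"
    if F: "finite F" "F \<subseteq> J" for F
    unfolding span_dim_def
  proof (rule card_separated_le[where x = Y and a = "Y i"])
    show "\<delta> \<le> norm (Y k - Y l)" if "k \<noteq> l" for k l using separatedD[OF that, of Y] \<delta> by linarith
  qed (use F \<delta> in \<open>auto simp: J_def span_base intro: span_diff\<close>)
  show fin: "finite J"
  proof (rule ccontr)
    assume inf: "infinite J"
    obtain m :: nat where m: "(2 * (real (span_dim Y) + 2) / \<delta> * r) ^ span_dim Y < real m"
      using reals_Archimedean2 by blast
    obtain F where "F \<subseteq> J" "finite F" "card F = m" using infinite_arbitrarily_large[OF inf] by blast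
    with le[of F] m show False by simp
  qed
  show "real (card J) \<le> (2 * (real (span_dim Y) + 2) / \<delta> * r) ^ span_dim Y" by (rule le[OF fin order_refl])
qed

text \<open>The operator bound is tested on the indicator of \<open>J\<close>, whose squared norm is
  \<open>card J\<close>.\<close>

lemma schoenberg_double_sum_le:
  assumes bdd: "generates_bounded_operator (schoenberg_matrix Y f)"
  shows "\<exists>C\<ge>0. \<forall>J. finite J \<longrightarrow> (\<Sum>i\<in>J. \<Sum>j\<in>J. f (norm (Y i - Y j))) \<le> C * real (card J)"
proof -
  let ?A = "schoenberg_matrix Y f"
  have gen: "generates_operator ?A" using bdd by (simp add: generates_bounded_operator_def)
  obtain C where C: "\<And>h g. (h, g) \<in> minimal_operator ?A \<Longrightarrow> ell2_norm g \<le> C * ell2_norm h"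
    using bdd by (fastforce simp: generates_bounded_operator_def bounded_operator_def)
  show ?thesis
  \<comment> \<open>The constant in the definition of boundedness carries no sign, hence the maximum
    with 0.\<close>
  proof (intro exI[of _ "max 0 C"] conjI allI impI)
    fix J :: "nat set" assume J: "finite J"
    define u where "u = (\<lambda>j. of_bool (j \<in> J) :: complex)"
    have supp: "{j. u j \<noteq> 0} = J" by (auto simp: u_def)
    have u: "u \<in> finite_sequences" using J by (simp add: finite_sequences_def supp)
    have uell: "u \<in> ell2" by (rule finite_sequences_subset[OF u])
    have norm_u: "(ell2_norm u)\<^sup>2 = real (card J)"
      unfolding ell2_inner_matrix_apply(2)[OF u] supp by (simp add: u_def)
    have eq: "ell2_inner (matrix_apply ?A u) u = complex_of_real (\<Sum>i\<in>J. \<Sum>j\<in>J. f (norm (Y i - Y j)))"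
      unfolding ell2_inner_matrix_apply(1)[OF u] supp
      by (simp add: u_def schoenberg_matrix_def cong: sum.cong)
    have "(\<Sum>i\<in>J. \<Sum>j\<in>J. f (norm (Y i - Y j))) \<le> cmod (ell2_inner (matrix_apply ?A u) u)"
      unfolding eq norm_of_real by (rule abs_ge_self)
    also have "\<dots> \<le> ell2_norm (matrix_apply ?A u) * ell2_norm u"
      by (intro ell2_inner_le matrix_apply_ell2 gen u uell)
    also have "\<dots> \<le> C * ell2_norm u * ell2_norm u"
      by (intro mult_right_mono C minimal_operator_finite gen u) (simp add: uell)
    also have "\<dots> = C * real (card J)" by (simp add: mult.assoc norm_u flip: power2_eq_square)
    also have "\<dots> \<le> max 0 C * real (card J)" by (intro mult_right_mono) auto
    finally show "(\<Sum>i\<in>J. \<Sum>j\<in>J. f (norm (Y i - Y j))) \<le> max 0 C * real (card J)" .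
  qed simp
qed

lemma sum_powers_ge:
  "real N ^ (d + 1) \<le> (\<Sum>m=N..<2 * N. real m ^ d)"
proof -
  have "(\<Sum>m=N..<2 * N. real N ^ d) \<le> (\<Sum>m=N..<2 * N. real m ^ d)"
    by (intro sum_mono power_mono) auto
  then show ?thesis by simp
qed

text \<open>Disjoint shells of width \<open>\<delta>\<close> from radius \<open>r0\<close> outwards,
  all inside the ball of radius \<open>2 * N * (r0 + \<delta>)\<close>. Enlarging the outer radius
  of the m-th shell to \<open>(r0 + \<delta>) * (m + 1)\<close> leaves a single length scale. The
  weight is arbitrary so that \<open>g = 1\<close> counts points and \<open>g = f\<close> bounds row
  sums.\<close>

lemma regular_shell_sum:
  fixes Y :: "nat \<Rightarrow> 'a::euclidean_space"
  assumes \<delta>: "0 < \<delta>" and c0: "0 < c0" and r0: "0 \<le> r0" and "inj Y"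
    and reg: "\<And>j r. r0 \<le> r \<Longrightarrow> c0 * r ^ e \<le>
        real (card {y \<in> range Y. r \<le> norm (y - Y j) \<and> norm (y - Y j) < r + \<delta>})"
    and g: "\<And>t. 0 \<le> t \<Longrightarrow> 0 \<le> g t" "\<And>s t. 0 \<le> s \<Longrightarrow> s \<le> t \<Longrightarrow> g t \<le> g s"
    and N: "0 < N" and L: "finite L" "{k. norm (Y k - Y j) < real (2 * N) * (r0 + \<delta>)} \<subseteq> L"
  shows "(\<Sum>m<2 * N. c0 * \<delta> ^ e * real m ^ e * g ((r0 + \<delta>) * (real m + 1))) \<le>
    (\<Sum>k\<in>L. g (norm (Y k - Y j)))"
proof -
  define R where "R = (\<lambda>m::nat. r0 + real m * \<delta>)"
  define S where "S = (\<lambda>m. {k. R m \<le> norm (Y k - Y j) \<and> norm (Y k - Y j) < R m + \<delta>})"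
  have SL: "S m \<subseteq> L" if "m < 2 * N" for m
  proof -
    have "R m + \<delta> = r0 + (real m + 1) * \<delta>" by (simp add: R_def algebra_simps)
    also have "\<dots> \<le> real (2 * N) * r0 + real (2 * N) * \<delta>"
    proof (rule add_mono)
      show "r0 \<le> real (2 * N) * r0" using mult_right_mono[of 1 "real (2 * N)" r0] N r0 by simp
      have "real m + 1 \<le> real (2 * N)" using that by linarith
      then show "(real m + 1) * \<delta> \<le> real (2 * N) * \<delta>" using \<delta> by (intro mult_right_mono) auto
    qed
    finally show ?thesis using L(2) by (force simp: S_def algebra_simps)
  qed
  have fin: "finite (S m)" if "m < 2 * N" for m using SL[OF that] L(1) by (rule finite_subset)
  have disj: "S m \<inter> S m' = {}" if "m \<noteq> m'" for m m'
  proof -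
    have False if k: "k \<in> S a" "k \<in> S b" and ab: "a < b" for a b k
    proof -
      have "R a + \<delta> = r0 + (real a + 1) * \<delta>" by (simp add: R_def algebra_simps)
      also have "\<dots> \<le> R b" unfolding R_def using ab \<delta> by (intro add_left_mono mult_right_mono) auto
      finally show False using k by (auto simp: S_def)
    qed
    then show ?thesis using that by (metis disjoint_iff linorder_neqE_nat)
  qed
  have "c0 * \<delta> ^ e * real m ^ e * g ((r0 + \<delta>) * (real m + 1)) \<le> (\<Sum>k\<in>S m. g (norm (Y k - Y j)))"
    if m: "m < 2 * N" for m
  proof -
    have Rpos: "0 \<le> R m" using r0 \<delta> by (simp add: R_def)
    have "{y \<in> range Y. R m \<le> norm (y - Y j) \<and> norm (y - Y j) < R m + \<delta>} = Y ` S m"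
      by (auto simp: S_def)
    then have card: "c0 * R m ^ e \<le> real (card (S m))"
      using reg[of "R m" j] \<delta> card_image[of Y "S m"] inj_on_subset[OF \<open>inj Y\<close>] by (simp add: R_def)
    have "c0 * \<delta> ^ e * real m ^ e = c0 * (real m * \<delta>) ^ e" by (simp add: power_mult_distrib)
    also have "\<dots> \<le> c0 * R m ^ e"
      using c0 r0 \<delta> by (intro mult_left_mono power_mono) (auto simp: R_def)
    finally have count: "c0 * \<delta> ^ e * real m ^ e \<le> real (card (S m))" using card by linarith
    let ?b = "(r0 + \<delta>) * (real m + 1)"
    have b: "0 \<le> ?b" using r0 \<delta> by simp
    have "R m + \<delta> \<le> ?b" using r0 by (simp add: R_def algebra_simps)
    then have gS: "g ?b \<le> g (norm (Y k - Y j))" if "k \<in> S m" for k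
      using that by (intro g) (auto simp: S_def)
    have "c0 * \<delta> ^ e * real m ^ e * g ?b \<le> real (card (S m)) * g ?b"
      by (intro mult_right_mono count g(1) b)
    also have "\<dots> = (\<Sum>k\<in>S m. g ?b)" by simp
    also have "\<dots> \<le> (\<Sum>k\<in>S m. g (norm (Y k - Y j)))" by (intro sum_mono gS)
    finally show ?thesis .
  qed
  then have "(\<Sum>m<2 * N. c0 * \<delta> ^ e * real m ^ e * g ((r0 + \<delta>) * (real m + 1))) \<le>
      (\<Sum>m<2 * N. \<Sum>k\<in>S m. g (norm (Y k - Y j)))"
    by (intro sum_mono) simp
  also have "\<dots> = (\<Sum>k\<in>(\<Union>m<2 * N. S m). g (norm (Y k - Y j)))"
    by (rule sum.UNION_disjoint[symmetric]) (use fin disj in auto)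
  also have "\<dots> \<le> (\<Sum>k\<in>L. g (norm (Y k - Y j)))"
    using SL by (intro sum_mono2 L) (auto intro: g)
  finally show ?thesis .
qed

text \<open>The quadratic form is tested on the indicator of the points in a ball of radius \<open>4 N B\<close>;
  the points in the concentric ball of radius \<open>2 N B\<close> form a fixed proportion of them and
  have all their neighbours at distance below \<open>2 N B\<close> inside the large ball.\<close>

lemma regular_sum_bounded:
  fixes Y :: "nat \<Rightarrow> 'a::euclidean_space"
  assumes "0 < \<alpha>" and sm: "schoenberg_measure \<alpha> f \<sigma>" and reg: "delta_regular \<delta> Y"
    and bdd: "generates_bounded_operator (schoenberg_matrix Y f)"
  shows "\<exists>B>0. \<exists>E. \<forall>n. (\<Sum>m<n. real m ^ (span_dim Y - 1) * f (B * (real m + 1))) \<le> E"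
proof -
  have \<delta>: "0 < \<delta>" and norm_Y: "normalized_sequence Y" and sep: "0 < d_star Y"
    using reg by (auto simp: delta_regular_def separated_def)
  have inj: "inj Y" and Y0: "Y 0 = 0" using norm_Y by (auto simp: normalized_sequence_def)
  define e where "e = span_dim Y - 1"
  have d: "span_dim Y = e + 1" using span_dim_pos[OF norm_Y] by (simp add: e_def)
  obtain c0 r0 where c0: "0 < c0" and r0: "0 \<le> r0"
    and shells: "\<And>j r. r0 \<le> r \<Longrightarrow> c0 * r ^ e \<le>
        real (card {y \<in> range Y. r \<le> norm (y - Y j) \<and> norm (y - Y j) < r + \<delta>})"
    using reg unfolding delta_regular_def e_def by blast
  define B where "B = r0 + \<delta>"
  have B: "0 < B" using r0 \<delta> by (simp add: B_def)
  \<comment> \<open>The counting bound wants a separation not exceeding the radius;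
    \<open>\<eta> \<le> B\<close> ensures this for all positive integer multiples of
    \<open>B\<close>.\<close>
  define \<eta> where "\<eta> = min (d_star Y) B"
  have \<eta>: "0 < \<eta>" "\<eta> \<le> d_star Y" "\<eta> \<le> B" using sep B by (auto simp: \<eta>_def)
  obtain C where C: "0 \<le> C"
    "\<And>J. finite J \<Longrightarrow> (\<Sum>i\<in>J. \<Sum>j\<in>J. f (norm (Y i - Y j))) \<le> C * real (card J)"
    using schoenberg_double_sum_le[OF bdd] by blast
  define K where "K = 2 * (real (e + 1) + 2) / \<eta> * (4 * B)"
  define q where "q = c0 * \<delta> ^ e"
  have q: "0 < q" using c0 \<delta> by (simp add: q_def)
  have f0: "0 \<le> f t" if "0 \<le> t" for t by (rule schoenberg_nonneg[OF sm that])
  have fmono: "f t \<le> f s" if "0 \<le> s" "s \<le> t" for s t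
    by (rule schoenberg_antimono[OF sm \<open>0 < \<alpha>\<close> that])
  have main: "(\<Sum>m<2 * N. real m ^ e * f (B * (real m + 1))) \<le> C * K ^ (e + 1) / q / q" if N: "0 < N" for N
  proof -
    define J where "J = {k. norm (Y k - Y 0) < real (4 * N) * B}"
    define J' where "J' = {k. norm (Y k - Y 0) < real (2 * N) * B}"
    have radius: "\<eta> \<le> real k * B" if "1 \<le> k" for k
    proof -
      have "1 * B \<le> real k * B" using that B by (intro mult_right_mono) auto
      then show ?thesis using \<eta>(3) by linarith
    qed
    have rad: "\<eta> \<le> real (4 * N) * B" "\<eta> \<le> real (2 * N) * B" using N by (intro radius; simp)+
    have J: "finite J" "real (card J) \<le> (K * real N) ^ (e + 1)"
      unfolding J_def using card_ball_le[OF \<eta>(1,2) rad(1), of 0] by (simp_all add: d K_def mult_ac)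
    have "finite J'" unfolding J'_def by (rule card_ball_le[OF \<eta>(1,2) rad(2)])
    define F where "F = (\<Sum>m<2 * N. q * real m ^ e * f (B * (real m + 1)))"
    have F0: "0 \<le> F" unfolding F_def using q B by (intro sum_nonneg mult_nonneg_nonneg f0) auto
    \<comment> \<open>The shell estimate with weight 1 around \<open>Y 0\<close>; the terms with
      \<open>m \<ge> N\<close> alone give \<open>N^(e+1)\<close>, the same order as the upper bound
      for \<open>card J\<close>.\<close>
    have "q * real N ^ (e + 1) \<le> q * (\<Sum>m=N..<2 * N. real m ^ e)"
      using q by (intro mult_left_mono sum_powers_ge) auto
    also have "\<dots> \<le> q * (\<Sum>m<2 * N. real m ^ e)"
      using q by (intro mult_left_mono sum_mono2) auto
    also have "\<dots> = (\<Sum>m<2 * N. c0 * \<delta> ^ e * real m ^ e * 1)" by (simp add: q_def sum_distrib_left)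
    also have "\<dots> \<le> (\<Sum>k\<in>J'. 1)"
      by (rule regular_shell_sum[OF \<delta> c0 r0 inj shells, where g = "\<lambda>_. 1" and j = 0])
        (use N \<open>finite J'\<close> in \<open>auto simp: J'_def B_def\<close>)
    finally have lower: "q * real N ^ (e + 1) \<le> real (card J')" by simp
    have nbr: "F \<le> (\<Sum>k\<in>J. f (norm (Y j - Y k)))" if "j \<in> J'" for j
    proof -
      have "{k. norm (Y k - Y j) < real (2 * N) * (r0 + \<delta>)} \<subseteq> J"
      proof
        fix k assume "k \<in> {k. norm (Y k - Y j) < real (2 * N) * (r0 + \<delta>)}"
        then have "norm (Y k - Y j) + norm (Y j - Y 0) < real (2 * N) * B + real (2 * N) * B"
          using that by (intro add_strict_mono) (auto simp: J'_def B_def)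
        moreover have "norm (Y k - Y 0) \<le> norm (Y k - Y j) + norm (Y j - Y 0)"
          using norm_triangle_ineq[of "Y k - Y j" "Y j - Y 0"] by simp
        ultimately have "norm (Y k - Y 0) < real (2 * N) * B + real (2 * N) * B" by linarith
        also have "\<dots> = real (4 * N) * B" by simp
        finally show "k \<in> J" unfolding J_def by blast
      qed
      from regular_shell_sum[OF \<delta> c0 r0 inj shells f0 fmono N J(1) this]
      have "F \<le> (\<Sum>k\<in>J. f (norm (Y k - Y j)))" unfolding F_def q_def B_def .
      also have "\<dots> = (\<Sum>k\<in>J. f (norm (Y j - Y k)))"
        by (intro sum.cong refl arg_cong[where f = f] norm_minus_commute)
      finally show ?thesis .
    qed
    have "q * real N ^ (e + 1) * F \<le> real (card J') * F" by (intro mult_right_mono lower F0)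
    also have "\<dots> = (\<Sum>j\<in>J'. F)" by simp
    also have "\<dots> \<le> (\<Sum>j\<in>J'. \<Sum>k\<in>J. f (norm (Y j - Y k)))" by (intro sum_mono nbr)
    also have "\<dots> \<le> (\<Sum>j\<in>J. \<Sum>k\<in>J. f (norm (Y j - Y k)))"
    proof (intro sum_mono2 J)
      have le: "real (2 * N) * B \<le> real (4 * N) * B" using B by (intro mult_right_mono) auto
      show "J' \<subseteq> J"
        unfolding J_def J'_def by (intro Collect_mono impI) (erule less_le_trans, rule le)
    qed (auto intro!: sum_nonneg f0)
    also have "\<dots> \<le> C * real (card J)" by (rule C(2)[OF J(1)])
    also have "\<dots> \<le> C * (K * real N) ^ (e + 1)" by (intro mult_left_mono J C)
    \<comment> \<open>The lower count for \<open>J'\<close> and the upper count for \<open>J\<close>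
      carry the same power of \<open>N\<close>, which cancels and leaves a bound uniform in
      \<open>N\<close>.\<close>
    finally have "real N ^ (e + 1) * (q * F) \<le> real N ^ (e + 1) * (C * K ^ (e + 1))"
      by (simp only: power_mult_distrib mult_ac)
    moreover have "0 < real N ^ (e + 1)" using N by simp
    ultimately have "q * F \<le> C * K ^ (e + 1)" by (rule mult_left_le_imp_le)
    then have "q * F / q / q \<le> C * K ^ (e + 1) / q / q" using q by (intro divide_right_mono) auto
    moreover have "F = q * (\<Sum>m<2 * N. real m ^ e * f (B * (real m + 1)))"
      by (simp add: F_def sum_distrib_left mult.assoc)
    ultimately show ?thesis using q by simp
  qed
  have "(\<Sum>m<n. real m ^ e * f (B * (real m + 1))) \<le> C * K ^ (e + 1) / q / q" for n
  proof -
    have "(\<Sum>m<n. real m ^ e * f (B * (real m + 1))) \<le> (\<Sum>m<2 * Suc n. real m ^ e * f (B * (real m + 1)))"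
      using B by (intro sum_mono2 mult_nonneg_nonneg f0) auto
    also have "\<dots> \<le> C * K ^ (e + 1) / q / q" by (rule main) simp
    finally show ?thesis .
  qed
  then show ?thesis using B unfolding e_def by blast
qed

text \<open>With \<open>\<rho> = s powr (- (1 / \<alpha>))\<close> the exponentials with
  \<open>B * (m + 1) \<le> \<rho>\<close> are at least \<open>exp (- 1)\<close>. For
  \<open>\<rho> \<ge> 2 * B\<close> an upper block of these terms already sums to a multiple of
  \<open>\<rho>^(e+1)\<close>; the constant term covers smaller \<open>\<rho>\<close>.\<close>

lemma negative_power_le_series:
  fixes B :: real
  assumes \<alpha>: "0 < \<alpha>" and B: "0 < B" and s: "0 \<le> s"
  shows "inverse (ennreal (s powr (real (e + 1) / \<alpha>))) \<le> ennreal ((2 * B) ^ (e + 1)) +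
    ennreal ((4 * B) ^ (e + 1) * exp 1) *
      (\<Sum>m. ennreal (real m ^ e * exp (- s * (B * (real m + 1)) powr \<alpha>)))"
    (is "_ \<le> _ + _ * ?S")
proof -
  have partial: "ennreal (real N ^ (e + 1) * exp (- 1)) \<le> ?S" if N: "s * (B * real (2 * N)) powr \<alpha> \<le> 1" for N
  proof -
    have "real N ^ (e + 1) * exp (- 1) \<le> (\<Sum>m=N..<2 * N. real m ^ e) * exp (- 1)"
      by (intro mult_right_mono sum_powers_ge) simp
    also have "\<dots> \<le> (\<Sum>m=N..<2 * N. real m ^ e * exp (- s * (B * (real m + 1)) powr \<alpha>))"
      unfolding sum_distrib_right
    proof (intro sum_mono mult_left_mono)
      fix m assume "m \<in> {N..<2 * N}"
      then have "B * (real m + 1) \<le> B * real (2 * N)" using B by (intro mult_left_mono) auto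
      then have "s * (B * (real m + 1)) powr \<alpha> \<le> s * (B * real (2 * N)) powr \<alpha>"
        using \<alpha> B s by (intro mult_left_mono powr_mono2) auto
      then show "exp (- 1) \<le> exp (- s * (B * (real m + 1)) powr \<alpha>)" using N by simp
    qed simp
    also have "\<dots> \<le> (\<Sum>m<2 * N. real m ^ e * exp (- s * (B * (real m + 1)) powr \<alpha>))"
      by (intro sum_mono2) auto
    finally have "ennreal (real N ^ (e + 1) * exp (- 1)) \<le>
        ennreal (\<Sum>m<2 * N. real m ^ e * exp (- s * (B * (real m + 1)) powr \<alpha>))"
      by (rule ennreal_leI)
    also have "\<dots> = (\<Sum>m<2 * N. ennreal (real m ^ e * exp (- s * (B * (real m + 1)) powr \<alpha>)))"
      by (rule sum_ennreal[symmetric]) simp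
    also have "\<dots> \<le> ?S" by (intro sum_le_suminf) auto
    finally show ?thesis .
  qed
  consider "s = 0" | "0 < s" using s by linarith
  then show ?thesis
  proof cases
    case 1
    \<comment> \<open>At \<open>s = 0\<close> the left side is infinite; the series diverges as
      well, because \<open>partial\<close> then applies to every \<open>N\<close>.\<close>
    have "?S = \<top>"
    proof (rule ccontr)
      assume "?S \<noteq> \<top>"
      then obtain M where M: "0 \<le> M" "?S = ennreal M" by (cases ?S) auto
      obtain N :: nat where N: "M * exp 1 < real N" using reals_Archimedean2 by blast
      have "ennreal (real N ^ (e + 1) * exp (- 1)) \<le> ennreal M"
        unfolding M(2)[symmetric] by (rule partial) (simp add: 1)
      then have "real N ^ (e + 1) * exp (- 1) \<le> M" using M(1) by (simp only: ennreal_le_iff)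
      then have "real N ^ (e + 1) * exp (- 1) * exp 1 \<le> M * exp 1" by (rule mult_right_mono) simp
      then have "real N ^ (e + 1) \<le> M * exp 1" by (simp only: mult.assoc exp_add[symmetric]) simp
      moreover have "real N \<le> real N ^ (e + 1)"
        using N M by (cases "N = 0") (auto intro: self_le_power)
      ultimately show False using N by linarith
    qed
    then show ?thesis using B by (simp add: ennreal_mult_top)
  next
    case 2
    define \<rho> where "\<rho> = s powr (- (1 / \<alpha>))"
    have \<rho>: "0 < \<rho>" using 2 by (simp add: \<rho>_def)
    have \<rho>\<alpha>: "\<rho> powr \<alpha> = 1 / s" using 2 \<alpha> by (simp add: \<rho>_def powr_powr powr_neg_one)
    have "\<rho> ^ (e + 1) = \<rho> powr real (e + 1)" by (rule powr_realpow[OF \<rho>, symmetric])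
    also have "\<dots> = s powr (- (real (e + 1) / \<alpha>))" unfolding \<rho>_def powr_powr by simp
    finally have lhs: "inverse (ennreal (s powr (real (e + 1) / \<alpha>))) = ennreal (\<rho> ^ (e + 1))"
      unfolding inverse_ennreal_powr[OF 2] by simp
    \<comment> \<open>The largest \<open>N\<close> with \<open>2 * B * N \<le> \<rho>\<close>, so
      that the block up to \<open>2 * N\<close> stays within \<open>\<rho>\<close>; for
      \<open>N \<ge> 1\<close> conversely \<open>\<rho> < 4 * B * N\<close>.\<close>
    define N where "N = nat \<lfloor>\<rho> / (2 * B)\<rfloor>"
    have "0 \<le> \<rho> / (2 * B)" using \<rho> B by simp
    then have "real N = of_int \<lfloor>\<rho> / (2 * B)\<rfloor>" by (simp add: N_def)
    then have N: "real N \<le> \<rho> / (2 * B)" "\<rho> / (2 * B) < real N + 1" by linarith+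
    show ?thesis
    proof (cases "N = 0")
      case True
      then have "\<rho> \<le> 2 * B" using N(2) B by (simp add: field_simps)
      then have "ennreal (\<rho> ^ (e + 1)) \<le> ennreal ((2 * B) ^ (e + 1))"
        using \<rho> by (intro ennreal_leI power_mono) auto
      then show ?thesis unfolding lhs by (rule order_trans) simp
    next
      case False
      have "\<rho> < 2 * B * (real N + 1)" using N(2) B by (simp add: field_simps)
      also have "\<dots> \<le> 4 * B * real N" using False B by (simp add: algebra_simps)
      finally have "\<rho> ^ (e + 1) \<le> (4 * B * real N) ^ (e + 1)" using \<rho> by (intro power_mono) auto
      also have "\<dots> = (4 * B) ^ (e + 1) * exp 1 * (real N ^ (e + 1) * exp (- 1))"
        by (simp add: power_mult_distrib exp_minus)
      finally have "ennreal (\<rho> ^ (e + 1)) \<le>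
          ennreal ((4 * B) ^ (e + 1) * exp 1) * ennreal (real N ^ (e + 1) * exp (- 1))"
        using B by (subst ennreal_mult[symmetric]) (auto intro: ennreal_leI)
      also have "\<dots> \<le> ennreal ((4 * B) ^ (e + 1) * exp 1) * ?S"
      proof (intro mult_left_mono partial)
        have "B * real (2 * N) \<le> \<rho>" using N(1) B by (simp add: field_simps)
        then have "(B * real (2 * N)) powr \<alpha> \<le> 1 / s" unfolding \<rho>\<alpha>[symmetric] using \<alpha> B by (intro powr_mono2) auto
        then show "s * (B * real (2 * N)) powr \<alpha> \<le> 1" using 2 by (simp add: field_simps)
      qed simp
      finally show ?thesis unfolding lhs by (rule order_trans) simp
    qed
  qed
qed

text \<open>Series and integral are exchanged by nonnegativity, and each term integrates to a term
  of the sum in \<open>regular_sum_bounded\<close>; the additive constant stays finite because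
  \<sigma> has mass 1.\<close>

lemma regular_bounded_negative_moment:
  fixes Y :: "nat \<Rightarrow> 'a::euclidean_space"
  assumes \<alpha>: "0 < \<alpha>" and sm: "schoenberg_measure \<alpha> f \<sigma>" and reg: "delta_regular \<delta> Y"
    and bdd: "generates_bounded_operator (schoenberg_matrix Y f)"
  shows "negative_moment \<sigma> (real (span_dim Y) / \<alpha>) < \<infinity>"
proof -
  interpret prob_space \<sigma> using schoenberg_measureD(1)[OF sm] .
  obtain B E where B: "0 < B"
    and E: "\<And>n. (\<Sum>m<n. real m ^ (span_dim Y - 1) * f (B * (real m + 1))) \<le> E"
    using regular_sum_bounded[OF \<alpha> sm reg bdd] by blast
  define e where "e = span_dim Y - 1"
  have d: "span_dim Y = e + 1"
    using span_dim_pos[of Y] reg by (simp add: e_def delta_regular_def)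
  let ?t = "\<lambda>m s. ennreal (real m ^ e * exp (- s * (B * (real m + 1)) powr \<alpha>))"
  have meas: "?t m \<in> borel_measurable \<sigma>" for m
    by (intro measurable_compose[OF schoenberg_measureD(3)[OF sm] measurable_ennreal]) measurable
  have int: "integrable \<sigma> (\<lambda>s. exp (- s * (B * (real m + 1)) powr \<alpha>))" for m
    by (rule schoenberg_integrable[OF sm]) simp
  have "(\<integral>\<^sup>+s. ?t m s \<partial>\<sigma>) = ennreal (real m ^ e * f (B * (real m + 1)))" for m
  proof -
    have "(\<integral>\<^sup>+s. ?t m s \<partial>\<sigma>) = ennreal (\<integral>s. real m ^ e * exp (- s * (B * (real m + 1)) powr \<alpha>) \<partial>\<sigma>)"
      by (rule nn_integral_eq_integral[OF integrable_mult_right[OF int]]) simp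
    then show ?thesis using B by (simp add: schoenberg_measureD(4)[OF sm])
  qed
  then have "(\<integral>\<^sup>+s. (\<Sum>m. ?t m s) \<partial>\<sigma>) = (\<Sum>m. ennreal (real m ^ e * f (B * (real m + 1))))"
    by (subst nn_integral_suminf[OF meas]) simp
  also have "\<dots> \<le> ennreal E"
  proof (rule suminf_le_const[OF summableI])
    fix n
    have "(\<Sum>m<n. ennreal (real m ^ e * f (B * (real m + 1)))) = ennreal (\<Sum>m<n. real m ^ e * f (B * (real m + 1)))"
      using B by (intro sum_ennreal mult_nonneg_nonneg schoenberg_nonneg[OF sm]) auto
    then show "(\<Sum>m<n. ennreal (real m ^ e * f (B * (real m + 1)))) \<le> ennreal E"
      using E[of n] by (simp add: e_def ennreal_leI)
  qed
  finally have series: "(\<integral>\<^sup>+s. (\<Sum>m. ?t m s) \<partial>\<sigma>) \<le> ennreal E" .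
  have "negative_moment \<sigma> (real (span_dim Y) / \<alpha>) \<le>
      (\<integral>\<^sup>+s. ennreal ((2 * B) ^ (e + 1)) + ennreal ((4 * B) ^ (e + 1) * exp 1) * (\<Sum>m. ?t m s) \<partial>\<sigma>)"
    unfolding negative_moment_def d
    by (intro nn_integral_mono negative_power_le_series \<alpha> B) (simp add: schoenberg_measureD(2)[OF sm])
  also have "\<dots> = ennreal ((2 * B) ^ (e + 1)) + ennreal ((4 * B) ^ (e + 1) * exp 1) * (\<integral>\<^sup>+s. (\<Sum>m. ?t m s) \<partial>\<sigma>)"
  proof -
    have S: "(\<lambda>s. \<Sum>m. ?t m s) \<in> borel_measurable \<sigma>" by (rule borel_measurable_suminf_order[OF meas])
    have const: "(\<integral>\<^sup>+s. c \<partial>\<sigma>) = c" for c by (simp only: nn_integral_const emeasure_space_1 mult_1_right)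
    show ?thesis
      by (subst nn_integral_add)
         (simp_all only: borel_measurable_const borel_measurable_times_ennreal[OF borel_measurable_const S]
           const nn_integral_cmult[OF S])
  qed
  also have "\<dots> \<le> ennreal ((2 * B) ^ (e + 1)) + ennreal ((4 * B) ^ (e + 1) * exp 1) * ennreal E"
    by (intro add_mono mult_left_mono series) auto
  also have "\<dots> < \<infinity>" by (simp add: ennreal_mult_less_top ennreal_add_less_top)
  finally show ?thesis .
qed

text \<open>The first claim is restricted to nonconstant \<open>f\<close> to exclude the unit mass
  at 0: there \<open>f = 1\<close>, and the form of the all-ones matrix vanishes on the difference
  of two unit vectors, so no positive \<open>c\<close> exists. In (iii) the dimension
  \<open>d\<close> is quantified independently of \<open>X\<close>, since \<open>Y\<close> may span
  a space of another dimension.\<close>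

theorem theorem1p7:
  fixes \<alpha> :: real and f :: "real \<Rightarrow> real" and \<sigma> :: "real measure"
    and X :: "nat \<Rightarrow> real ^ 'n"
  assumes "0 < \<alpha>" and "\<alpha> \<le> 2"
    and "f \<in> Phi_infty \<alpha>" and "schoenberg_measure \<alpha> f \<sigma>"
    and "normalized_sequence X" and "separated X"
  shows
    "((\<not> f constant_on {0..} \<longrightarrow> strongly_positive_definite (range X) f) \<and>
      (generates_operator (schoenberg_matrix X f) \<longrightarrow>
         positive_definite_operator (minimal_operator (schoenberg_matrix X f)) \<and>
         invertible_operator (minimal_operator (schoenberg_matrix X f)))) \<and>
     (negative_moment \<sigma> (real (span_dim X) / \<alpha>) < \<infinity> \<longrightarrow>
         generates_bounded_operator (schoenberg_matrix X f) \<and>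
         invertible_operator (minimal_operator (schoenberg_matrix X f))) \<and>
     (\<forall>d. (\<exists>\<delta>>0. \<exists>Y :: nat \<Rightarrow> real ^ 'n. delta_regular \<delta> Y \<and> span_dim Y = d \<and>
              generates_bounded_operator (schoenberg_matrix Y f)) \<longrightarrow>
          negative_moment \<sigma> (real d / \<alpha>) < \<infinity>)"
proof (intro conjI impI allI)
  note sm = assms(4)
  have \<delta>: "0 < d_star X" using assms(6) by (simp add: separated_def)
  show "strongly_positive_definite (range X) f" if nc: "\<not> f constant_on {0..}"
  proof -
    obtain c where "0 < c" "psd_lower_bound (d_star X) (\<lambda>z :: real ^ 'n. f (norm z)) c"
      using schoenberg_lower_bound[OF assms(1,2) sm nc \<delta>, where 'a = "real ^ 'n"] .
    then show ?thesis by (rule strongly_positive_definite_of_lower_bound)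
  qed
  show "positive_definite_operator (minimal_operator (schoenberg_matrix X f))"
    "invertible_operator (minimal_operator (schoenberg_matrix X f))"
    if "generates_operator (schoenberg_matrix X f)"
    by (rule schoenberg_generates_positive[OF assms(1,2) sm assms(6) that])+
  show bdd: "generates_bounded_operator (schoenberg_matrix X f)"
    if "negative_moment \<sigma> (real (span_dim X) / \<alpha>) < \<infinity>"
    by (rule schoenberg_bounded_operator[OF assms(1) sm assms(6) that])
  show "invertible_operator (minimal_operator (schoenberg_matrix X f))"
    if "negative_moment \<sigma> (real (span_dim X) / \<alpha>) < \<infinity>"
    using schoenberg_generates_positive(2)[OF assms(1,2) sm assms(6)] bdd[OF that]
    by (simp add: generates_bounded_operator_def)
  show "negative_moment \<sigma> (real d / \<alpha>) < \<infinity>"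
    if "\<exists>\<delta>>0. \<exists>Y :: nat \<Rightarrow> real ^ 'n. delta_regular \<delta> Y \<and> span_dim Y = d \<and>
      generates_bounded_operator (schoenberg_matrix Y f)" for d
    using that regular_bounded_negative_moment[OF assms(1) sm] by blast
qed

end
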